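(* For every hemiring $R$ and every $n\geq1$, the matrix hemiring $M_n(R)$ satisfies: (i) $\mathcal{R}_{BM}(M_n(R))=M_n(\mathcal{R}_{BM}(R))$; (ii) $J_s(M_n(R))=M_n(J_s(R))$; (iii) $J(M_n(R))=M_n(J(R))$.
   Context: A hemiring $(R,+,\cdot,0)$ consists of a commutative monoid $(R,+,0)$ and a semigroup $(R,\cdot)$ such that multiplication distributes over addition on both sides and $0r=0=r0$ for all $r$ (no multiplicative identity is required). A semiring is a hemiring with a multiplicative identity $1$. Ideals are two-sided and are regarded as hemirings. A left $R$-semimodule is a commutative monoid $(M,+,0_M)$ with a scalar multiplication $R\times M\to M$ satisfying $(rr')m=r(r'm)$, $r(m+m')=rm+rm'$, $(r+r')m=rm+r'm$, $r0_M=0_M=0m$. Write $(0:M)_R=\{r\in R\mid rM=0\}$. Brown-McCoy radical: a hemiring $R$ is ideal-simple if its only ideals are $0$ and $R$. Let $\mathcal{U}\mathbb{S}$ be the class of all hemirings having no nonzero homomorphic image that is an ideal-simple semiring. $\mathcal{R}_{BM}(R)$ is the union of all ideals of $R$ belonging to $\mathcal{U}\mathbb{S}$ (it is the greatest such ideal). $J_s$: a left $R$-semimodule $M$ is simple if $RM\neq0$, its only subsemimodules are $0$ and $M$, and its only semimodule congruences are the diagonal and $M^2$. $J_s(R):=\bigcap(0:M)_R$ over all simple left $R$-semimodules $M$ (equal to $R$ if there are none). Jacobson(-Bourne) radical: a right ideal $I$ of $R$ is right semiregular if for all $i_1,i_2\in I$ there are $j_1,j_2\in I$ with $i_1+j_1+i_1j_1+i_2j_2=i_2+j_2+i_1j_2+i_2j_1$;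 $J(R)$ is the sum of all right semiregular right ideals of $R$. Equivalently (known), $J(R)=\bigcap(0:M)_R$ over all irreducible left $R$-semimodules $M$ (with $J(R)=R$ if there are none), where a nonzero additively cancellative left semimodule $M$ is irreducible if for all $m_1\neq m_2$ and $m$ in $M$ there are $r_1,r_2\in R$ with $m+r_1m_1+r_2m_2=r_1m_2+r_2m_1$. *)

theory Defs
  imports "HOL-Algebra.Ring" "HOL-Algebra.Module"
begin

section \<open>Hemirings and matrix hemirings\<close>

text \<open>
  Hemirings are carried by the \<^typ>\<open>'a ring\<close> record; no axiom mentions its field \<open>one\<close>.
\<close>

locale hemiring = abelian_monoid R for R (structure) +
  assumes mult_closed: "\<lbrakk>x \<in> carrier R; y \<in> carrier R\<rbrakk> \<Longrightarrow> x \<otimes> y \<in> carrier R"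
    and mult_assoc: "\<lbrakk>x \<in> carrier R; y \<in> carrier R; z \<in> carrier R\<rbrakk>
          \<Longrightarrow> (x \<otimes> y) \<otimes> z = x \<otimes> (y \<otimes> z)"
    and distrib_right: "\<lbrakk>x \<in> carrier R; y \<in> carrier R; z \<in> carrier R\<rbrakk>
          \<Longrightarrow> (x \<oplus> y) \<otimes> z = x \<otimes> z \<oplus> y \<otimes> z"
    and distrib_left: "\<lbrakk>x \<in> carrier R; y \<in> carrier R; z \<in> carrier R\<rbrakk>
          \<Longrightarrow> z \<otimes> (x \<oplus> y) = z \<otimes> x \<oplus> z \<otimes> y"
    and zero_mult: "x \<in> carrier R \<Longrightarrow> \<zero> \<otimes> x = \<zero>"
    and mult_zero: "x \<in> carrier R \<Longrightarrow> x \<otimes> \<zero> = \<zero>"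

text \<open>The matrices have entries indexed by pairs \<open>(i, j)\<close> with \<open>i, j < n\<close>.\<close>

definition matrices :: "nat \<Rightarrow> 'a set \<Rightarrow> (nat \<times> nat \<Rightarrow> 'a) set"
  where "matrices n X = ({..<n} \<times> {..<n}) \<rightarrow>\<^sub>E X"

text \<open>
  The field \<open>one\<close> is the identity matrix if \<open>\<one>\<^bsub>R\<^esub>\<close> is an identity of \<open>R\<close>, and irrelevant otherwise.
\<close>

definition matrix_hemiring :: "nat \<Rightarrow> ('a, 'b) ring_scheme \<Rightarrow> (nat \<times> nat \<Rightarrow> 'a) ring"
  where "matrix_hemiring n R =
    \<lparr>carrier = matrices n (carrier R),
     mult = (\<lambda>A B. \<lambda>(i, j) \<in> {..<n} \<times> {..<n}. \<Oplus>\<^bsub>R\<^esub>k\<in>{..<n}. A (i, k) \<otimes>\<^bsub>R\<^esub> B (k, j)),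
     one = (\<lambda>(i, j) \<in> {..<n} \<times> {..<n}. if i = j then \<one>\<^bsub>R\<^esub> else \<zero>\<^bsub>R\<^esub>),
     zero = (\<lambda>(i, j) \<in> {..<n} \<times> {..<n}. \<zero>\<^bsub>R\<^esub>),
     add = (\<lambda>A B. \<lambda>(i, j) \<in> {..<n} \<times> {..<n}. A (i, j) \<oplus>\<^bsub>R\<^esub> B (i, j))\<rparr>"


section \<open>Ideals and the Brown-McCoy radical\<close>

definition right_hemiring_ideal :: "'a set \<Rightarrow> ('a, 'b) ring_scheme \<Rightarrow> bool"
  where "right_hemiring_ideal I R \<longleftrightarrow>
    I \<subseteq> carrier R \<and> \<zero>\<^bsub>R\<^esub> \<in> I \<and> (\<forall>x\<in>I. \<forall>y\<in>I. x \<oplus>\<^bsub>R\<^esub> y \<in> I) \<and>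
    (\<forall>x\<in>I. \<forall>r\<in>carrier R. x \<otimes>\<^bsub>R\<^esub> r \<in> I)"

definition hemiring_ideal :: "'a set \<Rightarrow> ('a, 'b) ring_scheme \<Rightarrow> bool"
  where "hemiring_ideal I R \<longleftrightarrow>
    right_hemiring_ideal I R \<and> (\<forall>x\<in>I. \<forall>r\<in>carrier R. r \<otimes>\<^bsub>R\<^esub> x \<in> I)"

definition ideal_simple :: "('a, 'b) ring_scheme \<Rightarrow> bool"
  where "ideal_simple R \<longleftrightarrow>
    (\<forall>I. hemiring_ideal I R \<longrightarrow> I = {\<zero>\<^bsub>R\<^esub>} \<or> I = carrier R)"

definition hemiring_hom :: "('a, 'c) ring_scheme \<Rightarrow> ('b, 'd) ring_scheme \<Rightarrow> ('a \<Rightarrow> 'b) set"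
  where "hemiring_hom R S =
    {h \<in> carrier R \<rightarrow> carrier S. h \<zero>\<^bsub>R\<^esub> = \<zero>\<^bsub>S\<^esub> \<and>
      (\<forall>x\<in>carrier R. \<forall>y\<in>carrier R.
        h (x \<oplus>\<^bsub>R\<^esub> y) = h x \<oplus>\<^bsub>S\<^esub> h y \<and> h (x \<otimes>\<^bsub>R\<^esub> y) = h x \<otimes>\<^bsub>S\<^esub> h y)}"

text \<open>
  The class \<open>\<U>\<S>\<close>. Homomorphic images are taken with elements in the type of \<open>R\<close>, which is no
  restriction: see \<open>in_US_no_image\<close> below.
\<close>

definition in_US :: "('a, 'b) ring_scheme \<Rightarrow> bool"
  where "in_US R \<longleftrightarrow> hemiring R \<and>
    \<not> (\<exists>(S :: 'a ring) h. h \<in> hemiring_hom R S \<and> h ` carrier R = carrier S \<and>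
         carrier S \<noteq> {\<zero>\<^bsub>S\<^esub>} \<and> semiring S \<and> ideal_simple S)"

definition brown_mccoy_radical :: "('a, 'b) ring_scheme \<Rightarrow> 'a set"
  where "brown_mccoy_radical R =
    \<Union> {I. hemiring_ideal I R \<and> in_US (R\<lparr>carrier := I\<rparr>)}"


section \<open>Semimodules and the radical $J_s$\<close>

text \<open>Of the \<^typ>\<open>('a, 'm) module\<close> record, the fields \<open>mult\<close> and \<open>one\<close> are not used.\<close>

locale left_semimodule = R?: hemiring R + M?: abelian_monoid M
  for R (structure) and M (structure) +
  assumes smult_closed: "\<lbrakk>r \<in> carrier R; x \<in> carrier M\<rbrakk> \<Longrightarrow> r \<odot>\<^bsub>M\<^esub> x \<in> carrier M"
    and smult_assoc: "\<lbrakk>r \<in> carrier R; s \<in> carrier R; x \<in> carrier M\<rbrakk>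
          \<Longrightarrow> (r \<otimes> s) \<odot>\<^bsub>M\<^esub> x = r \<odot>\<^bsub>M\<^esub> (s \<odot>\<^bsub>M\<^esub> x)"
    and smult_distrib_left: "\<lbrakk>r \<in> carrier R; x \<in> carrier M; y \<in> carrier M\<rbrakk>
          \<Longrightarrow> r \<odot>\<^bsub>M\<^esub> (x \<oplus>\<^bsub>M\<^esub> y) = r \<odot>\<^bsub>M\<^esub> x \<oplus>\<^bsub>M\<^esub> r \<odot>\<^bsub>M\<^esub> y"
    and smult_distrib_right: "\<lbrakk>r \<in> carrier R; s \<in> carrier R; x \<in> carrier M\<rbrakk>
          \<Longrightarrow> (r \<oplus> s) \<odot>\<^bsub>M\<^esub> x = r \<odot>\<^bsub>M\<^esub> x \<oplus>\<^bsub>M\<^esub> s \<odot>\<^bsub>M\<^esub> x"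
    and smult_zero: "r \<in> carrier R \<Longrightarrow> r \<odot>\<^bsub>M\<^esub> \<zero>\<^bsub>M\<^esub> = \<zero>\<^bsub>M\<^esub>"
    and zero_smult: "x \<in> carrier M \<Longrightarrow> \<zero> \<odot>\<^bsub>M\<^esub> x = \<zero>\<^bsub>M\<^esub>"

definition subsemimodule :: "('a, 'b) ring_scheme \<Rightarrow> ('a, 'm, 'c) module_scheme \<Rightarrow> 'm set \<Rightarrow> bool"
  where "subsemimodule R M N \<longleftrightarrow>
    N \<subseteq> carrier M \<and> \<zero>\<^bsub>M\<^esub> \<in> N \<and> (\<forall>x\<in>N. \<forall>y\<in>N. x \<oplus>\<^bsub>M\<^esub> y \<in> N) \<and>
    (\<forall>r\<in>carrier R. \<forall>x\<in>N. r \<odot>\<^bsub>M\<^esub> x \<in> N)"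

definition semimodule_congruence ::
  "('a, 'b) ring_scheme \<Rightarrow> ('a, 'm, 'c) module_scheme \<Rightarrow> ('m \<times> 'm) set \<Rightarrow> bool"
  where "semimodule_congruence R M \<theta> \<longleftrightarrow>
    equiv (carrier M) \<theta> \<and>
    (\<forall>(x, x')\<in>\<theta>. \<forall>(y, y')\<in>\<theta>. (x \<oplus>\<^bsub>M\<^esub> y, x' \<oplus>\<^bsub>M\<^esub> y') \<in> \<theta>) \<and>
    (\<forall>r\<in>carrier R. \<forall>(x, x')\<in>\<theta>. (r \<odot>\<^bsub>M\<^esub> x, r \<odot>\<^bsub>M\<^esub> x') \<in> \<theta>)"

definition simple_semimodule :: "('a, 'b) ring_scheme \<Rightarrow> ('a, 'm, 'c) module_scheme \<Rightarrow> bool"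
  where "simple_semimodule R M \<longleftrightarrow>
    left_semimodule R M \<and>
    (\<exists>r\<in>carrier R. \<exists>x\<in>carrier M. r \<odot>\<^bsub>M\<^esub> x \<noteq> \<zero>\<^bsub>M\<^esub>) \<and>
    (\<forall>N. subsemimodule R M N \<longrightarrow> N = {\<zero>\<^bsub>M\<^esub>} \<or> N = carrier M) \<and>
    (\<forall>\<theta>. semimodule_congruence R M \<theta> \<longrightarrow>
       \<theta> = Id_on (carrier M) \<or> \<theta> = carrier M \<times> carrier M)"

definition annihilator :: "('a, 'b) ring_scheme \<Rightarrow> ('a, 'm, 'c) module_scheme \<Rightarrow> 'a set"
  where "annihilator R M = {r \<in> carrier R. \<forall>x\<in>carrier M. r \<odot>\<^bsub>M\<^esub> x = \<zero>\<^bsub>M\<^esub>}"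

text \<open>
  The intersection is over simple semimodules with elements in the type of \<open>R\<close>. This loses nothing,
  since every simple semimodule is an image of \<open>R\<close>: see \<open>Js_subset_annihilator\<close> below.
\<close>

definition Js :: "('a, 'b) ring_scheme \<Rightarrow> 'a set"
  where "Js R = {r \<in> carrier R.
    \<forall>M :: ('a, 'a) module. simple_semimodule R M \<longrightarrow> r \<in> annihilator R M}"


section \<open>The Jacobson-Bourne radical\<close>

definition right_semiregular :: "('a, 'b) ring_scheme \<Rightarrow> 'a set \<Rightarrow> bool"
  where "right_semiregular R I \<longleftrightarrow>
    (\<forall>i1\<in>I. \<forall>i2\<in>I. \<exists>j1\<in>I. \<exists>j2\<in>I.
       i1 \<oplus>\<^bsub>R\<^esub> j1 \<oplus>\<^bsub>R\<^esub> (i1 \<otimes>\<^bsub>R\<^esub> j1) \<oplus>\<^bsub>R\<^esub> (i2 \<otimes>\<^bsub>R\<^esub> j2) =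
       i2 \<oplus>\<^bsub>R\<^esub> j2 \<oplus>\<^bsub>R\<^esub> (i1 \<otimes>\<^bsub>R\<^esub> j2) \<oplus>\<^bsub>R\<^esub> (i2 \<otimes>\<^bsub>R\<^esub> j1))"

definition ideal_sum :: "('a, 'b) ring_scheme \<Rightarrow> 'a set set \<Rightarrow> 'a set"
  where "ideal_sum R \<I> =
    {(\<Oplus>\<^bsub>R\<^esub>k\<in>{..<m}. x k) | (m :: nat) x. \<forall>k<m. x k \<in> \<Union>\<I>}"

definition jacobson_radical :: "('a, 'b) ring_scheme \<Rightarrow> 'a set"
  where "jacobson_radical R =
    ideal_sum R {I. right_hemiring_ideal I R \<and> right_semiregular R I}"


section \<open>Independence of the radicals from the element types\<close>

lemma in_US_no_image:
  fixes R :: "('a, 'b) ring_scheme" and S :: "('c, 'd) ring_scheme"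
  assumes US: "in_US R" and h: "h \<in> hemiring_hom R S" and surj: "h ` carrier R = carrier S"
    and nz: "carrier S \<noteq> {\<zero>\<^bsub>S\<^esub>}" and S: "semiring S"
  shows "\<not> ideal_simple S"
proof
  assume simple: "ideal_simple S"
  interpret S: semiring S by (rule S)
  define g where "g = inv_into (carrier R) h"
  have hg [simp]: "h (g y) = y" if "y \<in> carrier S" for y
    using that surj by (simp add: g_def f_inv_into_f)
  define T :: "'a ring" where "T =
    \<lparr>carrier = g ` carrier S, mult = (\<lambda>x y. g (h x \<otimes>\<^bsub>S\<^esub> h y)), one = g \<one>\<^bsub>S\<^esub>,
     zero = g \<zero>\<^bsub>S\<^esub>, add = (\<lambda>x y. g (h x \<oplus>\<^bsub>S\<^esub> h y))\<rparr>"
  have am: "abelian_monoid T"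
    by (rule abelian_monoidI) (auto simp: T_def S.a_ac)
  have mo: "monoid T"
    by (rule monoidI) (auto simp: T_def S.m_assoc)
  have T: "semiring T"
    using am mo by (intro semiring.intro semiring_axioms.intro)
      (auto simp: T_def S.l_distr S.r_distr)
  have "ideal_simple T"
    unfolding ideal_simple_def
  proof (intro allI impI)
    fix I assume I: "hemiring_ideal I T"
    then have sub: "I \<subseteq> g ` carrier S"
      by (simp add: hemiring_ideal_def right_hemiring_ideal_def T_def)
    have mem: "y \<in> h ` I \<longleftrightarrow> y \<in> carrier S \<and> g y \<in> I" for y
    proof
      assume "y \<in> h ` I"
      then obtain z where "z \<in> carrier S" "g z \<in> I" "y = h (g z)" using sub by auto
      then show "y \<in> carrier S \<and> g y \<in> I" by simp
    next
      assume "y \<in> carrier S \<and> g y \<in> I"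
      then show "y \<in> h ` I" using hg[of y] by (metis image_eqI)
    qed
    have "hemiring_ideal (h ` I) S"
      unfolding hemiring_ideal_def right_hemiring_ideal_def
    proof (intro conjI ballI)
      show "h ` I \<subseteq> carrier S" using mem by blast
      show "\<zero>\<^bsub>S\<^esub> \<in> h ` I"
        using I by (simp add: mem hemiring_ideal_def right_hemiring_ideal_def T_def)
    next
      fix x y assume xy: "x \<in> h ` I" "y \<in> h ` I"
      then have "g x \<oplus>\<^bsub>T\<^esub> g y \<in> I"
        using I by (simp add: mem hemiring_ideal_def right_hemiring_ideal_def)
      then show "x \<oplus>\<^bsub>S\<^esub> y \<in> h ` I" using xy by (simp add: mem T_def)
    next
      fix x r assume x: "x \<in> h ` I" and r: "r \<in> carrier S"
      then have "g r \<in> carrier T" by (simp add: T_def)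
      then have "g x \<otimes>\<^bsub>T\<^esub> g r \<in> I" "g r \<otimes>\<^bsub>T\<^esub> g x \<in> I"
        using I x by (simp_all add: mem hemiring_ideal_def right_hemiring_ideal_def)
      then show "x \<otimes>\<^bsub>S\<^esub> r \<in> h ` I" "r \<otimes>\<^bsub>S\<^esub> x \<in> h ` I"
        using x r by (simp_all add: mem T_def)
    qed
    then have "h ` I = {\<zero>\<^bsub>S\<^esub>} \<or> h ` I = carrier S"
      using simple by (auto simp: ideal_simple_def)
    moreover have "I = g ` h ` I"
      using sub by (force simp: image_image)
    ultimately show "I = {\<zero>\<^bsub>T\<^esub>} \<or> I = carrier T"
      by (auto simp: T_def)
  qed
  moreover have "(\<lambda>x. g (h x)) \<in> hemiring_hom R T"
    using h by (auto simp: hemiring_hom_def T_def Pi_iff)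
  moreover have "(\<lambda>x. g (h x)) ` carrier R = carrier T"
    using image_image[of g h "carrier R"] surj by (simp add: T_def)
  moreover have "carrier T \<noteq> {\<zero>\<^bsub>T\<^esub>}"
  proof
    assume "carrier T = {\<zero>\<^bsub>T\<^esub>}"
    then have "h ` g ` carrier S = h ` {g \<zero>\<^bsub>S\<^esub>}" by (simp add: T_def)
    then show False using nz by (simp add: image_image)
  qed
  ultimately show False
    using US T unfolding in_US_def by blast
qed

lemma simple_semimodule_transfer:
  fixes R :: "('a, 'b) ring_scheme" and M :: "('a, 'm, 'c) module_scheme"
  assumes M: "simple_semimodule R M"
  shows "\<exists>M' :: ('a, 'a) module. simple_semimodule R M' \<and> annihilator R M' = annihilator R M"
proof -
  interpret left_semimodule R M using M by (simp add: simple_semimodule_def)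
  have sub: "N = {\<zero>\<^bsub>M\<^esub>} \<or> N = carrier M" if "subsemimodule R M N" for N
    using M that by (simp add: simple_semimodule_def)
  obtain r m where rm: "r \<in> carrier R" "m \<in> carrier M" "r \<odot>\<^bsub>M\<^esub> m \<noteq> \<zero>\<^bsub>M\<^esub>"
    using M by (auto simp: simple_semimodule_def)
  define h where "h = (\<lambda>r. r \<odot>\<^bsub>M\<^esub> m)"
  have "subsemimodule R M (h ` carrier R)"
    unfolding subsemimodule_def
  proof (intro conjI ballI)
    show "h ` carrier R \<subseteq> carrier M" using rm by (auto simp: h_def smult_closed)
    show "\<zero>\<^bsub>M\<^esub> \<in> h ` carrier R"
      using zero_smult[OF rm(2)] R.zero_closed unfolding h_def by (metis image_eqI)
    show "x \<oplus>\<^bsub>M\<^esub> y \<in> h ` carrier R" if "x \<in> h ` carrier R" "y \<in> h ` carrier R" for x y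
      using that rm smult_distrib_right[symmetric] by (auto simp: h_def)
    show "s \<odot>\<^bsub>M\<^esub> x \<in> h ` carrier R" if "s \<in> carrier R" "x \<in> h ` carrier R" for s x
      using that rm smult_assoc[symmetric] by (auto simp: h_def mult_closed)
  qed
  moreover have "h ` carrier R \<noteq> {\<zero>\<^bsub>M\<^esub>}" using rm by (auto simp: h_def)
  ultimately have surj: "h ` carrier R = carrier M" using sub by blast
  define g where "g = inv_into (carrier R) h"
  have hg [simp]: "h (g y) = y" if "y \<in> carrier M" for y
    using that surj by (simp add: g_def f_inv_into_f)
  have g_inj [simp]: "g x = g y \<longleftrightarrow> x = y" if "x \<in> carrier M" "y \<in> carrier M" for x y
    using that by (metis hg)
  define T :: "('a, 'a) module" where "T =
    \<lparr>carrier = g ` carrier M, mult = undefined, one = undefined,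
     zero = g \<zero>\<^bsub>M\<^esub>, add = (\<lambda>x y. g (h x \<oplus>\<^bsub>M\<^esub> h y)), smult = (\<lambda>r x. g (r \<odot>\<^bsub>M\<^esub> h x))\<rparr>"
  have "abelian_monoid T"
    by (rule abelian_monoidI) (auto simp: T_def M.a_ac)
  then have T: "left_semimodule R T"
    using R.hemiring_axioms
    by (intro left_semimodule.intro left_semimodule_axioms.intro)
      (auto simp: T_def smult_closed smult_assoc smult_distrib_left smult_distrib_right
        smult_zero zero_smult)
  have "\<exists>r\<in>carrier R. \<exists>x\<in>carrier T. r \<odot>\<^bsub>T\<^esub> x \<noteq> \<zero>\<^bsub>T\<^esub>"
    using rm by (auto simp: T_def smult_closed)
  moreover have "N = {\<zero>\<^bsub>T\<^esub>} \<or> N = carrier T" if N: "subsemimodule R T N" for N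
  proof -
    have sb: "N \<subseteq> g ` carrier M" using N by (simp add: subsemimodule_def T_def)
    have mem: "y \<in> h ` N \<longleftrightarrow> y \<in> carrier M \<and> g y \<in> N" for y
    proof
      assume "y \<in> h ` N"
      then obtain z where "z \<in> carrier M" "g z \<in> N" "y = h (g z)" using sb by auto
      then show "y \<in> carrier M \<and> g y \<in> N" by simp
    next
      assume "y \<in> carrier M \<and> g y \<in> N"
      then show "y \<in> h ` N" using hg[of y] by (metis image_eqI)
    qed
    have "subsemimodule R M (h ` N)"
      unfolding subsemimodule_def
    proof (intro conjI ballI)
      show "h ` N \<subseteq> carrier M" using mem by blast
      show "\<zero>\<^bsub>M\<^esub> \<in> h ` N"
        using N by (simp add: mem subsemimodule_def T_def)
    next
      fix x y assume xy: "x \<in> h ` N" "y \<in> h ` N"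
      then have "g x \<oplus>\<^bsub>T\<^esub> g y \<in> N" using N by (simp add: mem subsemimodule_def)
      then show "x \<oplus>\<^bsub>M\<^esub> y \<in> h ` N" using xy by (simp add: mem T_def)
    next
      fix r x assume r: "r \<in> carrier R" and x: "x \<in> h ` N"
      then have "r \<odot>\<^bsub>T\<^esub> g x \<in> N" using N by (simp add: mem subsemimodule_def)
      then show "r \<odot>\<^bsub>M\<^esub> x \<in> h ` N" using r x by (simp add: mem T_def smult_closed)
    qed
    then have "h ` N = {\<zero>\<^bsub>M\<^esub>} \<or> h ` N = carrier M" by (rule sub)
    moreover have "N = g ` h ` N"
      using sb by (force simp: image_image)
    ultimately show ?thesis by (auto simp: T_def)
  qed
  moreover have "\<theta> = Id_on (carrier T) \<or> \<theta> = carrier T \<times> carrier T"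
    if \<theta>: "semimodule_congruence R T \<theta>" for \<theta>
  proof -
    define \<eta> where "\<eta> = {(x, y). x \<in> carrier M \<and> y \<in> carrier M \<and> (g x, g y) \<in> \<theta>}"
    have eq: "equiv (g ` carrier M) \<theta>"
      using \<theta> by (simp add: semimodule_congruence_def T_def)
    have "equiv (carrier M) \<eta>"
    proof (rule equivI)
      show "\<eta> \<subseteq> carrier M \<times> carrier M" by (auto simp: \<eta>_def)
      show "refl_on (carrier M) \<eta>"
        using eq by (auto simp: \<eta>_def equiv_def refl_on_def)
      show "sym \<eta>" using eq by (auto simp: \<eta>_def equiv_def sym_def)
      show "trans \<eta>" using eq unfolding \<eta>_def equiv_def trans_def by blast
    qed
    moreover have "(x \<oplus>\<^bsub>M\<^esub> y, x' \<oplus>\<^bsub>M\<^esub> y') \<in> \<eta>" if "(x, x') \<in> \<eta>" "(y, y') \<in> \<eta>" for x x' y y'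
    proof -
      have c: "x \<in> carrier M" "x' \<in> carrier M" "y \<in> carrier M" "y' \<in> carrier M"
        and "(g x, g x') \<in> \<theta>" "(g y, g y') \<in> \<theta>"
        using that by (auto simp: \<eta>_def)
      then have "(g x \<oplus>\<^bsub>T\<^esub> g y, g x' \<oplus>\<^bsub>T\<^esub> g y') \<in> \<theta>"
        using \<theta> unfolding semimodule_congruence_def by fast
      then show ?thesis using c by (simp add: \<eta>_def T_def)
    qed
    moreover have "(s \<odot>\<^bsub>M\<^esub> x, s \<odot>\<^bsub>M\<^esub> x') \<in> \<eta>" if s: "s \<in> carrier R" and x: "(x, x') \<in> \<eta>" for s x x'
    proof -
      have c: "x \<in> carrier M" "x' \<in> carrier M" and "(g x, g x') \<in> \<theta>"
        using x by (auto simp: \<eta>_def)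
      then have "(s \<odot>\<^bsub>T\<^esub> g x, s \<odot>\<^bsub>T\<^esub> g x') \<in> \<theta>"
        using \<theta> s unfolding semimodule_congruence_def by fast
      then show ?thesis using c s by (simp add: \<eta>_def T_def smult_closed)
    qed
    ultimately have "semimodule_congruence R M \<eta>"
      unfolding semimodule_congruence_def by blast
    then have "\<eta> = Id_on (carrier M) \<or> \<eta> = carrier M \<times> carrier M"
      using M by (auto simp: simple_semimodule_def)
    moreover have "\<theta> = map_prod g g ` \<eta>"
    proof -
      have "\<theta> \<subseteq> g ` carrier M \<times> g ` carrier M"
        using eq by (auto simp: equiv_def refl_on_def)
      then have "p \<in> map_prod g g ` \<eta>" if "p \<in> \<theta>" for p
        using that unfolding \<eta>_def by (cases p) blast
      moreover have "map_prod g g ` \<eta> \<subseteq> \<theta>" by (auto simp: \<eta>_def)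
      ultimately show ?thesis by blast
    qed
    moreover have "map_prod g g ` Id_on (carrier M) = Id_on (g ` carrier M)" by force
    moreover have "map_prod g g ` (carrier M \<times> carrier M) = g ` carrier M \<times> g ` carrier M" by force
    ultimately show ?thesis by (auto simp: T_def)
  qed
  ultimately have "simple_semimodule R T"
    using T by (simp add: simple_semimodule_def)
  moreover have "annihilator R T = annihilator R M"
    by (auto simp: annihilator_def T_def smult_closed)
  ultimately show ?thesis by blast
qed

lemma Js_subset_annihilator:
  fixes R :: "('a, 'b) ring_scheme" and M :: "('a, 'm, 'c) module_scheme"
  assumes "simple_semimodule R M"
  shows "Js R \<subseteq> annihilator R M"
  using simple_semimodule_transfer[OF assms] by (auto simp: Js_def)

end

theory Submission
  imports Defs
begin

text \<open>
  Over a ring with identity, \<open>R\<close> is the corner of \<open>M\<^sub>n(R)\<close> at the idempotent \<open>e\<^sub>p\<^sub>p\<close>, and each radical of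
  \<open>M\<^sub>n(R)\<close> is compared with that of \<open>R\<close> by cutting down to this corner and by building matrices over
  structures for \<open>R\<close>. A hemiring need not contain an identity, so \<open>e\<^sub>p\<^sub>p\<close> is not available as a
  matrix. What is left of it are the projections of a matrix to one row or one column, linked by
  \<open>A (e\<^sub>p\<^sub>p B) = (A e\<^sub>p\<^sub>p) B\<close> (\<open>mult_row_part\<close>), and the work is to see that they suffice.

  Brown--McCoy radical. It is the intersection of the kernels of the maps onto nonzero ideal-simple
  semirings (\<open>brown_mccoy_radical_killed\<close>, \<open>brown_mccoy_radicalI\<close>). Such a map \<open>h\<close> on \<open>R\<close> induces
  one on \<open>M\<^sub>n(R)\<close> entry by entry. Conversely, for a map \<open>H\<close> from \<open>M\<^sub>n(R)\<close> onto \<open>S\<close>, the identity of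
  \<open>S\<close> allows the projections to descend to \<open>S\<close>, and the corner of \<open>S\<close> is zero or an ideal-simple
  semiring image of \<open>R\<close> (\<open>simple_semiring_image_corner\<close>). So \<open>H\<close> kills the matrices \<open>r e\<^sub>p\<^sub>p\<close> with
  \<open>r\<close> in the radical of \<open>R\<close>, and then all matrices over the radical.

  The radical \<open>J\<^sub>s\<close> goes along the same lines. The columns over a simple semimodule \<open>M\<close> form a simple
  semimodule over \<open>M\<^sub>n(R)\<close>. Conversely, in a simple semimodule \<open>V\<close> over \<open>M\<^sub>n(R)\<close>, elements on which all
  matrices act equally are equal. This lets the row projection descend to \<open>V\<close>, and the corner of
  \<open>V\<close> is zero or simple over \<open>R\<close> (\<open>Js_diagonal_unit\<close>).

  Jacobson--Bourne radical. For a right ideal, to be semiregular means that the formal differences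
  \<open>p = a - b\<close> of its elements have a quasi-inverse: \<open>p + q + p q = 0\<close>. With pairs in place of
  differences, the classical arguments for rings apply: there is a greatest semiregular right ideal,
  it is two-sided and contains every \<open>x\<close> for which all \<open>r x s\<close> belong to it
  (\<open>sandwich_in_jacobson_radical\<close>). The matrices over \<open>J(R)\<close> with a single nonzero row form a
  semiregular right ideal (\<open>row_in_jacobson_radical\<close>), and these rows add up to all matrices over
  \<open>J(R)\<close>. For the other inclusion, the elements \<open>y\<close> with \<open>y e\<^sub>i\<^sub>i\<close> in \<open>J(M\<^sub>n(R))\<close> form a semiregular right
  ideal of \<open>R\<close>, which contains \<open>r A\<^sub>i\<^sub>j s\<close> for every \<open>A\<close> in \<open>J(M\<^sub>n(R))\<close>.
\<close>


section \<open>Finite sums\<close>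

lemma (in abelian_monoid) finsum_swap:
  assumes "finite A" "finite B" "\<And>i j. i \<in> A \<Longrightarrow> j \<in> B \<Longrightarrow> f i j \<in> carrier G"
  shows "(\<Oplus>i\<in>A. \<Oplus>j\<in>B. f i j) = (\<Oplus>j\<in>B. \<Oplus>i\<in>A. f i j)"
  using assms(1,3)
proof (induction A rule: finite_induct)
  case empty
  show ?case by simp
next
  case (insert a A)
  then have "(\<Oplus>j\<in>B. f a j \<oplus> (\<Oplus>i\<in>A. f i j)) = (\<Oplus>j\<in>B. f a j) \<oplus> (\<Oplus>j\<in>B. \<Oplus>i\<in>A. f i j)"
    by (intro finsum_addf) auto
  moreover have "(\<Oplus>j\<in>B. \<Oplus>i\<in>insert a A. f i j) = (\<Oplus>j\<in>B. f a j \<oplus> (\<Oplus>i\<in>A. f i j))"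
    using insert by (intro finsum_cong) (auto simp: simp_implies_def)
  ultimately show ?case using insert by (simp add: Pi_iff)
qed

lemma (in abelian_monoid) finsum_mem_submonoid:
  assumes "finite A" "Z \<subseteq> carrier G" "\<zero> \<in> Z" "\<And>x y. x \<in> Z \<Longrightarrow> y \<in> Z \<Longrightarrow> x \<oplus> y \<in> Z"
    and "\<And>i. i \<in> A \<Longrightarrow> f i \<in> Z"
  shows "(\<Oplus>i\<in>A. f i) \<in> Z"
  using assms(1,5)
proof (induction A rule: finite_induct)
  case (insert a A)
  then have "f \<in> A \<rightarrow> carrier G" "f a \<in> carrier G" using assms(2) by auto
  then show ?case using insert assms(4) by simp
qed (use assms(3) in simp)

lemma (in abelian_monoid) finsum_only:
  assumes "finite A" "k \<in> A" "f k \<in> carrier G" "\<And>i. i \<in> A \<Longrightarrow> i \<noteq> k \<Longrightarrow> f i = \<zero>"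
  shows "(\<Oplus>i\<in>A. f i) = f k"
proof -
  have "(\<Oplus>i\<in>A. f i) = (\<Oplus>i\<in>A. if k = i then f i else \<zero>)"
    using assms by (intro finsum_cong') auto
  then show ?thesis
    using assms finsum_singleton[of k A f] by (cases "f \<in> A \<rightarrow> carrier G") force+
qed

context left_semimodule
begin

lemma smult_finsum:
  assumes "finite A" "r \<in> carrier R" "\<And>i. i \<in> A \<Longrightarrow> f i \<in> carrier M"
  shows "r \<odot>\<^bsub>M\<^esub> (\<Oplus>\<^bsub>M\<^esub>i\<in>A. f i) = (\<Oplus>\<^bsub>M\<^esub>i\<in>A. r \<odot>\<^bsub>M\<^esub> f i)"
  using assms(1,3)
  by (induction A rule: finite_induct)
    (auto simp: assms(2) smult_zero smult_distrib_left smult_closed Pi_iff)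

lemma finsum_smult:
  assumes "finite A" "x \<in> carrier M" "\<And>i. i \<in> A \<Longrightarrow> f i \<in> carrier R"
  shows "(\<Oplus>i\<in>A. f i) \<odot>\<^bsub>M\<^esub> x = (\<Oplus>\<^bsub>M\<^esub>i\<in>A. f i \<odot>\<^bsub>M\<^esub> x)"
  using assms(1,3)
  by (induction A rule: finite_induct)
    (auto simp: assms(2) zero_smult smult_distrib_right smult_closed Pi_iff)

text \<open>
  Associativity of matrix multiplication, for one row \<open>a\<close>, a matrix \<open>B\<close> and a column \<open>v\<close>. With
  entries of \<open>v\<close> in a semimodule it covers both products of three matrices (take \<open>R\<close> itself) and the
  action of matrices on columns.
\<close>

lemma row_matrix_column_assoc:
  assumes "finite I" "finite K"
    and "\<And>i. i \<in> I \<Longrightarrow> a i \<in> carrier R" "\<And>i k. i \<in> I \<Longrightarrow> k \<in> K \<Longrightarrow> B i k \<in> carrier R"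
    and "\<And>k. k \<in> K \<Longrightarrow> v k \<in> carrier M"
  shows "(\<Oplus>\<^bsub>M\<^esub>k\<in>K. (\<Oplus>i\<in>I. a i \<otimes> B i k) \<odot>\<^bsub>M\<^esub> v k) = (\<Oplus>\<^bsub>M\<^esub>i\<in>I. a i \<odot>\<^bsub>M\<^esub> (\<Oplus>\<^bsub>M\<^esub>k\<in>K. B i k \<odot>\<^bsub>M\<^esub> v k))"
proof -
  have "(\<Oplus>\<^bsub>M\<^esub>k\<in>K. (\<Oplus>i\<in>I. a i \<otimes> B i k) \<odot>\<^bsub>M\<^esub> v k) = (\<Oplus>\<^bsub>M\<^esub>k\<in>K. \<Oplus>\<^bsub>M\<^esub>i\<in>I. a i \<odot>\<^bsub>M\<^esub> (B i k \<odot>\<^bsub>M\<^esub> v k))"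
    using assms by (intro M.finsum_cong')
      (auto simp: finsum_smult smult_assoc mult_closed smult_closed intro!: M.finsum_cong' M.finsum_closed)
  also have "\<dots> = (\<Oplus>\<^bsub>M\<^esub>i\<in>I. \<Oplus>\<^bsub>M\<^esub>k\<in>K. a i \<odot>\<^bsub>M\<^esub> (B i k \<odot>\<^bsub>M\<^esub> v k))"
    using assms by (intro M.finsum_swap) (auto simp: smult_closed)
  also have "\<dots> = (\<Oplus>\<^bsub>M\<^esub>i\<in>I. a i \<odot>\<^bsub>M\<^esub> (\<Oplus>\<^bsub>M\<^esub>k\<in>K. B i k \<odot>\<^bsub>M\<^esub> v k))"
    using assms by (intro M.finsum_cong')
      (auto simp: smult_finsum smult_closed intro!: M.finsum_closed)
  finally show ?thesis .
qed

end

definition regular_semimodule :: "('a, 'b) ring_scheme \<Rightarrow> ('a, 'a) module"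
  where "regular_semimodule R =
    \<lparr>carrier = carrier R, mult = mult R, one = one R, zero = zero R, add = add R, smult = mult R\<rparr>"

lemma finsum_regular_semimodule [simp]: "finsum (regular_semimodule R) f A = finsum R f A"
  by (simp add: finsum_def finprod_def regular_semimodule_def)

lemma (in hemiring) left_semimodule_regular: "left_semimodule R (regular_semimodule R)"
proof -
  have "abelian_monoid (regular_semimodule R)"
    by (rule abelian_monoidI) (auto simp: regular_semimodule_def a_ac)
  then show ?thesis
    using hemiring_axioms
    by (intro left_semimodule.intro left_semimodule_axioms.intro)
      (auto simp: regular_semimodule_def mult_closed mult_assoc distrib_left distrib_right
        zero_mult mult_zero)
qed


section \<open>Matrices\<close>

lemma matrices_entry: "A \<in> matrices n X \<Longrightarrow> i < n \<Longrightarrow> j < n \<Longrightarrow> A (i, j) \<in> X"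
  by (auto simp: matrices_def)

lemma matrices_restrictI:
  "(\<And>i j. i < n \<Longrightarrow> j < n \<Longrightarrow> f i j \<in> X) \<Longrightarrow> (\<lambda>(i, j)\<in>{..<n} \<times> {..<n}. f i j) \<in> matrices n X"
  by (auto simp: matrices_def)

lemma carrier_matrix_hemiring [simp]: "carrier (matrix_hemiring n R) = matrices n (carrier R)"
  by (simp add: matrix_hemiring_def)

lemma matrix_zero_entry [simp]: "i < n \<Longrightarrow> j < n \<Longrightarrow> \<zero>\<^bsub>matrix_hemiring n R\<^esub> (i, j) = \<zero>\<^bsub>R\<^esub>"
  by (simp add: matrix_hemiring_def)

lemma matrix_add_entry [simp]:
  "i < n \<Longrightarrow> j < n \<Longrightarrow> (A \<oplus>\<^bsub>matrix_hemiring n R\<^esub> B) (i, j) = A (i, j) \<oplus>\<^bsub>R\<^esub> B (i, j)"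
  by (simp add: matrix_hemiring_def)

lemma matrix_mult_entry:
  "i < n \<Longrightarrow> j < n \<Longrightarrow>
    (A \<otimes>\<^bsub>matrix_hemiring n R\<^esub> B) (i, j) = (\<Oplus>\<^bsub>R\<^esub>k\<in>{..<n}. A (i, k) \<otimes>\<^bsub>R\<^esub> B (k, j))"
  by (simp add: matrix_hemiring_def)

lemma matrix_one_entry:
  "i < n \<Longrightarrow> j < n \<Longrightarrow> \<one>\<^bsub>matrix_hemiring n R\<^esub> (i, j) = (if i = j then \<one>\<^bsub>R\<^esub> else \<zero>\<^bsub>R\<^esub>)"
  by (simp add: matrix_hemiring_def)

definition matrix_unit :: "('a, 'b) ring_scheme \<Rightarrow> nat \<Rightarrow> nat \<Rightarrow> nat \<Rightarrow> 'a \<Rightarrow> nat \<times> nat \<Rightarrow> 'a"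
  where "matrix_unit R n p q r =
    (\<lambda>(i, j)\<in>{..<n} \<times> {..<n}. if i = p \<and> j = q then r else \<zero>\<^bsub>R\<^esub>)"

text \<open>
  If \<open>R\<close> has no identity, then the idempotents \<open>e\<^sub>p\<^sub>p\<close> are not matrices over \<open>R\<close>. Multiplication by
  \<open>e\<^sub>p\<^sub>p\<close> from the left or from the right still makes sense: it keeps one row or one column.
\<close>

definition row_part :: "('a, 'b) ring_scheme \<Rightarrow> nat \<Rightarrow> nat \<Rightarrow> (nat \<times> nat \<Rightarrow> 'a) \<Rightarrow> nat \<times> nat \<Rightarrow> 'a"
  where "row_part R n p A = (\<lambda>(i, j)\<in>{..<n} \<times> {..<n}. if i = p then A (i, j) else \<zero>\<^bsub>R\<^esub>)"

definition col_part :: "('a, 'b) ring_scheme \<Rightarrow> nat \<Rightarrow> nat \<Rightarrow> (nat \<times> nat \<Rightarrow> 'a) \<Rightarrow> nat \<times> nat \<Rightarrow> 'a"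
  where "col_part R n p A = (\<lambda>(i, j)\<in>{..<n} \<times> {..<n}. if j = p then A (i, j) else \<zero>\<^bsub>R\<^esub>)"

lemma matrix_unit_entry [simp]:
  "i < n \<Longrightarrow> j < n \<Longrightarrow> matrix_unit R n p q r (i, j) = (if i = p \<and> j = q then r else \<zero>\<^bsub>R\<^esub>)"
  by (simp add: matrix_unit_def)

lemma row_part_entry [simp]:
  "i < n \<Longrightarrow> j < n \<Longrightarrow> row_part R n p A (i, j) = (if i = p then A (i, j) else \<zero>\<^bsub>R\<^esub>)"
  by (simp add: row_part_def)

lemma col_part_entry [simp]:
  "i < n \<Longrightarrow> j < n \<Longrightarrow> col_part R n p A (i, j) = (if j = p then A (i, j) else \<zero>\<^bsub>R\<^esub>)"
  by (simp add: col_part_def)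

context hemiring
begin

declare mult_closed [simp] zero_mult [simp] mult_zero [simp]

lemma matrix_eqI:
  assumes "A \<in> matrices n (carrier R)" "B \<in> matrices n (carrier R)"
    and "\<And>i j. i < n \<Longrightarrow> j < n \<Longrightarrow> A (i, j) = B (i, j)"
  shows "A = B"
  using assms unfolding matrices_def by (intro PiE_ext) auto

lemma matrix_add_closed:
  "A \<in> matrices n (carrier R) \<Longrightarrow> B \<in> matrices n (carrier R) \<Longrightarrow>
    A \<oplus>\<^bsub>matrix_hemiring n R\<^esub> B \<in> matrices n (carrier R)"
  unfolding matrix_hemiring_def by (auto intro!: matrices_restrictI dest: matrices_entry)

lemma matrix_mult_closed:
  "A \<in> matrices n (carrier R) \<Longrightarrow> B \<in> matrices n (carrier R) \<Longrightarrow>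
    A \<otimes>\<^bsub>matrix_hemiring n R\<^esub> B \<in> matrices n (carrier R)"
  unfolding matrix_hemiring_def
  by (auto intro!: matrices_restrictI finsum_closed mult_closed intro: matrices_entry)

lemma matrix_zero_closed: "\<zero>\<^bsub>matrix_hemiring n R\<^esub> \<in> matrices n (carrier R)"
  unfolding matrix_hemiring_def by (auto intro!: matrices_restrictI)

lemma matrix_unit_closed: "r \<in> carrier R \<Longrightarrow> matrix_unit R n p q r \<in> matrices n (carrier R)"
  unfolding matrix_unit_def by (auto intro!: matrices_restrictI)

lemma row_part_closed: "A \<in> matrices n (carrier R) \<Longrightarrow> row_part R n p A \<in> matrices n (carrier R)"
  unfolding row_part_def by (auto intro!: matrices_restrictI dest: matrices_entry)

lemma col_part_closed: "A \<in> matrices n (carrier R) \<Longrightarrow> col_part R n p A \<in> matrices n (carrier R)"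
  unfolding col_part_def by (auto intro!: matrices_restrictI dest: matrices_entry)

lemmas matrix_closed [simp] =
  matrix_add_closed matrix_mult_closed matrix_zero_closed matrix_unit_closed
  row_part_closed col_part_closed

lemma matrix_mult_assoc:
  assumes A: "A \<in> matrices n (carrier R)" and B: "B \<in> matrices n (carrier R)"
    and C: "C \<in> matrices n (carrier R)"
  shows "A \<otimes>\<^bsub>matrix_hemiring n R\<^esub> B \<otimes>\<^bsub>matrix_hemiring n R\<^esub> C =
    A \<otimes>\<^bsub>matrix_hemiring n R\<^esub> (B \<otimes>\<^bsub>matrix_hemiring n R\<^esub> C)"
proof (rule matrix_eqI[of _ n])
  interpret reg: left_semimodule R "regular_semimodule R" by (rule left_semimodule_regular)
  fix i j assume ij: "i < n" "j < n"
  note entry = matrices_entry[OF A] matrices_entry[OF B] matrices_entry[OF C]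
  have reg: "carrier (regular_semimodule R) = carrier R" "smult (regular_semimodule R) = mult R"
    by (simp_all add: regular_semimodule_def)
  have "(A \<otimes>\<^bsub>matrix_hemiring n R\<^esub> B \<otimes>\<^bsub>matrix_hemiring n R\<^esub> C) (i, j) =
    (\<Oplus>k\<in>{..<n}. (\<Oplus>l\<in>{..<n}. A (i, l) \<otimes> B (l, k)) \<otimes> C (k, j))"
    using ij entry by (auto simp: matrix_mult_entry intro!: finsum_cong' finsum_closed)
  also have "\<dots> = (\<Oplus>l\<in>{..<n}. A (i, l) \<otimes> (\<Oplus>k\<in>{..<n}. B (l, k) \<otimes> C (k, j)))"
    using reg.row_matrix_column_assoc[of "{..<n}" "{..<n}" "\<lambda>l. A (i, l)" "\<lambda>l k. B (l, k)"
        "\<lambda>k. C (k, j)"] ij entry by (simp add: reg)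
  also have "\<dots> = (A \<otimes>\<^bsub>matrix_hemiring n R\<^esub> (B \<otimes>\<^bsub>matrix_hemiring n R\<^esub> C)) (i, j)"
    using ij entry by (auto simp: matrix_mult_entry intro!: finsum_cong' finsum_closed)
  finally show "(A \<otimes>\<^bsub>matrix_hemiring n R\<^esub> B \<otimes>\<^bsub>matrix_hemiring n R\<^esub> C) (i, j) =
    (A \<otimes>\<^bsub>matrix_hemiring n R\<^esub> (B \<otimes>\<^bsub>matrix_hemiring n R\<^esub> C)) (i, j)" .
qed (use A B C in auto)

theorem hemiring_matrix_hemiring: "hemiring (matrix_hemiring n R)"
proof -
  note entry = matrices_entry[of _ n "carrier R"]
  have "abelian_monoid (matrix_hemiring n R)"
    by (rule abelian_monoidI) (auto intro!: matrix_eqI[of _ n] simp: a_ac entry)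
  moreover have "hemiring_axioms (matrix_hemiring n R)"
  proof
    fix A B C assume ABC: "A \<in> carrier (matrix_hemiring n R)" "B \<in> carrier (matrix_hemiring n R)"
      "C \<in> carrier (matrix_hemiring n R)"
    show "(A \<oplus>\<^bsub>matrix_hemiring n R\<^esub> B) \<otimes>\<^bsub>matrix_hemiring n R\<^esub> C =
      A \<otimes>\<^bsub>matrix_hemiring n R\<^esub> C \<oplus>\<^bsub>matrix_hemiring n R\<^esub> B \<otimes>\<^bsub>matrix_hemiring n R\<^esub> C"
    proof (rule matrix_eqI[of _ n])
      fix i j assume ij: "i < n" "j < n"
      have "((A \<oplus>\<^bsub>matrix_hemiring n R\<^esub> B) \<otimes>\<^bsub>matrix_hemiring n R\<^esub> C) (i, j) =
        (\<Oplus>k\<in>{..<n}. A (i, k) \<otimes> C (k, j) \<oplus> B (i, k) \<otimes> C (k, j))"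
        unfolding matrix_mult_entry[OF ij] by (rule finsum_cong') (use ABC ij in \<open>auto simp: distrib_right entry\<close>)
      also have "\<dots> = (A \<otimes>\<^bsub>matrix_hemiring n R\<^esub> C \<oplus>\<^bsub>matrix_hemiring n R\<^esub> B \<otimes>\<^bsub>matrix_hemiring n R\<^esub> C) (i, j)"
        using ABC ij by (auto simp: matrix_mult_entry entry)
      finally show "((A \<oplus>\<^bsub>matrix_hemiring n R\<^esub> B) \<otimes>\<^bsub>matrix_hemiring n R\<^esub> C) (i, j) = \<dots>" .
    qed (use ABC in auto)
    show "C \<otimes>\<^bsub>matrix_hemiring n R\<^esub> (A \<oplus>\<^bsub>matrix_hemiring n R\<^esub> B) =
      C \<otimes>\<^bsub>matrix_hemiring n R\<^esub> A \<oplus>\<^bsub>matrix_hemiring n R\<^esub> C \<otimes>\<^bsub>matrix_hemiring n R\<^esub> B"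
    proof (rule matrix_eqI[of _ n])
      fix i j assume ij: "i < n" "j < n"
      have "(C \<otimes>\<^bsub>matrix_hemiring n R\<^esub> (A \<oplus>\<^bsub>matrix_hemiring n R\<^esub> B)) (i, j) =
        (\<Oplus>k\<in>{..<n}. C (i, k) \<otimes> A (k, j) \<oplus> C (i, k) \<otimes> B (k, j))"
        unfolding matrix_mult_entry[OF ij] by (rule finsum_cong') (use ABC ij in \<open>auto simp: distrib_left entry\<close>)
      also have "\<dots> = (C \<otimes>\<^bsub>matrix_hemiring n R\<^esub> A \<oplus>\<^bsub>matrix_hemiring n R\<^esub> C \<otimes>\<^bsub>matrix_hemiring n R\<^esub> B) (i, j)"
        using ABC ij by (auto simp: matrix_mult_entry entry)
      finally show "(C \<otimes>\<^bsub>matrix_hemiring n R\<^esub> (A \<oplus>\<^bsub>matrix_hemiring n R\<^esub> B)) (i, j) = \<dots>" .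
    qed (use ABC in auto)
    show "\<zero>\<^bsub>matrix_hemiring n R\<^esub> \<otimes>\<^bsub>matrix_hemiring n R\<^esub> A = \<zero>\<^bsub>matrix_hemiring n R\<^esub>"
      "A \<otimes>\<^bsub>matrix_hemiring n R\<^esub> \<zero>\<^bsub>matrix_hemiring n R\<^esub> = \<zero>\<^bsub>matrix_hemiring n R\<^esub>"
      using ABC by (auto intro!: matrix_eqI[of _ n] add.finprod_one_eqI simp: matrix_mult_entry entry)
  qed (auto simp: matrix_mult_assoc)
  ultimately show ?thesis by (rule hemiring.intro)
qed

lemma matrix_mult_unit_entry:
  assumes "A \<in> matrices n (carrier R)" "r \<in> carrier R" "p < n" "i < n" "j < n"
  shows "(A \<otimes>\<^bsub>matrix_hemiring n R\<^esub> matrix_unit R n p q r) (i, j) = (if j = q then A (i, p) \<otimes> r else \<zero>)"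
  using assms matrices_entry[OF assms(1)]
  by (subst matrix_mult_entry, simp, simp, subst finsum_only[where k = p]) auto

lemma unit_mult_matrix_entry:
  assumes "A \<in> matrices n (carrier R)" "r \<in> carrier R" "q < n" "i < n" "j < n"
  shows "(matrix_unit R n p q r \<otimes>\<^bsub>matrix_hemiring n R\<^esub> A) (i, j) = (if i = p then r \<otimes> A (q, j) else \<zero>)"
  using assms matrices_entry[OF assms(1)]
  by (subst matrix_mult_entry, simp, simp, subst finsum_only[where k = q]) auto

lemma unit_mult_unit:
  assumes "r \<in> carrier R" "s \<in> carrier R" "q < n"
  shows "matrix_unit R n p q r \<otimes>\<^bsub>matrix_hemiring n R\<^esub> matrix_unit R n q q' s = matrix_unit R n p q' (r \<otimes> s)"
  using assms by (intro matrix_eqI[of _ n]) (auto simp: unit_mult_matrix_entry)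

lemma unit_mult_unit_zero:
  assumes "r \<in> carrier R" "s \<in> carrier R" "q < n" "q \<noteq> p'"
  shows "matrix_unit R n p q r \<otimes>\<^bsub>matrix_hemiring n R\<^esub> matrix_unit R n p' q' s = \<zero>\<^bsub>matrix_hemiring n R\<^esub>"
  using assms by (intro matrix_eqI[of _ n]) (auto simp: unit_mult_matrix_entry)

lemma unit_add:
  assumes "r \<in> carrier R" "s \<in> carrier R"
  shows "matrix_unit R n p q (r \<oplus> s) = matrix_unit R n p q r \<oplus>\<^bsub>matrix_hemiring n R\<^esub> matrix_unit R n p q s"
  using assms by (intro matrix_eqI[of _ n]) auto

lemma unit_zero: "matrix_unit R n p q \<zero> = \<zero>\<^bsub>matrix_hemiring n R\<^esub>"
  by (intro matrix_eqI[of _ n]) auto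

lemma row_part_mult:
  assumes "A \<in> matrices n (carrier R)" "B \<in> matrices n (carrier R)"
  shows "row_part R n p A \<otimes>\<^bsub>matrix_hemiring n R\<^esub> B = row_part R n p (A \<otimes>\<^bsub>matrix_hemiring n R\<^esub> B)"
  using assms matrices_entry[OF assms(1)] matrices_entry[OF assms(2)]
  by (intro matrix_eqI[of _ n])
    (auto simp: matrix_mult_entry intro!: add.finprod_one_eqI finsum_cong')

lemma mult_col_part:
  assumes "A \<in> matrices n (carrier R)" "B \<in> matrices n (carrier R)"
  shows "A \<otimes>\<^bsub>matrix_hemiring n R\<^esub> col_part R n p B = col_part R n p (A \<otimes>\<^bsub>matrix_hemiring n R\<^esub> B)"
  using assms matrices_entry[OF assms(1)] matrices_entry[OF assms(2)]
  by (intro matrix_eqI[of _ n])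
    (auto simp: matrix_mult_entry intro!: add.finprod_one_eqI finsum_cong')

text \<open>Both sides are \<open>A e\<^sub>p\<^sub>p B\<close>.\<close>

lemma mult_row_part:
  assumes "A \<in> matrices n (carrier R)" "B \<in> matrices n (carrier R)"
  shows "A \<otimes>\<^bsub>matrix_hemiring n R\<^esub> row_part R n p B = col_part R n p A \<otimes>\<^bsub>matrix_hemiring n R\<^esub> B"
  using assms matrices_entry[OF assms(1)] matrices_entry[OF assms(2)]
  by (intro matrix_eqI[of _ n])
    (auto simp: matrix_mult_entry intro!: finsum_cong')

lemma row_part_add:
  assumes "A \<in> matrices n (carrier R)" "B \<in> matrices n (carrier R)"
  shows "row_part R n p (A \<oplus>\<^bsub>matrix_hemiring n R\<^esub> B) =
    row_part R n p A \<oplus>\<^bsub>matrix_hemiring n R\<^esub> row_part R n p B"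
  using assms by (intro matrix_eqI[of _ n]) auto

lemma row_part_zero: "row_part R n p \<zero>\<^bsub>matrix_hemiring n R\<^esub> = \<zero>\<^bsub>matrix_hemiring n R\<^esub>"
  by (intro matrix_eqI[of _ n]) auto

lemma row_part_row_part: "A \<in> matrices n (carrier R) \<Longrightarrow> row_part R n p (row_part R n p A) = row_part R n p A"
  by (intro matrix_eqI[of _ n]) auto

lemma row_part_unit: "r \<in> carrier R \<Longrightarrow> row_part R n p (matrix_unit R n p q r) = matrix_unit R n p q r"
  by (intro matrix_eqI[of _ n]) auto

lemma col_part_unit: "r \<in> carrier R \<Longrightarrow> col_part R n q (matrix_unit R n p q r) = matrix_unit R n p q r"
  by (intro matrix_eqI[of _ n]) auto

lemma row_part_col_part:
  assumes "A \<in> matrices n (carrier R)" "p < n" "q < n"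
  shows "row_part R n p (col_part R n q A) = matrix_unit R n p q (A (p, q))"
  using assms matrices_entry[OF assms(1)]
  by (intro matrix_eqI[of _ n]) auto

text \<open>
  A matrix is the sum of its entries, each at its own place; this form of the expansion avoids
  double sums.
\<close>

lemma matrix_mem_submonoid:
  assumes A: "A \<in> matrices n (carrier R)" and Z: "Z \<subseteq> matrices n (carrier R)"
    "\<zero>\<^bsub>matrix_hemiring n R\<^esub> \<in> Z" "\<And>X Y. X \<in> Z \<Longrightarrow> Y \<in> Z \<Longrightarrow> X \<oplus>\<^bsub>matrix_hemiring n R\<^esub> Y \<in> Z"
    and units: "\<And>p q. p < n \<Longrightarrow> q < n \<Longrightarrow> matrix_unit R n p q (A (p, q)) \<in> Z"
  shows "A \<in> Z"
proof -
  note entry = matrices_entry[OF A]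
  define part where "part P = (\<lambda>(i, j)\<in>{..<n} \<times> {..<n}. if (i, j) \<in> P then A (i, j) else \<zero>)" for P
  have part_closed: "part P \<in> matrices n (carrier R)" for P
    unfolding part_def by (rule matrices_restrictI) (auto intro: entry)
  have part_entry: "part P (i, j) = (if (i, j) \<in> P then A (i, j) else \<zero>)" if "i < n" "j < n" for P i j
    using that by (simp add: part_def)
  have "part P \<in> Z" if "finite P" "P \<subseteq> {..<n} \<times> {..<n}" for P
    using that
  proof (induction P rule: finite_induct)
    case empty
    have "part {} = \<zero>\<^bsub>matrix_hemiring n R\<^esub>"
      by (intro matrix_eqI[of _ n] matrix_closed part_closed) (auto simp: part_entry)
    then show ?case using Z by simp
  next
    case (insert x P)
    obtain p q where x: "x = (p, q)" "p < n" "q < n" using insert.prems by (cases x) auto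
    have "part (insert x P) = matrix_unit R n p q (A (p, q)) \<oplus>\<^bsub>matrix_hemiring n R\<^esub> part P"
      using insert.hyps entry x
      by (intro matrix_eqI[of _ n] matrix_closed part_closed) (auto simp: part_entry)
    then show ?case using insert Z x units by auto
  qed
  then have "part ({..<n} \<times> {..<n}) \<in> Z" by simp
  moreover have "part ({..<n} \<times> {..<n}) = A"
    by (intro matrix_eqI[of _ n] part_closed A) (auto simp: part_entry)
  ultimately show ?thesis by simp
qed

end


section \<open>The Brown--McCoy radical\<close>

definition simple_semiring_image ::
  "('a, 'b) ring_scheme \<Rightarrow> ('c, 'd) ring_scheme \<Rightarrow> ('a \<Rightarrow> 'c) \<Rightarrow> bool"
  where "simple_semiring_image R S h \<longleftrightarrow>
    h \<in> hemiring_hom R S \<and> h ` carrier R = carrier S \<and> carrier S \<noteq> {\<zero>\<^bsub>S\<^esub>} \<and> semiring S \<and> ideal_simple S"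

lemma semiring_imp_hemiring:
  assumes "semiring S"
  shows "hemiring S"
proof -
  interpret semiring S by (rule assms)
  show ?thesis by unfold_locales (simp_all add: m_assoc l_distr r_distr)
qed

lemma hemiring_hom_closed: "h \<in> hemiring_hom R S \<Longrightarrow> x \<in> carrier R \<Longrightarrow> h x \<in> carrier S"
  and hemiring_hom_zero: "h \<in> hemiring_hom R S \<Longrightarrow> h \<zero>\<^bsub>R\<^esub> = \<zero>\<^bsub>S\<^esub>"
  and hemiring_hom_add: "h \<in> hemiring_hom R S \<Longrightarrow> x \<in> carrier R \<Longrightarrow> y \<in> carrier R \<Longrightarrow>
    h (x \<oplus>\<^bsub>R\<^esub> y) = h x \<oplus>\<^bsub>S\<^esub> h y"
  and hemiring_hom_mult: "h \<in> hemiring_hom R S \<Longrightarrow> x \<in> carrier R \<Longrightarrow> y \<in> carrier R \<Longrightarrow>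
    h (x \<otimes>\<^bsub>R\<^esub> y) = h x \<otimes>\<^bsub>S\<^esub> h y"
  by (auto simp: hemiring_hom_def)

lemma hemiring_ideal_subset: "hemiring_ideal I R \<Longrightarrow> I \<subseteq> carrier R"
  and hemiring_ideal_zero: "hemiring_ideal I R \<Longrightarrow> \<zero>\<^bsub>R\<^esub> \<in> I"
  and hemiring_ideal_add: "hemiring_ideal I R \<Longrightarrow> x \<in> I \<Longrightarrow> y \<in> I \<Longrightarrow> x \<oplus>\<^bsub>R\<^esub> y \<in> I"
  and hemiring_ideal_right: "hemiring_ideal I R \<Longrightarrow> x \<in> I \<Longrightarrow> r \<in> carrier R \<Longrightarrow> x \<otimes>\<^bsub>R\<^esub> r \<in> I"
  and hemiring_ideal_left: "hemiring_ideal I R \<Longrightarrow> x \<in> I \<Longrightarrow> r \<in> carrier R \<Longrightarrow> r \<otimes>\<^bsub>R\<^esub> x \<in> I"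
  by (auto simp: hemiring_ideal_def right_hemiring_ideal_def)

lemma hemiring_idealI:
  assumes "I \<subseteq> carrier R" "\<zero>\<^bsub>R\<^esub> \<in> I" "\<And>x y. x \<in> I \<Longrightarrow> y \<in> I \<Longrightarrow> x \<oplus>\<^bsub>R\<^esub> y \<in> I"
    and "\<And>x r. x \<in> I \<Longrightarrow> r \<in> carrier R \<Longrightarrow> x \<otimes>\<^bsub>R\<^esub> r \<in> I"
    and "\<And>x r. x \<in> I \<Longrightarrow> r \<in> carrier R \<Longrightarrow> r \<otimes>\<^bsub>R\<^esub> x \<in> I"
  shows "hemiring_ideal I R"
  using assms by (simp add: hemiring_ideal_def right_hemiring_ideal_def)

lemma hemiring_ideal_image:
  assumes h: "h \<in> hemiring_hom R S" and surj: "h ` carrier R = carrier S" and I: "hemiring_ideal I R"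
  shows "hemiring_ideal (h ` I) S"
proof (rule hemiring_idealI)
  note sub = hemiring_ideal_subset[OF I, THEN subsetD]
  show "h ` I \<subseteq> carrier S" using sub hemiring_hom_closed[OF h] by blast
  show "\<zero>\<^bsub>S\<^esub> \<in> h ` I" using hemiring_hom_zero[OF h] hemiring_ideal_zero[OF I] by (metis image_eqI)
next
  fix x y assume "x \<in> h ` I" "y \<in> h ` I"
  then obtain a b where ab: "a \<in> I" "b \<in> I" "x = h a" "y = h b" by blast
  have "x \<oplus>\<^bsub>S\<^esub> y = h (a \<oplus>\<^bsub>R\<^esub> b)"
    using ab hemiring_ideal_subset[OF I] hemiring_hom_add[OF h] by (simp add: subset_iff)
  then show "x \<oplus>\<^bsub>S\<^esub> y \<in> h ` I" using hemiring_ideal_add[OF I] ab by simp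
next
  fix x r assume "x \<in> h ` I" "r \<in> carrier S"
  then obtain a b where ab: "a \<in> I" "b \<in> carrier R" "x = h a" "r = h b" using surj by blast
  have "x \<otimes>\<^bsub>S\<^esub> r = h (a \<otimes>\<^bsub>R\<^esub> b)" "r \<otimes>\<^bsub>S\<^esub> x = h (b \<otimes>\<^bsub>R\<^esub> a)"
    using ab hemiring_ideal_subset[OF I] hemiring_hom_mult[OF h] by (simp_all add: subset_iff)
  then show "x \<otimes>\<^bsub>S\<^esub> r \<in> h ` I" "r \<otimes>\<^bsub>S\<^esub> x \<in> h ` I"
    using hemiring_ideal_left[OF I] hemiring_ideal_right[OF I] ab by simp_all
qed

lemma (in hemiring) hemiring_of_ideal:
  assumes I: "hemiring_ideal I R"
  shows "hemiring (R\<lparr>carrier := I\<rparr>)"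
proof -
  have sub: "x \<in> carrier R" if "x \<in> I" for x using hemiring_ideal_subset[OF I] that by blast
  have "abelian_monoid (R\<lparr>carrier := I\<rparr>)"
    using hemiring_ideal_zero[OF I] hemiring_ideal_add[OF I]
    by (intro abelian_monoidI) (auto simp: sub a_ac)
  then show ?thesis
    using hemiring_ideal_right[OF I]
    by (intro hemiring.intro hemiring_axioms.intro)
      (auto simp: sub mult_assoc distrib_left distrib_right)
qed

text \<open>
  The next two lemmas make the radical the intersection of the kernels of the maps onto ideal-simple
  semirings. The image of an ideal is an ideal, and an ideal in \<open>\<U>\<S>\<close> cannot map onto everything.
\<close>

lemma (in hemiring) brown_mccoy_radical_killed:
  assumes S: "simple_semiring_image R S h" and r: "r \<in> brown_mccoy_radical R"
  shows "h r = \<zero>\<^bsub>S\<^esub>"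
proof -
  obtain I where I: "r \<in> I" "hemiring_ideal I R" "in_US (R\<lparr>carrier := I\<rparr>)"
    using r by (auto simp: brown_mccoy_radical_def)
  have h: "h \<in> hemiring_hom R S" "h ` carrier R = carrier S" and nz: "carrier S \<noteq> {\<zero>\<^bsub>S\<^esub>}"
    and "semiring S" "ideal_simple S"
    using S by (auto simp: simple_semiring_image_def)
  have "h \<in> hemiring_hom (R\<lparr>carrier := I\<rparr>) S"
    using h(1) hemiring_ideal_subset[OF I(2)] by (auto simp: hemiring_hom_def subset_iff)
  then have "h ` I \<noteq> carrier S"
    using in_US_no_image[OF I(3), of h S] nz \<open>semiring S\<close> \<open>ideal_simple S\<close> by auto
  then have "h ` I = {\<zero>\<^bsub>S\<^esub>}"
    using hemiring_ideal_image[OF h I(2)] \<open>ideal_simple S\<close> by (auto simp: ideal_simple_def)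
  then show ?thesis using I(1) by blast
qed

text \<open>
  The common kernel \<open>K\<close> lies in \<open>\<U>\<S>\<close>: a simple semiring image \<open>g\<close> of \<open>K\<close> extends to one of \<open>R\<close> by
  \<open>r \<mapsto> g (e r)\<close>, where \<open>g e = 1\<close>, and the extension kills \<open>K\<close> by the choice of \<open>K\<close>.
\<close>

lemma (in hemiring) brown_mccoy_radicalI:
  assumes r: "r \<in> carrier R"
    and killed: "\<And>(S :: 'a ring) h. simple_semiring_image R S h \<Longrightarrow> h r = \<zero>\<^bsub>S\<^esub>"
  shows "r \<in> brown_mccoy_radical R"
proof -
  define K where "K = {x \<in> carrier R. \<forall>(S :: 'a ring) h. simple_semiring_image R S h \<longrightarrow> h x = \<zero>\<^bsub>S\<^esub>}"
  have KR: "x \<in> carrier R" if "x \<in> K" for x using that by (simp add: K_def)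
  have Kz: "h x = \<zero>\<^bsub>S\<^esub>" if "x \<in> K" "simple_semiring_image R S h" for x and S :: "'a ring" and h
    using that by (simp add: K_def)
  have KI: "x \<in> K" if "x \<in> carrier R" "\<And>(S :: 'a ring) h. simple_semiring_image R S h \<Longrightarrow> h x = \<zero>\<^bsub>S\<^esub>" for x
    unfolding K_def using that by blast
  have K: "hemiring_ideal K R"
  proof (rule hemiring_idealI)
    show "K \<subseteq> carrier R" using KR by blast
    have "h \<zero> = \<zero>\<^bsub>S\<^esub>" if "simple_semiring_image R S h" for S :: "'a ring" and h
      using that hemiring_hom_zero[of h R S] by (simp add: simple_semiring_image_def)
    then show "\<zero> \<in> K" by (rule KI[OF zero_closed])
  next
    fix x y assume xy: "x \<in> K" "y \<in> K"
    have "h (x \<oplus> y) = \<zero>\<^bsub>S\<^esub>" if S: "simple_semiring_image R S h" for S :: "'a ring" and h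
    proof -
      interpret S: hemiring S using S by (simp add: simple_semiring_image_def semiring_imp_hemiring)
      have "h \<in> hemiring_hom R S" using S by (simp add: simple_semiring_image_def)
      then show ?thesis
        using hemiring_hom_add[of h R S x y] Kz[OF xy(1) S] Kz[OF xy(2) S] xy KR by simp
    qed
    then show "x \<oplus> y \<in> K" using xy KR by (intro KI) auto
  next
    fix x s assume xs: "x \<in> K" "s \<in> carrier R"
    have "h (x \<otimes> s) = \<zero>\<^bsub>S\<^esub> \<and> h (s \<otimes> x) = \<zero>\<^bsub>S\<^esub>" if S: "simple_semiring_image R S h" for S :: "'a ring" and h
    proof -
      interpret S: hemiring S using S by (simp add: simple_semiring_image_def semiring_imp_hemiring)
      have h: "h \<in> hemiring_hom R S" using S by (simp add: simple_semiring_image_def)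
      then show ?thesis
        using hemiring_hom_mult[OF h] hemiring_hom_closed[OF h] Kz[OF xs(1) S] xs KR by simp
    qed
    then show "x \<otimes> s \<in> K" "s \<otimes> x \<in> K" using xs KR by (auto intro!: KI)
  qed
  have "in_US (R\<lparr>carrier := K\<rparr>)"
    unfolding in_US_def
  proof (intro conjI notI)
    show "hemiring (R\<lparr>carrier := K\<rparr>)" by (rule hemiring_of_ideal[OF K])
  next
    assume "\<exists>(S :: 'a ring) h. h \<in> hemiring_hom (R\<lparr>carrier := K\<rparr>) S \<and>
      h ` carrier (R\<lparr>carrier := K\<rparr>) = carrier S \<and> carrier S \<noteq> {\<zero>\<^bsub>S\<^esub>} \<and> semiring S \<and> ideal_simple S"
    then obtain S :: "'a ring" and g where g: "g \<in> hemiring_hom (R\<lparr>carrier := K\<rparr>) S" "g ` K = carrier S"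
      and S: "carrier S \<noteq> {\<zero>\<^bsub>S\<^esub>}" "semiring S" "ideal_simple S" by auto
    interpret S: semiring S by (rule S)
    obtain e where e: "e \<in> K" "g e = \<one>\<^bsub>S\<^esub>" using g(2) S.one_closed by (metis imageE)
    have g_closed: "g x \<in> carrier S" if "x \<in> K" for x using g(2) that by blast
    have g_add: "g (x \<oplus> y) = g x \<oplus>\<^bsub>S\<^esub> g y" and g_mult: "g (x \<otimes> y) = g x \<otimes>\<^bsub>S\<^esub> g y" if "x \<in> K" "y \<in> K" for x y
      using g(1) that by (auto simp: hemiring_hom_def)
    have mK: "x \<otimes> y \<in> K" "y \<otimes> x \<in> K" if "x \<in> K" "y \<in> carrier R" for x y
      using that hemiring_ideal_left[OF K] hemiring_ideal_right[OF K] by auto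
    define G where "G = (\<lambda>x. g (e \<otimes> x))"
    have Gg: "G x = g x" if "x \<in> K" for x
      using that e by (simp add: G_def g_mult g_closed)
    \<comment> \<open>In the middle, \<open>e\<close> can be inserted because \<open>g\<close> maps it to the identity.\<close>
    have G_mult: "G (x \<otimes> y) = G x \<otimes>\<^bsub>S\<^esub> G y" if xy: "x \<in> carrier R" "y \<in> carrier R" for x y
    proof -
      have "G (x \<otimes> y) = g (e \<otimes> x \<otimes> y) \<otimes>\<^bsub>S\<^esub> \<one>\<^bsub>S\<^esub>"
        using xy e KR by (simp add: G_def mK g_closed mult_assoc)
      also have "\<dots> = g ((e \<otimes> x) \<otimes> (y \<otimes> e))"
        using xy e KR mK by (simp add: g_mult[symmetric] e(2)[symmetric] mult_assoc)
      also have "\<dots> = g (e \<otimes> x) \<otimes>\<^bsub>S\<^esub> g (y \<otimes> e)"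
        using xy e mK by (intro g_mult) auto
      also have "g (y \<otimes> e) = \<one>\<^bsub>S\<^esub> \<otimes>\<^bsub>S\<^esub> g (y \<otimes> e)"
        using xy e by (simp add: mK g_closed)
      also have "\<dots> = g ((e \<otimes> y) \<otimes> e)"
        using xy e KR mK by (simp add: g_mult[symmetric] e(2)[symmetric] mult_assoc)
      also have "\<dots> = g (e \<otimes> y)"
        using g_mult[of "e \<otimes> y" e] xy e by (simp add: mK g_closed)
      finally show ?thesis by (simp add: G_def)
    qed
    have "G \<in> hemiring_hom R S"
      using e KR G_mult Gg hemiring_ideal_zero[OF K] g(1)
      by (auto simp: hemiring_hom_def) (auto simp: G_def distrib_left mK g_closed g_add)
    moreover have "G ` carrier R = carrier S"
    proof
      show "G ` carrier R \<subseteq> carrier S" using e by (auto simp: G_def mK g_closed)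
      have "g ` K \<subseteq> G ` carrier R" using Gg KR by (metis image_subsetI imageI)
      then show "carrier S \<subseteq> G ` carrier R" using g(2) by simp
    qed
    ultimately have "simple_semiring_image R S G" using S by (simp add: simple_semiring_image_def)
    then have "g ` K \<subseteq> {\<zero>\<^bsub>S\<^esub>}" using Kz Gg by fastforce
    then show False using S(1) S.zero_closed g(2) by auto
  qed
  moreover have "r \<in> K" using r killed by (rule KI)
  ultimately show ?thesis
    using K by (auto simp: brown_mccoy_radical_def)
qed

lemma (in hemiring) brown_mccoy_radical_subset: "brown_mccoy_radical R \<subseteq> carrier R"
  using hemiring_ideal_subset by (fastforce simp: brown_mccoy_radical_def)

lemma semiring_matrix_hemiring:
  assumes "semiring S"
  shows "semiring (matrix_hemiring n S)"
proof -
  interpret S: semiring S by (rule assms)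
  interpret H: hemiring S by (rule semiring_imp_hemiring[OF assms])
  interpret MS: hemiring "matrix_hemiring n S" by (rule H.hemiring_matrix_hemiring)
  note entry = matrices_entry[of _ n "carrier S"]
  have one: "\<one>\<^bsub>matrix_hemiring n S\<^esub> \<in> matrices n (carrier S)"
    by (auto simp: matrix_hemiring_def intro!: matrices_restrictI)
  have "monoid (matrix_hemiring n S)"
  proof (rule monoidI)
    fix A assume "A \<in> carrier (matrix_hemiring n S)"
    then have A: "A \<in> matrices n (carrier S)" by simp
    have "(\<one>\<^bsub>matrix_hemiring n S\<^esub> \<otimes>\<^bsub>matrix_hemiring n S\<^esub> A) (i, j) = A (i, j)"
      "(A \<otimes>\<^bsub>matrix_hemiring n S\<^esub> \<one>\<^bsub>matrix_hemiring n S\<^esub>) (i, j) = A (i, j)" if "i < n" "j < n" for i j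
      using that A S.finsum_only[where k = i and A = "{..<n}" and f = "\<lambda>k. \<one>\<^bsub>matrix_hemiring n S\<^esub> (i, k) \<otimes>\<^bsub>S\<^esub> A (k, j)"]
        S.finsum_only[where k = j and A = "{..<n}" and f = "\<lambda>k. A (i, k) \<otimes>\<^bsub>S\<^esub> \<one>\<^bsub>matrix_hemiring n S\<^esub> (k, j)"]
      by (auto simp: matrix_mult_entry entry matrix_one_entry)
    then show "\<one>\<^bsub>matrix_hemiring n S\<^esub> \<otimes>\<^bsub>matrix_hemiring n S\<^esub> A = A"
      "A \<otimes>\<^bsub>matrix_hemiring n S\<^esub> \<one>\<^bsub>matrix_hemiring n S\<^esub> = A"
      using A one by (auto intro!: H.matrix_eqI[of _ n])
  qed (use one in \<open>auto simp: H.matrix_mult_assoc\<close>)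
  then show ?thesis
    by (intro semiring.intro semiring_axioms.intro MS.abelian_monoid_axioms)
      (auto simp: MS.distrib_left MS.distrib_right MS.zero_mult MS.mult_zero simp del: carrier_matrix_hemiring)
qed

text \<open>
  As \<open>S\<close> has an identity, multiplication by matrix units moves each entry of a matrix in an ideal to
  every position, so the ideal consists of all matrices over some ideal of \<open>S\<close>.
\<close>

lemma ideal_simple_matrix_hemiring:
  assumes "semiring S" "ideal_simple S"
  shows "ideal_simple (matrix_hemiring n S)"
  unfolding ideal_simple_def
proof (intro allI impI)
  let ?M = "matrix_hemiring n S"
  interpret S: semiring S by (rule assms)
  interpret H: hemiring S by (rule semiring_imp_hemiring[OF assms(1)])
  fix J assume J: "hemiring_ideal J ?M"
  note JM = hemiring_ideal_subset[OF J, unfolded carrier_matrix_hemiring, THEN subsetD]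
  define I where "I = {s \<in> carrier S. \<forall>k<n. \<forall>l<n. matrix_unit S n k l s \<in> J}"
  have I: "hemiring_ideal I S"
  proof (rule hemiring_idealI)
    show "I \<subseteq> carrier S" by (auto simp: I_def)
    show "\<zero>\<^bsub>S\<^esub> \<in> I" using hemiring_ideal_zero[OF J] by (simp add: I_def H.unit_zero)
    show "x \<oplus>\<^bsub>S\<^esub> y \<in> I" if "x \<in> I" "y \<in> I" for x y
      using that hemiring_ideal_add[OF J] by (simp add: I_def H.unit_add)
    fix x r assume x: "x \<in> I" and r: "r \<in> carrier S"
    have "matrix_unit S n k l (x \<otimes>\<^bsub>S\<^esub> r) \<in> J" "matrix_unit S n k l (r \<otimes>\<^bsub>S\<^esub> x) \<in> J" if "k < n" "l < n" for k l
      using x r that hemiring_ideal_right[OF J, of "matrix_unit S n k l x" "matrix_unit S n l l r"]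
        hemiring_ideal_left[OF J, of "matrix_unit S n k l x" "matrix_unit S n k k r"]
      by (auto simp: I_def H.unit_mult_unit)
    then show "x \<otimes>\<^bsub>S\<^esub> r \<in> I" "r \<otimes>\<^bsub>S\<^esub> x \<in> I" using x r by (auto simp: I_def)
  qed
  have entry: "A (p, q) \<in> I" if A: "A \<in> J" and pq: "p < n" "q < n" for A p q
  proof -
    have "matrix_unit S n k l (A (p, q)) \<in> J" if kl: "k < n" "l < n" for k l
    proof -
      have "matrix_unit S n k l (A (p, q)) = matrix_unit S n k p \<one>\<^bsub>S\<^esub> \<otimes>\<^bsub>?M\<^esub> A \<otimes>\<^bsub>?M\<^esub> matrix_unit S n q l \<one>\<^bsub>S\<^esub>"
        using pq kl JM[OF A] matrices_entry[OF JM[OF A]]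
        by (intro H.matrix_eqI[of _ n]) (auto simp: H.matrix_mult_unit_entry H.unit_mult_matrix_entry)
      then show ?thesis
        using hemiring_ideal_right[OF J hemiring_ideal_left[OF J A]] by simp
    qed
    then show ?thesis using matrices_entry[OF JM[OF A] pq] by (simp add: I_def)
  qed
  consider "I = {\<zero>\<^bsub>S\<^esub>}" | "I = carrier S" using I assms(2) by (auto simp: ideal_simple_def)
  then show "J = {\<zero>\<^bsub>?M\<^esub>} \<or> J = carrier ?M"
  proof cases
    case 1
    then have "A = \<zero>\<^bsub>?M\<^esub>" if "A \<in> J" for A
      using entry[OF that] JM[OF that] by (intro H.matrix_eqI[of _ n]) auto
    then show ?thesis using hemiring_ideal_zero[OF J] by blast
  next
    case 2
    have "A \<in> J" if A: "A \<in> matrices n (carrier S)" for A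
    proof (rule H.matrix_mem_submonoid[OF A])
      fix p q assume pq: "p < n" "q < n"
      then have "A (p, q) \<in> I" using matrices_entry[OF A] 2 by simp
      then show "matrix_unit S n p q (A (p, q)) \<in> J" using pq by (simp add: I_def)
    qed (use JM hemiring_ideal_zero[OF J] hemiring_ideal_add[OF J] in auto)
    then show ?thesis using JM by auto
  qed
qed

lemma hemiring_hom_finsum:
  assumes "hemiring R" "hemiring S" "h \<in> hemiring_hom R S" "finite A" "\<And>i. i \<in> A \<Longrightarrow> f i \<in> carrier R"
  shows "h (\<Oplus>\<^bsub>R\<^esub>i\<in>A. f i) = (\<Oplus>\<^bsub>S\<^esub>i\<in>A. h (f i))"
proof -
  interpret R: hemiring R by (rule assms)
  interpret S: hemiring S by (rule assms)
  show ?thesis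
    using assms(4,5)
  proof (induction A rule: finite_induct)
    case (insert a A)
    then have "f \<in> A \<rightarrow> carrier R" "(\<lambda>i. h (f i)) \<in> A \<rightarrow> carrier S" "h (f a) \<in> carrier S"
      using hemiring_hom_closed[OF assms(3)] by auto
    then show ?case using insert hemiring_hom_add[OF assms(3)] by simp
  qed (simp add: hemiring_hom_zero[OF assms(3)])
qed

definition map_matrix :: "nat \<Rightarrow> ('a \<Rightarrow> 'c) \<Rightarrow> (nat \<times> nat \<Rightarrow> 'a) \<Rightarrow> nat \<times> nat \<Rightarrow> 'c"
  where "map_matrix n h A = (\<lambda>(i, j)\<in>{..<n} \<times> {..<n}. h (A (i, j)))"

lemma map_matrix_entry [simp]: "i < n \<Longrightarrow> j < n \<Longrightarrow> map_matrix n h A (i, j) = h (A (i, j))"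
  by (simp add: map_matrix_def)

lemma simple_semiring_image_matrix:
  assumes R: "hemiring R" and h: "simple_semiring_image R S h" and n: "n \<ge> 1"
  shows "simple_semiring_image (matrix_hemiring n R) (matrix_hemiring n S) (map_matrix n h)"
proof -
  interpret R: hemiring R by (rule R)
  have S: "semiring S" "ideal_simple S" "carrier S \<noteq> {\<zero>\<^bsub>S\<^esub>}" and hom: "h \<in> hemiring_hom R S"
    and surj: "h ` carrier R = carrier S"
    using h by (auto simp: simple_semiring_image_def)
  interpret S: hemiring S by (rule semiring_imp_hemiring[OF S(1)])
  note entry = matrices_entry[of _ n "carrier R"]
  have closed: "map_matrix n h A \<in> matrices n (carrier S)" if "A \<in> matrices n (carrier R)" for A
    unfolding map_matrix_def
    by (rule matrices_restrictI) (auto intro: hemiring_hom_closed[OF hom] entry[OF that])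
  have "map_matrix n h (A \<otimes>\<^bsub>matrix_hemiring n R\<^esub> B) = map_matrix n h A \<otimes>\<^bsub>matrix_hemiring n S\<^esub> map_matrix n h B"
    if AB: "A \<in> matrices n (carrier R)" "B \<in> matrices n (carrier R)" for A B
  proof (rule S.matrix_eqI[of _ n])
    fix i j assume ij: "i < n" "j < n"
    have "h (\<Oplus>\<^bsub>R\<^esub>k\<in>{..<n}. A (i, k) \<otimes>\<^bsub>R\<^esub> B (k, j)) = (\<Oplus>\<^bsub>S\<^esub>k\<in>{..<n}. h (A (i, k) \<otimes>\<^bsub>R\<^esub> B (k, j)))"
      by (rule hemiring_hom_finsum[OF R S.hemiring_axioms hom]) (use AB ij in \<open>auto simp: entry\<close>)
    also have "\<dots> = (\<Oplus>\<^bsub>S\<^esub>k\<in>{..<n}. map_matrix n h A (i, k) \<otimes>\<^bsub>S\<^esub> map_matrix n h B (k, j))"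
      by (rule S.finsum_cong')
        (use AB ij in \<open>auto simp: entry hemiring_hom_mult[OF hom] hemiring_hom_closed[OF hom]\<close>)
    finally show "map_matrix n h (A \<otimes>\<^bsub>matrix_hemiring n R\<^esub> B) (i, j) =
      (map_matrix n h A \<otimes>\<^bsub>matrix_hemiring n S\<^esub> map_matrix n h B) (i, j)"
      using ij by (simp add: matrix_mult_entry)
  qed (use AB closed in auto)
  then have "map_matrix n h \<in> hemiring_hom (matrix_hemiring n R) (matrix_hemiring n S)"
    unfolding hemiring_hom_def
    by (auto simp: closed hemiring_hom_zero[OF hom] hemiring_hom_add[OF hom] entry
        intro!: S.matrix_eqI[of _ n])
  moreover have "map_matrix n h ` matrices n (carrier R) = matrices n (carrier S)"
  proof
    show "map_matrix n h ` matrices n (carrier R) \<subseteq> matrices n (carrier S)" using closed by blast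
    show "matrices n (carrier S) \<subseteq> map_matrix n h ` matrices n (carrier R)"
    proof
      fix B assume B: "B \<in> matrices n (carrier S)"
      have pre: "inv_into (carrier R) h s \<in> carrier R" "h (inv_into (carrier R) h s) = s" if "s \<in> carrier S" for s
        using that surj by (auto intro: inv_into_into f_inv_into_f)
      have "map_matrix n (inv_into (carrier R) h) B \<in> matrices n (carrier R)"
        unfolding map_matrix_def by (rule matrices_restrictI) (auto intro: pre matrices_entry[OF B])
      moreover have "map_matrix n h (map_matrix n (inv_into (carrier R) h) B) = B"
        using calculation B by (intro S.matrix_eqI[of _ n] closed) (auto simp: pre matrices_entry[OF B])
      ultimately show "B \<in> map_matrix n h ` matrices n (carrier R)" by (metis imageI)
    qed
  qed
  moreover have "matrices n (carrier S) \<noteq> {\<zero>\<^bsub>matrix_hemiring n S\<^esub>}"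
  proof
    assume eq: "matrices n (carrier S) = {\<zero>\<^bsub>matrix_hemiring n S\<^esub>}"
    obtain s where s: "s \<in> carrier S" "s \<noteq> \<zero>\<^bsub>S\<^esub>" using S(3) S.zero_closed by blast
    have "matrix_unit S n 0 0 s = \<zero>\<^bsub>matrix_hemiring n S\<^esub>" using eq s(1) S.matrix_unit_closed by blast
    then have "matrix_unit S n 0 0 s (0, 0) = \<zero>\<^bsub>matrix_hemiring n S\<^esub> (0, 0)" by simp
    then show False using n s by simp
  qed
  ultimately show ?thesis
    using semiring_matrix_hemiring[OF S(1)] ideal_simple_matrix_hemiring[OF S(1,2)]
    by (simp add: simple_semiring_image_def)
qed

text \<open>
  The identity of \<open>S\<close> is \<open>H E\<close> for some matrix \<open>E\<close>. Inserting it shows that \<open>H (e\<^sub>p\<^sub>p B)\<close> and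
  \<open>H (B e\<^sub>p\<^sub>p)\<close> depend only on \<open>H B\<close>: they are \<open>H (E e\<^sub>p\<^sub>p) H B\<close> and \<open>H B H (e\<^sub>p\<^sub>p E)\<close>. So
  \<open>f = H (e\<^sub>p\<^sub>p E e\<^sub>p\<^sub>p)\<close> serves as the image of \<open>e\<^sub>p\<^sub>p\<close>, and the matrices with a single entry at \<open>(p, p)\<close>
  map onto the corner of \<open>S\<close> with identity \<open>f\<close>. This corner is ideal-simple: for an ideal \<open>I\<close> of it,
  the elements \<open>s\<close> such that \<open>I\<close> contains the corner of the ideal generated by \<open>s\<close> form an ideal of
  \<open>S\<close>, which is \<open>0\<close> or \<open>S\<close>.
\<close>

lemma simple_semiring_image_corner:
  assumes R: "hemiring R" and H: "simple_semiring_image (matrix_hemiring n R) S H" and p: "p < n"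
    and nz: "r0 \<in> carrier R" "H (matrix_unit R n p p r0) \<noteq> \<zero>\<^bsub>S\<^esub>"
  obtains T where "simple_semiring_image R (T :: 'c ring) (\<lambda>r. H (matrix_unit R n p p r))" "\<zero>\<^bsub>T\<^esub> = \<zero>\<^bsub>S\<^esub>"
proof -
  let ?M = "matrix_hemiring n R" and ?row = "row_part R n p" and ?col = "col_part R n p"
  let ?e = "matrix_unit R n p p"
  interpret R: hemiring R by (rule R)
  interpret M: hemiring ?M by (rule R.hemiring_matrix_hemiring)
  have S: "semiring S" "ideal_simple S" and hom: "H \<in> hemiring_hom ?M S"
    and surj: "H ` matrices n (carrier R) = carrier S"
    using H by (auto simp: simple_semiring_image_def)
  interpret S: semiring S by (rule S)
  have H_closed: "H A \<in> carrier S" if "A \<in> matrices n (carrier R)" for A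
    using surj that by blast
  have H_mult: "H (A \<otimes>\<^bsub>?M\<^esub> B) = H A \<otimes>\<^bsub>S\<^esub> H B" if "A \<in> matrices n (carrier R)" "B \<in> matrices n (carrier R)" for A B
    using hemiring_hom_mult[OF hom] that by simp
  obtain E where E: "E \<in> matrices n (carrier R)" "H E = \<one>\<^bsub>S\<^esub>"
    using surj S.one_closed by (metis imageE)
  note mE = matrices_entry[OF E(1) p p]
  define h where "h = (\<lambda>r. H (?e r))"
  have h_eq: "H (?e r) = h r" for r by (simp add: h_def)
  have h_closed: "h r \<in> carrier S" if "r \<in> carrier R" for r using that by (simp add: h_def H_closed)
  have h_add: "h (r \<oplus>\<^bsub>R\<^esub> s) = h r \<oplus>\<^bsub>S\<^esub> h s" if "r \<in> carrier R" "s \<in> carrier R" for r s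
    using that hemiring_hom_add[OF hom] by (simp add: h_def R.unit_add)
  have h_zero: "h \<zero>\<^bsub>R\<^esub> = \<zero>\<^bsub>S\<^esub>" using hemiring_hom_zero[OF hom] by (simp add: h_def R.unit_zero)
  have h_mult: "h (r \<otimes>\<^bsub>R\<^esub> s) = h r \<otimes>\<^bsub>S\<^esub> h s" if "r \<in> carrier R" "s \<in> carrier R" for r s
    using that H_mult p by (simp add: h_def R.unit_mult_unit[symmetric])
  define f where "f = h (E (p, p))"
  have f_closed: "f \<in> carrier S" by (simp add: f_def h_closed mE)
  have H_row: "H (?row B) = H (?col E) \<otimes>\<^bsub>S\<^esub> H B" if "B \<in> matrices n (carrier R)" for B
  proof -
    have "H (?row B) = H E \<otimes>\<^bsub>S\<^esub> H (?row B)" using that E by (simp add: H_closed)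
    also have "\<dots> = H (?col E \<otimes>\<^bsub>?M\<^esub> B)" using that E(1) by (simp add: H_mult[symmetric] R.mult_row_part)
    finally show ?thesis using that E(1) by (simp add: H_mult)
  qed
  have H_col: "H (?col B) = H B \<otimes>\<^bsub>S\<^esub> H (?row E)" if "B \<in> matrices n (carrier R)" for B
  proof -
    have "H (?col B) = H (?col B) \<otimes>\<^bsub>S\<^esub> H E" using that E by (simp add: H_closed)
    also have "\<dots> = H (B \<otimes>\<^bsub>?M\<^esub> ?row E)" using that E(1) by (simp add: H_mult[symmetric] R.mult_row_part)
    finally show ?thesis using that E(1) by (simp add: H_mult)
  qed
  have f_eq: "f = H (?row (?col E))"
    using E(1) p by (simp add: f_def h_def R.row_part_col_part)
  have f_left: "f \<otimes>\<^bsub>S\<^esub> h r = h r" if "r \<in> carrier R" for r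
  proof -
    have row: "H (?col E) \<otimes>\<^bsub>S\<^esub> h r = h r"
      using H_row[of "?e r"] that by (simp add: h_def R.row_part_unit)
    have "f \<otimes>\<^bsub>S\<^esub> h r = H (?col E) \<otimes>\<^bsub>S\<^esub> (H (?col E) \<otimes>\<^bsub>S\<^esub> h r)"
      using E(1) that by (simp add: f_eq H_row H_closed h_closed S.m_assoc)
    then show ?thesis by (simp add: row)
  qed
  have f_right: "h r \<otimes>\<^bsub>S\<^esub> f = h r" if "r \<in> carrier R" for r
  proof -
    have col: "h r \<otimes>\<^bsub>S\<^esub> H (?row E) = h r"
      using H_col[of "?e r"] that by (simp add: h_def R.col_part_unit)
    have "?row (?col E) = ?col (?row E)"
      using E(1) by (intro R.matrix_eqI[of _ n]) auto
    then have "h r \<otimes>\<^bsub>S\<^esub> f = h r \<otimes>\<^bsub>S\<^esub> H (?row E) \<otimes>\<^bsub>S\<^esub> H (?row E)"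
      using E(1) that by (simp add: f_eq H_col H_closed h_closed S.m_assoc)
    then show ?thesis by (simp add: col)
  qed
  define T :: "'c ring" where "T =
    \<lparr>carrier = h ` carrier R, mult = mult S, one = f, zero = zero S, add = add S\<rparr>"
  have zT: "\<zero>\<^bsub>S\<^esub> \<in> h ` carrier R" using h_zero by (metis R.zero_closed imageI)
  have am: "abelian_monoid T"
    by (rule abelian_monoidI) (auto simp: T_def S.a_ac R.a_ac h_closed zT simp flip: h_add)
  have mo: "monoid T"
    using f_left f_right
    by (intro monoidI) (auto simp: T_def R.mult_assoc f_def mE simp flip: h_mult)
  have T: "semiring T"
    using am mo by (intro semiring.intro semiring_axioms.intro)
      (auto simp: T_def S.l_distr S.r_distr h_closed)
  have corner: "?row X \<otimes>\<^bsub>?M\<^esub> ?e r \<otimes>\<^bsub>?M\<^esub> ?col Y = ?e (X (p, p) \<otimes>\<^bsub>R\<^esub> r \<otimes>\<^bsub>R\<^esub> Y (p, p))"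
    if "X \<in> matrices n (carrier R)" "Y \<in> matrices n (carrier R)" "r \<in> carrier R" for X Y r
  proof -
    have "?row X \<otimes>\<^bsub>?M\<^esub> ?e r = ?e (X (p, p) \<otimes>\<^bsub>R\<^esub> r)"
      using that p matrices_entry[OF that(1)]
      by (intro R.matrix_eqI[of _ n]) (auto simp: R.matrix_mult_unit_entry)
    moreover have "?e s \<otimes>\<^bsub>?M\<^esub> ?col Y = ?e (s \<otimes>\<^bsub>R\<^esub> Y (p, p))" if "s \<in> carrier R" for s
      using that \<open>Y \<in> _\<close> p matrices_entry[OF \<open>Y \<in> _\<close>]
      by (intro R.matrix_eqI[of _ n]) (auto simp: R.unit_mult_matrix_entry)
    ultimately show ?thesis using that p matrices_entry[OF that(1)] by simp
  qed
  have "ideal_simple T"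
    unfolding ideal_simple_def
  proof (intro allI impI)
    fix I assume I: "hemiring_ideal I T"
    have I_sub: "I \<subseteq> h ` carrier R" using hemiring_ideal_subset[OF I] by (simp add: T_def)
    have I_mult: "x \<otimes>\<^bsub>S\<^esub> t \<in> I" "t \<otimes>\<^bsub>S\<^esub> x \<in> I" if "x \<in> I" "t \<in> h ` carrier R" for x t
      using hemiring_ideal_left[OF I] hemiring_ideal_right[OF I] that by (auto simp: T_def)
    define I' where "I' = {s \<in> carrier S. \<forall>X\<in>matrices n (carrier R). \<forall>Y\<in>matrices n (carrier R).
      H (?row X) \<otimes>\<^bsub>S\<^esub> s \<otimes>\<^bsub>S\<^esub> H (?col Y) \<in> I}"
    have "hemiring_ideal I' S"
    proof (rule hemiring_idealI)
      show "I' \<subseteq> carrier S" by (auto simp: I'_def)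
      show "\<zero>\<^bsub>S\<^esub> \<in> I'" using hemiring_ideal_zero[OF I] by (auto simp: I'_def H_closed T_def)
      show "x \<oplus>\<^bsub>S\<^esub> y \<in> I'" if "x \<in> I'" "y \<in> I'" for x y
        using that hemiring_ideal_add[OF I] by (auto simp: I'_def H_closed T_def S.l_distr S.r_distr)
    next
      fix x s assume x: "x \<in> I'" and s: "s \<in> carrier S"
      obtain B where B: "B \<in> matrices n (carrier R)" "s = H B" using s surj by blast
      have "H (?row X) \<otimes>\<^bsub>S\<^esub> (x \<otimes>\<^bsub>S\<^esub> s) \<otimes>\<^bsub>S\<^esub> H (?col Y) \<in> I \<and> H (?row X) \<otimes>\<^bsub>S\<^esub> (s \<otimes>\<^bsub>S\<^esub> x) \<otimes>\<^bsub>S\<^esub> H (?col Y) \<in> I"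
        if XY: "X \<in> matrices n (carrier R)" "Y \<in> matrices n (carrier R)" for X Y
      proof -
        have "H (?row X) \<otimes>\<^bsub>S\<^esub> x \<otimes>\<^bsub>S\<^esub> H (?col (B \<otimes>\<^bsub>?M\<^esub> Y)) \<in> I" "H (?row (X \<otimes>\<^bsub>?M\<^esub> B)) \<otimes>\<^bsub>S\<^esub> x \<otimes>\<^bsub>S\<^esub> H (?col Y) \<in> I"
          using x XY B by (auto simp: I'_def)
        moreover have "H (?col (B \<otimes>\<^bsub>?M\<^esub> Y)) = s \<otimes>\<^bsub>S\<^esub> H (?col Y)" "H (?row (X \<otimes>\<^bsub>?M\<^esub> B)) = H (?row X) \<otimes>\<^bsub>S\<^esub> s"
          using XY B by (simp_all add: R.mult_col_part[symmetric] R.row_part_mult[symmetric] H_mult)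
        ultimately show ?thesis using x s XY by (simp add: I'_def S.m_assoc H_closed)
      qed
      then show "x \<otimes>\<^bsub>S\<^esub> s \<in> I'" "s \<otimes>\<^bsub>S\<^esub> x \<in> I'" using x s by (auto simp: I'_def)
    qed
    then consider "I' = {\<zero>\<^bsub>S\<^esub>}" | "I' = carrier S" using S(2) by (auto simp: ideal_simple_def)
    then show "I = {\<zero>\<^bsub>T\<^esub>} \<or> I = carrier T"
    proof cases
      case 1
      have "x \<in> I'" if x: "x \<in> I" for x
      proof -
        obtain r where r: "r \<in> carrier R" "x = h r" using I_sub x by blast
        have "H (?row X) \<otimes>\<^bsub>S\<^esub> x \<otimes>\<^bsub>S\<^esub> H (?col Y) \<in> I" if XY: "X \<in> matrices n (carrier R)" "Y \<in> matrices n (carrier R)" for X Y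
        proof -
          have m: "X (p, p) \<in> carrier R" "Y (p, p) \<in> carrier R" using XY p by (auto intro: matrices_entry)
          have "H (?row X) \<otimes>\<^bsub>S\<^esub> x \<otimes>\<^bsub>S\<^esub> H (?col Y) = H (?row X \<otimes>\<^bsub>?M\<^esub> ?e r \<otimes>\<^bsub>?M\<^esub> ?col Y)"
            using XY r by (simp add: H_mult h_def)
          also have "\<dots> = h (X (p, p)) \<otimes>\<^bsub>S\<^esub> x \<otimes>\<^bsub>S\<^esub> h (Y (p, p))"
            using XY r m by (simp add: corner h_eq h_mult)
          finally show ?thesis using m x I_mult by simp
        qed
        then show ?thesis using r by (auto simp: I'_def h_closed)
      qed
      then have "I \<subseteq> {\<zero>\<^bsub>S\<^esub>}" using 1 by blast
      moreover have "\<zero>\<^bsub>S\<^esub> \<in> I" using hemiring_ideal_zero[OF I] by (simp add: T_def)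
      ultimately have "I = {\<zero>\<^bsub>S\<^esub>}" by blast
      then show ?thesis by (simp add: T_def)
    next
      case 2
      have "h r \<in> I" if r: "r \<in> carrier R" for r
      proof -
        have "\<one>\<^bsub>S\<^esub> \<in> I'" by (simp add: 2)
        then have "H (?row (?e r)) \<otimes>\<^bsub>S\<^esub> \<one>\<^bsub>S\<^esub> \<otimes>\<^bsub>S\<^esub> H (?col (?e (E (p, p)))) \<in> I"
          using r mE by (simp add: I'_def)
        then show ?thesis
          using r mE f_right[OF r] by (simp add: R.row_part_unit R.col_part_unit h_eq h_closed f_def)
      qed
      then show ?thesis using I_sub by (auto simp: T_def)
    qed
  qed
  moreover have "carrier T \<noteq> {\<zero>\<^bsub>T\<^esub>}" using nz by (auto simp: T_def h_def)
  moreover have "h \<in> hemiring_hom R T" "h ` carrier R = carrier T"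
    by (auto simp: hemiring_hom_def T_def h_zero h_add h_mult)
  ultimately have "simple_semiring_image R T h" using T by (simp add: simple_semiring_image_def)
  then show ?thesis using that by (simp add: T_def h_def)
qed

text \<open>
  To be applied with \<open>A = B = E\<close> for a matrix \<open>E\<close> that maps to an identity: then the two factors do
  not change the image of \<open>C\<close>, but provide matrix units on both sides of it.
\<close>

lemma (in hemiring) matrix_product_induct:
  assumes A: "A \<in> matrices n (carrier R)" and B: "B \<in> matrices n (carrier R)"
    and zero: "P \<zero>\<^bsub>matrix_hemiring n R\<^esub>"
    and add: "\<And>X Y. X \<in> matrices n (carrier R) \<Longrightarrow> Y \<in> matrices n (carrier R) \<Longrightarrow> P X \<Longrightarrow> P Y \<Longrightarrow>
      P (X \<oplus>\<^bsub>matrix_hemiring n R\<^esub> Y)"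
    and C: "C \<in> matrices n (carrier R)"
    and units: "\<And>a b i j k l. a \<in> carrier R \<Longrightarrow> b \<in> carrier R \<Longrightarrow> i < n \<Longrightarrow> j < n \<Longrightarrow> k < n \<Longrightarrow> l < n \<Longrightarrow>
      P (matrix_unit R n i j a \<otimes>\<^bsub>matrix_hemiring n R\<^esub> C \<otimes>\<^bsub>matrix_hemiring n R\<^esub> matrix_unit R n k l b)"
  shows "P (A \<otimes>\<^bsub>matrix_hemiring n R\<^esub> C \<otimes>\<^bsub>matrix_hemiring n R\<^esub> B)"
proof -
  let ?M = "matrix_hemiring n R"
  interpret M: hemiring ?M by (rule hemiring_matrix_hemiring)
  have 1: "P (A \<otimes>\<^bsub>?M\<^esub> C \<otimes>\<^bsub>?M\<^esub> matrix_unit R n k l b)" if "b \<in> carrier R" "k < n" "l < n" for b k l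
  proof -
    let ?Z = "{X \<in> matrices n (carrier R). P (X \<otimes>\<^bsub>?M\<^esub> C \<otimes>\<^bsub>?M\<^esub> matrix_unit R n k l b)}"
    have "A \<in> ?Z"
      by (rule matrix_mem_submonoid[OF A])
        (use that C zero add M.zero_mult M.distrib_right units matrices_entry[OF A] in auto)
    then show ?thesis by simp
  qed
  let ?Z = "{X \<in> matrices n (carrier R). P (A \<otimes>\<^bsub>?M\<^esub> C \<otimes>\<^bsub>?M\<^esub> X)}"
  have "B \<in> ?Z"
    by (rule matrix_mem_submonoid[OF B])
      (use 1 A C zero add M.mult_zero M.distrib_left matrices_entry[OF B] in auto)
  then show ?thesis by simp
qed

theorem brown_mccoy_radical_matrix_hemiring:
  assumes R: "hemiring R" and n: "n \<ge> 1"
  shows "brown_mccoy_radical (matrix_hemiring n R) = matrices n (brown_mccoy_radical R)"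
proof (intro equalityI subsetI)
  let ?M = "matrix_hemiring n R"
  interpret R: hemiring R by (rule R)
  interpret M: hemiring ?M by (rule R.hemiring_matrix_hemiring)
  {
    fix A assume A: "A \<in> brown_mccoy_radical ?M"
    then have AM: "A \<in> matrices n (carrier R)" using M.brown_mccoy_radical_subset by auto
    have "A (i, j) \<in> brown_mccoy_radical R" if ij: "i < n" "j < n" for i j
    proof (rule R.brown_mccoy_radicalI)
      show "A (i, j) \<in> carrier R" using AM ij by (rule matrices_entry)
      fix S :: "'a ring" and h assume "simple_semiring_image R S h"
      then have "map_matrix n h A = \<zero>\<^bsub>matrix_hemiring n S\<^esub>"
        by (rule M.brown_mccoy_radical_killed[OF simple_semiring_image_matrix[OF R _ n] A])
      then have "map_matrix n h A (i, j) = \<zero>\<^bsub>matrix_hemiring n S\<^esub> (i, j)" by simp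
      then show "h (A (i, j)) = \<zero>\<^bsub>S\<^esub>" using ij by simp
    qed
    then show "A \<in> matrices n (brown_mccoy_radical R)" using AM by (auto simp: matrices_def PiE_iff)
  }
  fix A assume A: "A \<in> matrices n (brown_mccoy_radical R)"
  then have AM: "A \<in> matrices n (carrier R)"
    using R.brown_mccoy_radical_subset unfolding matrices_def by (auto simp: PiE_iff)
  show "A \<in> brown_mccoy_radical ?M"
  proof (rule M.brown_mccoy_radicalI)
    fix S :: "(nat \<times> nat \<Rightarrow> 'a) ring" and H assume H: "simple_semiring_image ?M S H"
    have S: "semiring S" and hom: "H \<in> hemiring_hom ?M S" and surj: "H ` matrices n (carrier R) = carrier S"
      using H by (auto simp: simple_semiring_image_def)
    interpret S: semiring S by (rule S)
    have H_closed: "H X \<in> carrier S" if "X \<in> matrices n (carrier R)" for X using surj that by blast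
    have H_mult: "H (X \<otimes>\<^bsub>?M\<^esub> Y) = H X \<otimes>\<^bsub>S\<^esub> H Y" if "X \<in> matrices n (carrier R)" "Y \<in> matrices n (carrier R)" for X Y
      using hemiring_hom_mult[OF hom] that by simp
    have H_add: "H (X \<oplus>\<^bsub>?M\<^esub> Y) = H X \<oplus>\<^bsub>S\<^esub> H Y" if "X \<in> matrices n (carrier R)" "Y \<in> matrices n (carrier R)" for X Y
      using hemiring_hom_add[OF hom] that by simp
    note H_zero = hemiring_hom_zero[OF hom]
    obtain E where E: "E \<in> matrices n (carrier R)" "H E = \<one>\<^bsub>S\<^esub>"
      using surj S.one_closed by (metis imageE)
    have diag: "H (matrix_unit R n p p r) = \<zero>\<^bsub>S\<^esub>" if r: "r \<in> brown_mccoy_radical R" and p: "p < n" for r p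
    proof (rule ccontr)
      assume nz: "H (matrix_unit R n p p r) \<noteq> \<zero>\<^bsub>S\<^esub>"
      obtain T where "simple_semiring_image R (T :: (nat \<times> nat \<Rightarrow> 'a) ring) (\<lambda>r. H (matrix_unit R n p p r))"
        "\<zero>\<^bsub>T\<^esub> = \<zero>\<^bsub>S\<^esub>"
        using simple_semiring_image_corner[OF R H p _ nz] r R.brown_mccoy_radical_subset by blast
      then show False using R.brown_mccoy_radical_killed r nz by metis
    qed
    have unit: "H (matrix_unit R n p q r) = \<zero>\<^bsub>S\<^esub>" if r: "r \<in> brown_mccoy_radical R" and pq: "p < n" "q < n" for r p q
    proof -
      have rR: "r \<in> carrier R" using r R.brown_mccoy_radical_subset by blast
      have "H (E \<otimes>\<^bsub>?M\<^esub> matrix_unit R n p q r \<otimes>\<^bsub>?M\<^esub> E) = \<zero>\<^bsub>S\<^esub>"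
      proof (rule R.matrix_product_induct[OF E(1) E(1)])
        fix a b i j k l assume a: "a \<in> carrier R" "b \<in> carrier R" "i < n" "j < n" "k < n" "l < n"
        show "H (matrix_unit R n i j a \<otimes>\<^bsub>?M\<^esub> matrix_unit R n p q r \<otimes>\<^bsub>?M\<^esub> matrix_unit R n k l b) = \<zero>\<^bsub>S\<^esub>"
        proof (cases "j = p \<and> k = q")
          case True
          \<comment> \<open>The factor \<open>r\<close> moves to a diagonal position.\<close>
          then have "matrix_unit R n i j a \<otimes>\<^bsub>?M\<^esub> matrix_unit R n p q r \<otimes>\<^bsub>?M\<^esub> matrix_unit R n k l b =
            matrix_unit R n i p a \<otimes>\<^bsub>?M\<^esub> matrix_unit R n p p r \<otimes>\<^bsub>?M\<^esub> matrix_unit R n p l b"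
            using a rR pq by (simp add: R.unit_mult_unit)
          then show ?thesis using a rR pq r by (simp add: H_mult diag H_closed)
        next
          case False
          then show ?thesis
            using a rR pq M.zero_mult M.mult_zero H_zero
            by (cases "j = p") (auto simp: R.unit_mult_unit R.unit_mult_unit_zero)
        qed
      qed (use rR H_zero in \<open>auto simp: H_add\<close>)
      then show ?thesis using E rR by (simp add: H_mult H_closed)
    qed
    have "A \<in> {X \<in> matrices n (carrier R). H X = \<zero>\<^bsub>S\<^esub>}"
      by (rule R.matrix_mem_submonoid[OF AM])
        (use AM A unit H_zero in \<open>auto simp: H_add matrices_entry\<close>)
    then show "H A = \<zero>\<^bsub>S\<^esub>" by simp
  qed (use AM in simp)
qed


section \<open>The radical defined by simple semimodules\<close>

lemma semimodule_congruence_equiv: "semimodule_congruence R M \<theta> \<Longrightarrow> equiv (carrier M) \<theta>"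
  and semimodule_congruence_add: "semimodule_congruence R M \<theta> \<Longrightarrow> (x, x') \<in> \<theta> \<Longrightarrow> (y, y') \<in> \<theta> \<Longrightarrow>
    (x \<oplus>\<^bsub>M\<^esub> y, x' \<oplus>\<^bsub>M\<^esub> y') \<in> \<theta>"
  and semimodule_congruence_smult: "semimodule_congruence R M \<theta> \<Longrightarrow> (x, x') \<in> \<theta> \<Longrightarrow> r \<in> carrier R \<Longrightarrow>
    (r \<odot>\<^bsub>M\<^esub> x, r \<odot>\<^bsub>M\<^esub> x') \<in> \<theta>"
  unfolding semimodule_congruence_def by blast+

lemma semimodule_congruenceI:
  assumes "\<theta> \<subseteq> carrier M \<times> carrier M" "\<And>x. x \<in> carrier M \<Longrightarrow> (x, x) \<in> \<theta>"
    and "\<And>x y. (x, y) \<in> \<theta> \<Longrightarrow> (y, x) \<in> \<theta>" "\<And>x y z. (x, y) \<in> \<theta> \<Longrightarrow> (y, z) \<in> \<theta> \<Longrightarrow> (x, z) \<in> \<theta>"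
    and "\<And>x x' y y'. (x, x') \<in> \<theta> \<Longrightarrow> (y, y') \<in> \<theta> \<Longrightarrow> (x \<oplus>\<^bsub>M\<^esub> y, x' \<oplus>\<^bsub>M\<^esub> y') \<in> \<theta>"
    and "\<And>r x x'. r \<in> carrier R \<Longrightarrow> (x, x') \<in> \<theta> \<Longrightarrow> (r \<odot>\<^bsub>M\<^esub> x, r \<odot>\<^bsub>M\<^esub> x') \<in> \<theta>"
  shows "semimodule_congruence R M \<theta>"
proof -
  have "equiv (carrier M) \<theta>"
  proof (rule equivI)
    show "refl_on (carrier M) \<theta>" using assms(2) by (rule refl_onI)
    show "sym \<theta>" using assms(3) by (rule symI)
    show "trans \<theta>" using assms(4) by (rule transI)
  qed (rule assms(1))
  then show ?thesis using assms(5,6) unfolding semimodule_congruence_def by blast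
qed

lemma congruence_cases_simple [consumes 2]:
  assumes "simple_semimodule R M" "semimodule_congruence R M \<theta>"
  obtains (identity) "\<theta> = Id_on (carrier M)" | (full) "\<theta> = carrier M \<times> carrier M"
  using assms by (auto simp: simple_semimodule_def)

text \<open>
  To be indistinguishable under the action of \<open>R\<close> is a congruence, and it is not the full one because
  \<open>R\<close> does not annihilate \<open>M\<close>.
\<close>

lemma simple_semimodule_cancel:
  assumes M: "simple_semimodule R M" and xy: "x \<in> carrier M" "y \<in> carrier M"
    and eq: "\<And>r. r \<in> carrier R \<Longrightarrow> r \<odot>\<^bsub>M\<^esub> x = r \<odot>\<^bsub>M\<^esub> y"
  shows "x = y"
proof -
  interpret left_semimodule R M using M by (simp add: simple_semimodule_def)
  define \<theta> where "\<theta> = {(x, y). x \<in> carrier M \<and> y \<in> carrier M \<and> (\<forall>r\<in>carrier R. r \<odot>\<^bsub>M\<^esub> x = r \<odot>\<^bsub>M\<^esub> y)}"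
  have "semimodule_congruence R M \<theta>"
    by (rule semimodule_congruenceI)
      (auto simp: \<theta>_def smult_distrib_left smult_closed smult_assoc[symmetric])
  with M show ?thesis
  proof (cases rule: congruence_cases_simple)
    case identity
    moreover have "(x, y) \<in> \<theta>" using xy eq by (simp add: \<theta>_def)
    ultimately show ?thesis by auto
  next
    case full
    obtain r z where rz: "r \<in> carrier R" "z \<in> carrier M" "r \<odot>\<^bsub>M\<^esub> z \<noteq> \<zero>\<^bsub>M\<^esub>"
      using M by (auto simp: simple_semimodule_def)
    then have "(z, \<zero>\<^bsub>M\<^esub>) \<in> \<theta>" using full by simp
    then show ?thesis using rz by (auto simp: \<theta>_def smult_zero)
  qed
qed

text \<open>
  \<open>R x\<close> is a subsemimodule. If it were \<open>0\<close>, then every \<open>r\<close> would act on \<open>x\<close> as on \<open>0\<close>.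
\<close>

lemma simple_semimodule_cyclic:
  assumes M: "simple_semimodule R M" and x: "x \<in> carrier M" "x \<noteq> \<zero>\<^bsub>M\<^esub>" and y: "y \<in> carrier M"
  obtains r where "r \<in> carrier R" "y = r \<odot>\<^bsub>M\<^esub> x"
proof -
  interpret left_semimodule R M using M by (simp add: simple_semimodule_def)
  let ?N = "(\<lambda>r. r \<odot>\<^bsub>M\<^esub> x) ` carrier R"
  have "subsemimodule R M ?N"
    unfolding subsemimodule_def
  proof (intro conjI ballI)
    show "\<zero>\<^bsub>M\<^esub> \<in> ?N" using zero_smult[OF x(1)] R.zero_closed by (metis image_eqI)
  qed (use x(1) in \<open>auto simp: smult_closed smult_distrib_right[symmetric] smult_assoc[symmetric]\<close>)
  then consider "?N = {\<zero>\<^bsub>M\<^esub>}" | "?N = carrier M" using M by (auto simp: simple_semimodule_def)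
  then show ?thesis
  proof cases
    case 1
    then have "r \<odot>\<^bsub>M\<^esub> x = r \<odot>\<^bsub>M\<^esub> \<zero>\<^bsub>M\<^esub>" if "r \<in> carrier R" for r using that by (auto simp: smult_zero)
    then have "x = \<zero>\<^bsub>M\<^esub>" by (rule simple_semimodule_cancel[OF M x(1) M.zero_closed])
    then show ?thesis using x by simp
  next
    case 2
    then show ?thesis using that y by blast
  qed
qed

lemma simple_semimoduleI:
  assumes M: "left_semimodule R M" and nz: "z \<in> carrier M" "z \<noteq> \<zero>\<^bsub>M\<^esub>"
    and cyclic: "\<And>x y. x \<in> carrier M \<Longrightarrow> x \<noteq> \<zero>\<^bsub>M\<^esub> \<Longrightarrow> y \<in> carrier M \<Longrightarrow> \<exists>r\<in>carrier R. y = r \<odot>\<^bsub>M\<^esub> x"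
    and cong: "\<And>\<theta>. semimodule_congruence R M \<theta> \<Longrightarrow> \<theta> = Id_on (carrier M) \<or> \<theta> = carrier M \<times> carrier M"
  shows "simple_semimodule R M"
  unfolding simple_semimodule_def
proof (intro conjI allI impI M cong)
  show "\<exists>r\<in>carrier R. \<exists>x\<in>carrier M. r \<odot>\<^bsub>M\<^esub> x \<noteq> \<zero>\<^bsub>M\<^esub>"
    using cyclic[OF nz nz(1)] nz by metis
  fix N assume N: "subsemimodule R M N"
  show "N = {\<zero>\<^bsub>M\<^esub>} \<or> N = carrier M"
  proof (cases "N \<subseteq> {\<zero>\<^bsub>M\<^esub>}")
    case True
    then show ?thesis using N by (auto simp: subsemimodule_def)
  next
    case False
    then obtain x where x: "x \<in> N" "x \<noteq> \<zero>\<^bsub>M\<^esub>" by blast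
    then have "y \<in> N" if "y \<in> carrier M" for y
      using cyclic[of x y] N that unfolding subsemimodule_def by blast
    then show ?thesis using N by (auto simp: subsemimodule_def)
  qed
qed

lemma congruence_fullI:
  assumes \<theta>: "equiv (carrier M) \<theta>" and "\<And>x. x \<in> carrier M \<Longrightarrow> (x, z) \<in> \<theta>"
  shows "\<theta> = carrier M \<times> carrier M"
proof -
  have "(x, y) \<in> \<theta>" if "x \<in> carrier M" "y \<in> carrier M" for x y
    using assms(2)[OF that(1)] assms(2)[OF that(2)] \<theta> unfolding equiv_def by (meson symD transD)
  moreover have "\<theta> \<subseteq> carrier M \<times> carrier M" using \<theta> by (rule equiv_type)
  ultimately show ?thesis by auto
qed

lemma congruence_IdI:
  assumes \<theta>: "equiv (carrier M) \<theta>" and "\<And>x y. (x, y) \<in> \<theta> \<Longrightarrow> x = y"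
  shows "\<theta> = Id_on (carrier M)"
proof -
  have "(x, x) \<in> \<theta>" if "x \<in> carrier M" for x using \<theta> that by (meson equiv_class_self Image_singleton_iff)
  moreover have "\<theta> \<subseteq> carrier M \<times> carrier M" using \<theta> by (rule equiv_type)
  ultimately show ?thesis using assms(2) by auto
qed


subsection \<open>Columns over a simple semimodule\<close>

definition column_semimodule ::
  "nat \<Rightarrow> ('a, 'm, 'c) module_scheme \<Rightarrow> (nat \<times> nat \<Rightarrow> 'a, nat \<Rightarrow> 'm) module"
  where "column_semimodule n M =
    \<lparr>carrier = {..<n} \<rightarrow>\<^sub>E carrier M, mult = undefined, one = undefined,
     zero = (\<lambda>i\<in>{..<n}. \<zero>\<^bsub>M\<^esub>), add = (\<lambda>v w. \<lambda>i\<in>{..<n}. v i \<oplus>\<^bsub>M\<^esub> w i),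
     smult = (\<lambda>A v. \<lambda>i\<in>{..<n}. \<Oplus>\<^bsub>M\<^esub>k\<in>{..<n}. A (i, k) \<odot>\<^bsub>M\<^esub> v k)\<rparr>"

lemma column_entry [simp]:
  assumes "i < n"
  shows "\<zero>\<^bsub>column_semimodule n M\<^esub> i = \<zero>\<^bsub>M\<^esub>" "(v \<oplus>\<^bsub>column_semimodule n M\<^esub> w) i = v i \<oplus>\<^bsub>M\<^esub> w i"
    and "(A \<odot>\<^bsub>column_semimodule n M\<^esub> v) i = (\<Oplus>\<^bsub>M\<^esub>k\<in>{..<n}. A (i, k) \<odot>\<^bsub>M\<^esub> v k)"
  using assms by (simp_all add: column_semimodule_def)

lemma carrier_column [simp]: "carrier (column_semimodule n M) = {..<n} \<rightarrow>\<^sub>E carrier M"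
  by (simp add: column_semimodule_def)

definition unit_column :: "('a, 'm, 'c) module_scheme \<Rightarrow> nat \<Rightarrow> nat \<Rightarrow> 'm \<Rightarrow> nat \<Rightarrow> 'm"
  where "unit_column M n k x = (\<lambda>i\<in>{..<n}. if i = k then x else \<zero>\<^bsub>M\<^esub>)"

lemma unit_column_entry [simp]: "i < n \<Longrightarrow> unit_column M n k x i = (if i = k then x else \<zero>\<^bsub>M\<^esub>)"
  by (simp add: unit_column_def)

context left_semimodule
begin

lemma column_eqI:
  assumes "v \<in> {..<n} \<rightarrow>\<^sub>E carrier M" "w \<in> {..<n} \<rightarrow>\<^sub>E carrier M" "\<And>i. i < n \<Longrightarrow> v i = w i"
  shows "v = w"
  using assms by (intro PiE_ext) auto

lemma column_closed [simp]:
  "\<zero>\<^bsub>column_semimodule n M\<^esub> \<in> {..<n} \<rightarrow>\<^sub>E carrier M"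
  "v \<in> {..<n} \<rightarrow>\<^sub>E carrier M \<Longrightarrow> w \<in> {..<n} \<rightarrow>\<^sub>E carrier M \<Longrightarrow>
    v \<oplus>\<^bsub>column_semimodule n M\<^esub> w \<in> {..<n} \<rightarrow>\<^sub>E carrier M"
  "A \<in> matrices n (carrier R) \<Longrightarrow> v \<in> {..<n} \<rightarrow>\<^sub>E carrier M \<Longrightarrow>
    A \<odot>\<^bsub>column_semimodule n M\<^esub> v \<in> {..<n} \<rightarrow>\<^sub>E carrier M"
  "x \<in> carrier M \<Longrightarrow> unit_column M n k x \<in> {..<n} \<rightarrow>\<^sub>E carrier M"
  unfolding column_semimodule_def unit_column_def
  by (auto simp: PiE_iff intro!: M.finsum_closed smult_closed intro: matrices_entry)

lemma left_semimodule_column: "left_semimodule (matrix_hemiring n R) (column_semimodule n M)"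
proof -
  have column: "v i \<in> carrier M" if "v \<in> {..<n} \<rightarrow>\<^sub>E carrier M" "i < n" for v i
    using that by auto
  have distrib: "(\<Oplus>\<^bsub>M\<^esub>k\<in>{..<n}. h k) = (\<Oplus>\<^bsub>M\<^esub>k\<in>{..<n}. f k) \<oplus>\<^bsub>M\<^esub> (\<Oplus>\<^bsub>M\<^esub>k\<in>{..<n}. g k)"
    if "\<And>k. k < n \<Longrightarrow> h k = f k \<oplus>\<^bsub>M\<^esub> g k" "\<And>k. k < n \<Longrightarrow> f k \<in> carrier M" "\<And>k. k < n \<Longrightarrow> g k \<in> carrier M"
    for f g h
  proof -
    have "(\<Oplus>\<^bsub>M\<^esub>k\<in>{..<n}. h k) = (\<Oplus>\<^bsub>M\<^esub>k\<in>{..<n}. f k \<oplus>\<^bsub>M\<^esub> g k)"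
      by (rule M.finsum_cong') (use that in auto)
    then show ?thesis using that by (simp add: Pi_iff)
  qed
  have "abelian_monoid (column_semimodule n M)"
  proof (rule abelian_monoidI)
    fix u v w assume "u \<in> carrier (column_semimodule n M)" "v \<in> carrier (column_semimodule n M)"
      "w \<in> carrier (column_semimodule n M)"
    then have uvw: "u \<in> {..<n} \<rightarrow>\<^sub>E carrier M" "v \<in> {..<n} \<rightarrow>\<^sub>E carrier M" "w \<in> {..<n} \<rightarrow>\<^sub>E carrier M"
      by simp_all
    note [simp] = uvw column[OF uvw(1)] column[OF uvw(2)] column[OF uvw(3)]
    show "u \<oplus>\<^bsub>column_semimodule n M\<^esub> v \<oplus>\<^bsub>column_semimodule n M\<^esub> w =
      u \<oplus>\<^bsub>column_semimodule n M\<^esub> (v \<oplus>\<^bsub>column_semimodule n M\<^esub> w)"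
      by (rule column_eqI[of _ n]) (auto simp: M.a_ac)
    show "\<zero>\<^bsub>column_semimodule n M\<^esub> \<oplus>\<^bsub>column_semimodule n M\<^esub> u = u"
      by (rule column_eqI[of _ n]) auto
    show "u \<oplus>\<^bsub>column_semimodule n M\<^esub> v = v \<oplus>\<^bsub>column_semimodule n M\<^esub> u"
      by (rule column_eqI[of _ n]) (auto simp: M.a_ac)
  qed auto
  moreover have "left_semimodule_axioms (matrix_hemiring n R) (column_semimodule n M)"
  proof
    fix A B v assume AB: "A \<in> carrier (matrix_hemiring n R)" "B \<in> carrier (matrix_hemiring n R)"
      and "v \<in> carrier (column_semimodule n M)"
    then have v: "v \<in> {..<n} \<rightarrow>\<^sub>E carrier M" by simp
    note entry = matrices_entry[OF AB(1)[unfolded carrier_matrix_hemiring]]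
      matrices_entry[OF AB(2)[unfolded carrier_matrix_hemiring]]
    note [simp] = AB[unfolded carrier_matrix_hemiring] v entry column[OF v] smult_closed
      R.matrix_add_closed R.matrix_mult_closed R.matrix_zero_closed
    show "(A \<oplus>\<^bsub>matrix_hemiring n R\<^esub> B) \<odot>\<^bsub>column_semimodule n M\<^esub> v =
      A \<odot>\<^bsub>column_semimodule n M\<^esub> v \<oplus>\<^bsub>column_semimodule n M\<^esub> B \<odot>\<^bsub>column_semimodule n M\<^esub> v"
      by (rule column_eqI[of _ n]) (auto simp: smult_distrib_right intro!: distrib)
    show "(A \<otimes>\<^bsub>matrix_hemiring n R\<^esub> B) \<odot>\<^bsub>column_semimodule n M\<^esub> v =
      A \<odot>\<^bsub>column_semimodule n M\<^esub> (B \<odot>\<^bsub>column_semimodule n M\<^esub> v)"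
    proof (rule column_eqI[of _ n])
      fix i assume i: "i < n"
      have "((A \<otimes>\<^bsub>matrix_hemiring n R\<^esub> B) \<odot>\<^bsub>column_semimodule n M\<^esub> v) i =
        (\<Oplus>\<^bsub>M\<^esub>k\<in>{..<n}. (\<Oplus>l\<in>{..<n}. A (i, l) \<otimes> B (l, k)) \<odot>\<^bsub>M\<^esub> v k)"
        unfolding column_entry(3)[OF i]
        by (rule M.finsum_cong')
          (use i in \<open>simp_all add: matrix_mult_entry Pi_iff\<close>)
      also have "\<dots> = (\<Oplus>\<^bsub>M\<^esub>l\<in>{..<n}. A (i, l) \<odot>\<^bsub>M\<^esub> (\<Oplus>\<^bsub>M\<^esub>k\<in>{..<n}. B (l, k) \<odot>\<^bsub>M\<^esub> v k))"
        by (rule row_matrix_column_assoc) (use i in simp_all)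
      also have "\<dots> = (A \<odot>\<^bsub>column_semimodule n M\<^esub> (B \<odot>\<^bsub>column_semimodule n M\<^esub> v)) i"
        unfolding column_entry(3)[OF i]
        by (rule M.finsum_cong')
          (use i in \<open>simp_all add: Pi_iff\<close>)
      finally show "((A \<otimes>\<^bsub>matrix_hemiring n R\<^esub> B) \<odot>\<^bsub>column_semimodule n M\<^esub> v) i = \<dots>" .
    qed simp_all
  next
    fix A v w assume A: "A \<in> carrier (matrix_hemiring n R)"
      and "v \<in> carrier (column_semimodule n M)" "w \<in> carrier (column_semimodule n M)"
    then have vw: "v \<in> {..<n} \<rightarrow>\<^sub>E carrier M" "w \<in> {..<n} \<rightarrow>\<^sub>E carrier M" by simp_all
    note [simp] = A[unfolded carrier_matrix_hemiring] matrices_entry[OF A[unfolded carrier_matrix_hemiring]]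
      vw column[OF vw(1)] column[OF vw(2)] smult_closed
    show "A \<odot>\<^bsub>column_semimodule n M\<^esub> (v \<oplus>\<^bsub>column_semimodule n M\<^esub> w) =
      A \<odot>\<^bsub>column_semimodule n M\<^esub> v \<oplus>\<^bsub>column_semimodule n M\<^esub> A \<odot>\<^bsub>column_semimodule n M\<^esub> w"
      by (rule column_eqI[of _ n]) (auto simp: smult_distrib_left intro!: distrib)
  next
    fix v assume "v \<in> carrier (column_semimodule n M)"
    then have v: "v \<in> {..<n} \<rightarrow>\<^sub>E carrier M" by simp
    note [simp] = v column[OF v] R.matrix_zero_closed
    show "\<zero>\<^bsub>matrix_hemiring n R\<^esub> \<odot>\<^bsub>column_semimodule n M\<^esub> v = \<zero>\<^bsub>column_semimodule n M\<^esub>"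
      by (rule column_eqI[of _ n]) (auto simp: zero_smult intro!: M.add.finprod_one_eqI)
  next
    fix A assume "A \<in> carrier (matrix_hemiring n R)"
    then have A: "A \<in> matrices n (carrier R)" by simp
    note [simp] = A matrices_entry[OF A]
    show "A \<odot>\<^bsub>column_semimodule n M\<^esub> \<zero>\<^bsub>column_semimodule n M\<^esub> = \<zero>\<^bsub>column_semimodule n M\<^esub>"
      by (rule column_eqI[of _ n]) (auto simp: smult_zero intro!: M.add.finprod_one_eqI)
  qed auto
  ultimately show ?thesis by (intro left_semimodule.intro R.hemiring_matrix_hemiring)
qed

lemma smult_unit_column:
  assumes "A \<in> matrices n (carrier R)" "x \<in> carrier M" "k < n" "i < n"
  shows "(A \<odot>\<^bsub>column_semimodule n M\<^esub> unit_column M n k x) i = A (i, k) \<odot>\<^bsub>M\<^esub> x"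
  using assms matrices_entry[OF assms(1)]
    M.finsum_only[where k = k and A = "{..<n}" and f = "\<lambda>j. A (i, j) \<odot>\<^bsub>M\<^esub> unit_column M n k x j"]
  by (auto simp: smult_closed smult_zero)

lemma unit_smult_column:
  assumes "v \<in> {..<n} \<rightarrow>\<^sub>E carrier M" "r \<in> carrier R" "k < n"
  shows "matrix_unit R n j k r \<odot>\<^bsub>column_semimodule n M\<^esub> v = unit_column M n j (r \<odot>\<^bsub>M\<^esub> v k)"
proof -
  have v: "v i \<in> carrier M" if "i < n" for i using assms that by auto
  show ?thesis
  proof (rule column_eqI[of _ n])
    fix i assume i: "i < n"
    show "(matrix_unit R n j k r \<odot>\<^bsub>column_semimodule n M\<^esub> v) i = unit_column M n j (r \<odot>\<^bsub>M\<^esub> v k) i"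
      using assms v i
        M.finsum_only[where k = k and A = "{..<n}" and f = "\<lambda>l. matrix_unit R n j k r (i, l) \<odot>\<^bsub>M\<^esub> v l"]
      by (auto simp: smult_closed zero_smult)
  qed (use assms v in \<open>auto simp: smult_closed R.matrix_unit_closed\<close>)
qed

end

text \<open>
  A congruence \<open>\<theta>\<close> on columns induces a congruence \<open>\<rho>\<close> on \<open>M\<close>: two elements are related if
  \<open>\<theta>\<close> relates them at every position. If \<open>\<rho>\<close> is the identity, then columns related by \<open>\<theta>\<close> have
  entries on which \<open>R\<close> acts equally, hence equal entries. If \<open>\<rho>\<close> is full, then some nonzero column
  is related to \<open>0\<close>, and it generates all columns.
\<close>

lemma simple_semimodule_column:
  assumes M: "simple_semimodule R M" and n: "n \<ge> 1"
  shows "simple_semimodule (matrix_hemiring n R) (column_semimodule n M)"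
proof -
  let ?M = "matrix_hemiring n R" and ?V = "column_semimodule n M"
  interpret left_semimodule R M using M by (simp add: simple_semimodule_def)
  interpret V: left_semimodule ?M ?V by (rule left_semimodule_column)
  obtain z where z: "z \<in> carrier M" "z \<noteq> \<zero>\<^bsub>M\<^esub>"
    using M smult_closed unfolding simple_semimodule_def by blast
  have uz: "unit_column M n 0 z \<in> carrier ?V" "unit_column M n 0 z \<noteq> \<zero>\<^bsub>?V\<^esub>"
  proof -
    have "unit_column M n 0 z 0 \<noteq> \<zero>\<^bsub>?V\<^esub> 0" using z n by simp
    then show "unit_column M n 0 z \<noteq> \<zero>\<^bsub>?V\<^esub>" by metis
  qed (use z in simp)
  \<comment> \<open>One nonzero entry of \<open>v\<close> suffices to reach \<open>w\<close>: all other columns of the matrix are zero.\<close>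
  have cyclic: "\<exists>A\<in>carrier ?M. w = A \<odot>\<^bsub>?V\<^esub> v" if v: "v \<in> carrier ?V" "v \<noteq> \<zero>\<^bsub>?V\<^esub>" and w: "w \<in> carrier ?V" for v w
  proof -
    have "\<exists>k<n. v k \<noteq> \<zero>\<^bsub>M\<^esub>"
    proof (rule ccontr)
      assume "\<not> (\<exists>k<n. v k \<noteq> \<zero>\<^bsub>M\<^esub>)"
      then have "v = \<zero>\<^bsub>?V\<^esub>" using v by (intro column_eqI[of _ n]) auto
      then show False using v by simp
    qed
    then obtain k where k: "k < n" "v k \<noteq> \<zero>\<^bsub>M\<^esub>" by blast
    have vk: "v i \<in> carrier M" "w i \<in> carrier M" if "i < n" for i using v w that by auto
    have "\<forall>i<n. \<exists>r\<in>carrier R. w i = r \<odot>\<^bsub>M\<^esub> v k"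
      using simple_semimodule_cyclic[OF M vk(1)[OF k(1)] k(2)] vk by metis
    then obtain a where a: "\<And>i. i < n \<Longrightarrow> a i \<in> carrier R \<and> w i = a i \<odot>\<^bsub>M\<^esub> v k" by metis
    define A where "A = (\<lambda>(i, j)\<in>{..<n} \<times> {..<n}. if j = k then a i else \<zero>\<^bsub>R\<^esub>)"
    have A: "A \<in> matrices n (carrier R)" unfolding A_def using a by (auto intro!: matrices_restrictI)
    have A_entry: "A (i, j) = (if j = k then a i else \<zero>\<^bsub>R\<^esub>)" if "i < n" "j < n" for i j
      using that by (simp add: A_def)
    have "w = A \<odot>\<^bsub>?V\<^esub> v"
    proof (rule column_eqI[of _ n])
      fix i assume i: "i < n"
      have "(\<Oplus>\<^bsub>M\<^esub>j\<in>{..<n}. A (i, j) \<odot>\<^bsub>M\<^esub> v j) = A (i, k) \<odot>\<^bsub>M\<^esub> v k"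
        using k i a vk by (intro M.finsum_only) (auto simp: A_entry smult_closed zero_smult)
      then show "w i = (A \<odot>\<^bsub>?V\<^esub> v) i" using k i a by (simp add: A_entry)
    qed (use A v w in auto)
    then show ?thesis using A by auto
  qed
  show ?thesis
  proof (rule simple_semimoduleI[OF V.left_semimodule_axioms uz cyclic])
    fix \<theta> assume \<theta>: "semimodule_congruence ?M ?V \<theta>"
    note eq = semimodule_congruence_equiv[OF \<theta>]
    define \<rho> where "\<rho> = {(a, b). a \<in> carrier M \<and> b \<in> carrier M \<and>
      (\<forall>k<n. (unit_column M n k a, unit_column M n k b) \<in> \<theta>)}"
    have "semimodule_congruence R M \<rho>"
    proof (rule semimodule_congruenceI)
      show "\<rho> \<subseteq> carrier M \<times> carrier M" by (auto simp: \<rho>_def)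
      show "(a, a) \<in> \<rho>" if "a \<in> carrier M" for a
        using that eq by (auto simp: \<rho>_def equiv_def refl_on_def)
      show "(b, a) \<in> \<rho>" if "(a, b) \<in> \<rho>" for a b
        using that eq unfolding \<rho>_def equiv_def sym_def by blast
      show "(a, c) \<in> \<rho>" if "(a, b) \<in> \<rho>" "(b, c) \<in> \<rho>" for a b c
        using that eq unfolding \<rho>_def equiv_def trans_def by blast
    next
      fix a a' b b' assume ab: "(a, a') \<in> \<rho>" "(b, b') \<in> \<rho>"
      have "unit_column M n k (x \<oplus>\<^bsub>M\<^esub> y) = unit_column M n k x \<oplus>\<^bsub>?V\<^esub> unit_column M n k y"
        if "x \<in> carrier M" "y \<in> carrier M" for x y k
        using that by (intro column_eqI[of _ n]) auto
      then show "(a \<oplus>\<^bsub>M\<^esub> b, a' \<oplus>\<^bsub>M\<^esub> b') \<in> \<rho>"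
        using ab semimodule_congruence_add[OF \<theta>] by (auto simp: \<rho>_def)
    next
      fix r a a' assume r: "r \<in> carrier R" and a: "(a, a') \<in> \<rho>"
      have "unit_column M n k (r \<odot>\<^bsub>M\<^esub> x) = matrix_unit R n k k r \<odot>\<^bsub>?V\<^esub> unit_column M n k x"
        if "x \<in> carrier M" "k < n" for x k
        using that r by (simp add: unit_smult_column)
      then show "(r \<odot>\<^bsub>M\<^esub> a, r \<odot>\<^bsub>M\<^esub> a') \<in> \<rho>"
        using a r semimodule_congruence_smult[OF \<theta>] by (auto simp: \<rho>_def smult_closed R.matrix_unit_closed)
    qed
    with M show "\<theta> = Id_on (carrier ?V) \<or> \<theta> = carrier ?V \<times> carrier ?V"
    proof (cases rule: congruence_cases_simple)
      case identity
      have "v = w" if vw: "(v, w) \<in> \<theta>" for v w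
      proof -
        have c: "v \<in> carrier ?V" "w \<in> carrier ?V" using equiv_type[OF eq] vw by auto
        then have ck: "v k \<in> carrier M" "w k \<in> carrier M" if "k < n" for k using that by auto
        have "r \<odot>\<^bsub>M\<^esub> v k = r \<odot>\<^bsub>M\<^esub> w k" if r: "r \<in> carrier R" and k: "k < n" for r k
        proof -
          have "(unit_column M n j (r \<odot>\<^bsub>M\<^esub> v k), unit_column M n j (r \<odot>\<^bsub>M\<^esub> w k)) \<in> \<theta>" for j
            using semimodule_congruence_smult[OF \<theta> vw, of "matrix_unit R n j k r"] c r k
            by (simp add: unit_smult_column R.matrix_unit_closed)
          then have "(r \<odot>\<^bsub>M\<^esub> v k, r \<odot>\<^bsub>M\<^esub> w k) \<in> \<rho>" using r ck[OF k] by (simp add: \<rho>_def smult_closed)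
          then show ?thesis using identity by auto
        qed
        then have "v k = w k" if "k < n" for k
          using simple_semimodule_cancel[OF M ck[OF that]] that by blast
        then show ?thesis using c by (intro column_eqI[of _ n]) auto
      qed
      then show ?thesis using congruence_IdI[OF eq] by blast
    next
      case full
      then have "(z, \<zero>\<^bsub>M\<^esub>) \<in> \<rho>" using z by simp
      then have "(unit_column M n 0 z, unit_column M n 0 \<zero>\<^bsub>M\<^esub>) \<in> \<theta>" using n by (auto simp: \<rho>_def)
      moreover have "unit_column M n 0 \<zero>\<^bsub>M\<^esub> = \<zero>\<^bsub>?V\<^esub>" by (intro column_eqI[of _ n]) auto
      ultimately have uz0: "(unit_column M n 0 z, \<zero>\<^bsub>?V\<^esub>) \<in> \<theta>" by simp
      have "(v, \<zero>\<^bsub>?V\<^esub>) \<in> \<theta>" if v: "v \<in> carrier ?V" for v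
      proof -
        obtain A where "A \<in> carrier ?M" "v = A \<odot>\<^bsub>?V\<^esub> unit_column M n 0 z" using cyclic[OF uz v] by blast
        then show ?thesis using semimodule_congruence_smult[OF \<theta> uz0, of A] V.smult_zero[of A] by simp
      qed
      then show ?thesis using congruence_fullI[OF eq] by blast
    qed
  qed
qed


subsection \<open>The corner of a simple semimodule over a matrix hemiring\<close>

text \<open>
  Let \<open>v\<close> generate \<open>V\<close>. By \<open>simple_semimodule_cancel\<close>, \<open>e\<^sub>p\<^sub>p A v\<close> depends only on \<open>A v\<close>, so \<open>e\<^sub>p\<^sub>p\<close>
  acts on \<open>V\<close>. Its image \<open>C\<close>, on which \<open>r\<close> acts as \<open>r e\<^sub>p\<^sub>p\<close>, is \<open>0\<close> or a simple semimodule over \<open>R\<close>: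
  a congruence \<open>\<theta>\<close> on \<open>C\<close> is contained in the congruence \<open>\<eta>\<close> on \<open>V\<close> that relates \<open>x\<close> and \<open>y\<close> if
  \<open>\<theta>\<close> relates \<open>e\<^sub>p\<^sub>p X x\<close> and \<open>e\<^sub>p\<^sub>p X y\<close> for all matrices \<open>X\<close>, and \<open>\<theta>\<close> is full if \<open>\<eta>\<close> is. So each \<open>r\<close>
  in \<open>J\<^sub>s(R)\<close> annihilates \<open>C\<close>, and \<open>(r e\<^sub>p\<^sub>p) x = (r e\<^sub>p\<^sub>p) (e\<^sub>p\<^sub>p x) = 0\<close> for \<open>x\<close> in \<open>V\<close>.
\<close>

lemma Js_diagonal_unit:
  assumes R: "hemiring R" and V: "simple_semimodule (matrix_hemiring n R) V"
    and r: "r \<in> Js R" and p: "p < n"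
  shows "matrix_unit R n p p r \<in> annihilator (matrix_hemiring n R) V"
proof -
  let ?M = "matrix_hemiring n R" and ?row = "row_part R n p" and ?col = "col_part R n p"
  let ?e = "matrix_unit R n p p"
  interpret R: hemiring R by (rule R)
  interpret V: left_semimodule ?M V using V by (simp add: simple_semimodule_def)
  note smult_assoc = V.smult_assoc[unfolded carrier_matrix_hemiring]
    and smult_closed = V.smult_closed[unfolded carrier_matrix_hemiring]
    and smult_distrib_right = V.smult_distrib_right[unfolded carrier_matrix_hemiring]
    and smult_distrib_left = V.smult_distrib_left[unfolded carrier_matrix_hemiring]
    and smult_zero = V.smult_zero[unfolded carrier_matrix_hemiring]
  have rR: "r \<in> carrier R" using r by (simp add: Js_def)
  obtain v where v: "v \<in> carrier V" "v \<noteq> \<zero>\<^bsub>V\<^esub>"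
    using V V.smult_closed unfolding simple_semimodule_def by blast
  have gen: "\<exists>A\<in>matrices n (carrier R). x = A \<odot>\<^bsub>V\<^esub> v" if "x \<in> carrier V" for x
    using simple_semimodule_cyclic[OF V v that] by (metis carrier_matrix_hemiring)
  define C where "C = (\<lambda>A. ?row A \<odot>\<^bsub>V\<^esub> v) ` matrices n (carrier R)"
  have CI: "?row A \<odot>\<^bsub>V\<^esub> v \<in> C" if "A \<in> matrices n (carrier R)" for A using that by (simp add: C_def)
  have CV: "x \<in> carrier V" if "x \<in> C" for x using that v by (auto simp: C_def smult_closed)
  have row_C: "?row X \<odot>\<^bsub>V\<^esub> x \<in> C" if X: "X \<in> matrices n (carrier R)" and x: "x \<in> carrier V" for X x
  proof -
    obtain A where A: "A \<in> matrices n (carrier R)" "x = A \<odot>\<^bsub>V\<^esub> v" using gen x by blast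
    then have "?row X \<odot>\<^bsub>V\<^esub> x = ?row (X \<otimes>\<^bsub>?M\<^esub> A) \<odot>\<^bsub>V\<^esub> v"
      using X v by (simp add: smult_assoc[symmetric] R.row_part_mult)
    then show ?thesis using CI X A by simp
  qed
  have e_row: "?e s \<odot>\<^bsub>V\<^esub> x = ?row (?e s) \<odot>\<^bsub>V\<^esub> x" if "s \<in> carrier R" for s x
    using that by (simp add: R.row_part_unit)
  \<comment> \<open>On \<open>C\<close>, where \<open>e\<^sub>p\<^sub>p\<close> acts as the identity, \<open>e\<^sub>p\<^sub>p X\<close> acts as \<open>e\<^sub>p\<^sub>p X e\<^sub>p\<^sub>p\<close>.\<close>
  have row_on_C: "?row X \<odot>\<^bsub>V\<^esub> x = ?e (X (p, p)) \<odot>\<^bsub>V\<^esub> x" if X: "X \<in> matrices n (carrier R)" and x: "x \<in> C" for X x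
  proof -
    obtain B where B: "B \<in> matrices n (carrier R)" "x = ?row B \<odot>\<^bsub>V\<^esub> v" using x by (auto simp: C_def)
    have "?row (?col X) \<otimes>\<^bsub>?M\<^esub> ?row B = ?row (X \<otimes>\<^bsub>?M\<^esub> ?row (?row B))"
      using X B(1) by (simp add: R.row_part_mult R.mult_row_part[symmetric])
    also have "\<dots> = ?row X \<otimes>\<^bsub>?M\<^esub> ?row B"
      using X B(1) by (simp add: R.row_part_mult R.row_part_row_part)
    finally have "?row (?col X) \<odot>\<^bsub>V\<^esub> x = ?row X \<odot>\<^bsub>V\<^esub> x"
      using X B v by (simp add: smult_assoc[symmetric])
    then show ?thesis using X p by (simp add: R.row_part_col_part)
  qed
  have well_defined: "?row A \<odot>\<^bsub>V\<^esub> v = ?row B \<odot>\<^bsub>V\<^esub> v"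
    if AB: "A \<in> matrices n (carrier R)" "B \<in> matrices n (carrier R)" "A \<odot>\<^bsub>V\<^esub> v = B \<odot>\<^bsub>V\<^esub> v" for A B
  proof (rule simple_semimodule_cancel[OF V])
    fix D assume "D \<in> carrier ?M"
    then have "D \<odot>\<^bsub>V\<^esub> (?row X \<odot>\<^bsub>V\<^esub> v) = ?col D \<odot>\<^bsub>V\<^esub> (X \<odot>\<^bsub>V\<^esub> v)" if "X \<in> matrices n (carrier R)" for X
      using that v by (simp add: smult_assoc[symmetric] R.mult_row_part)
    then show "D \<odot>\<^bsub>V\<^esub> (?row A \<odot>\<^bsub>V\<^esub> v) = D \<odot>\<^bsub>V\<^esub> (?row B \<odot>\<^bsub>V\<^esub> v)" using AB by simp
  qed (use AB v in \<open>auto simp: smult_closed\<close>)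
  define T :: "('a, 'c) module" where "T =
    \<lparr>carrier = C, mult = undefined, one = undefined, zero = zero V, add = add V,
     smult = (\<lambda>s x. ?e s \<odot>\<^bsub>V\<^esub> x)\<rparr>"
  have zero_C: "\<zero>\<^bsub>V\<^esub> \<in> C"
    using CI[OF R.matrix_zero_closed] V.zero_smult[OF v(1)] by (simp add: R.row_part_zero)
  have add_C: "x \<oplus>\<^bsub>V\<^esub> y \<in> C" if xy: "x \<in> C" "y \<in> C" for x y
  proof -
    obtain A B where AB: "A \<in> matrices n (carrier R)" "x = ?row A \<odot>\<^bsub>V\<^esub> v"
      "B \<in> matrices n (carrier R)" "y = ?row B \<odot>\<^bsub>V\<^esub> v" using xy by (auto simp: C_def)
    then have "x \<oplus>\<^bsub>V\<^esub> y = ?row (A \<oplus>\<^bsub>?M\<^esub> B) \<odot>\<^bsub>V\<^esub> v"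
      using v by (simp add: R.row_part_add smult_distrib_right)
    then show ?thesis using CI AB by simp
  qed
  have smult_C: "?e s \<odot>\<^bsub>V\<^esub> x \<in> C" if "s \<in> carrier R" "x \<in> C" for s x
    using that by (simp add: e_row row_C CV)
  have "abelian_monoid T"
    by (rule abelian_monoidI) (auto simp: T_def zero_C add_C V.a_ac CV)
  then have T: "left_semimodule R T"
    using R p
    by (intro left_semimodule.intro left_semimodule_axioms.intro)
      (auto simp: T_def smult_C CV R.unit_mult_unit[symmetric] smult_assoc R.unit_add smult_distrib_left
        smult_distrib_right smult_zero R.unit_zero V.zero_smult)
  show ?thesis
  proof (cases "C = {\<zero>\<^bsub>V\<^esub>}")
    case True
    have "?e r \<odot>\<^bsub>V\<^esub> x = \<zero>\<^bsub>V\<^esub>" if "x \<in> carrier V" for x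
      using row_C[of "?e r" x] that rR True by (simp add: R.row_part_unit)
    then show ?thesis using rR by (simp add: annihilator_def)
  next
    case False
    then obtain z where z: "z \<in> C" "z \<noteq> \<zero>\<^bsub>V\<^esub>" using zero_C by blast
    have "simple_semimodule R T"
    proof (rule simple_semimoduleI[OF T])
      show "z \<in> carrier T" "z \<noteq> \<zero>\<^bsub>T\<^esub>" using z by (auto simp: T_def)
    next
      fix x y assume "x \<in> carrier T" "x \<noteq> \<zero>\<^bsub>T\<^esub>" "y \<in> carrier T"
      then have x: "x \<in> C" "x \<noteq> \<zero>\<^bsub>V\<^esub>" and y: "y \<in> C" by (auto simp: T_def)
      obtain B where B: "B \<in> matrices n (carrier R)" "x = ?row B \<odot>\<^bsub>V\<^esub> v" using x by (auto simp: C_def)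
      obtain D where D: "D \<in> matrices n (carrier R)" "y = ?row D \<odot>\<^bsub>V\<^esub> v" using y by (auto simp: C_def)
      obtain A where A: "A \<in> matrices n (carrier R)" "y = A \<odot>\<^bsub>V\<^esub> x"
        using simple_semimodule_cyclic[OF V CV[OF x(1)] x(2) CV[OF y]] by (metis carrier_matrix_hemiring)
      have "(A \<otimes>\<^bsub>?M\<^esub> ?row B) \<odot>\<^bsub>V\<^esub> v = ?row D \<odot>\<^bsub>V\<^esub> v"
        using A B D v by (simp add: smult_assoc)
      then have "?row (A \<otimes>\<^bsub>?M\<^esub> ?row B) \<odot>\<^bsub>V\<^esub> v = ?row (?row D) \<odot>\<^bsub>V\<^esub> v"
        using A B(1) D(1) by (intro well_defined) auto
      then have "y = ?row A \<odot>\<^bsub>V\<^esub> x"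
        using A B D v by (simp add: R.row_part_row_part R.row_part_mult[symmetric] smult_assoc)
      then have "y = ?e (A (p, p)) \<odot>\<^bsub>V\<^esub> x" using A x by (simp add: row_on_C)
      then show "\<exists>s\<in>carrier R. y = s \<odot>\<^bsub>T\<^esub> x" using matrices_entry[OF A(1) p p] by (auto simp: T_def)
    next
      fix \<theta> assume \<theta>: "semimodule_congruence R T \<theta>"
      note eq = semimodule_congruence_equiv[OF \<theta>]
      define \<eta> where "\<eta> = {(x, y). x \<in> carrier V \<and> y \<in> carrier V \<and>
        (\<forall>X\<in>matrices n (carrier R). (?row X \<odot>\<^bsub>V\<^esub> x, ?row X \<odot>\<^bsub>V\<^esub> y) \<in> \<theta>)}"
      have "semimodule_congruence ?M V \<eta>"
      proof (rule semimodule_congruenceI)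
        show "\<eta> \<subseteq> carrier V \<times> carrier V" by (auto simp: \<eta>_def)
        show "(x, x) \<in> \<eta>" if "x \<in> carrier V" for x
          using that eq row_C by (auto simp: \<eta>_def equiv_def refl_on_def T_def)
        show "(y, x) \<in> \<eta>" if "(x, y) \<in> \<eta>" for x y
          using that eq unfolding \<eta>_def equiv_def sym_def by blast
        show "(x, z) \<in> \<eta>" if "(x, y) \<in> \<eta>" "(y, z) \<in> \<eta>" for x y z
          using that eq unfolding \<eta>_def equiv_def trans_def by blast
      next
        fix x x' y y' assume "(x, x') \<in> \<eta>" "(y, y') \<in> \<eta>"
        then show "(x \<oplus>\<^bsub>V\<^esub> y, x' \<oplus>\<^bsub>V\<^esub> y') \<in> \<eta>"
          using semimodule_congruence_add[OF \<theta>] by (auto simp: \<eta>_def smult_distrib_left T_def)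
      next
        fix A x x' assume A: "A \<in> carrier ?M" and x: "(x, x') \<in> \<eta>"
        have "?row X \<odot>\<^bsub>V\<^esub> (A \<odot>\<^bsub>V\<^esub> u) = ?row (X \<otimes>\<^bsub>?M\<^esub> A) \<odot>\<^bsub>V\<^esub> u"
          if "X \<in> matrices n (carrier R)" "u \<in> carrier V" for X u
          using that A by (simp add: smult_assoc[symmetric] R.row_part_mult)
        then show "(A \<odot>\<^bsub>V\<^esub> x, A \<odot>\<^bsub>V\<^esub> x') \<in> \<eta>" using A x by (auto simp: \<eta>_def smult_closed)
      qed
      with V show "\<theta> = Id_on (carrier T) \<or> \<theta> = carrier T \<times> carrier T"
      proof (cases rule: congruence_cases_simple)
        case identity
        have "x = y" if xy: "(x, y) \<in> \<theta>" for x y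
        proof -
          have c: "x \<in> C" "y \<in> C" using equiv_type[OF eq] xy by (auto simp: T_def)
          have "(?row X \<odot>\<^bsub>V\<^esub> x, ?row X \<odot>\<^bsub>V\<^esub> y) \<in> \<theta>" if X: "X \<in> matrices n (carrier R)" for X
            using semimodule_congruence_smult[OF \<theta> xy matrices_entry[OF X p p]] c X
            by (simp add: row_on_C T_def)
          then have "(x, y) \<in> \<eta>" using c CV by (simp add: \<eta>_def)
          then show ?thesis using identity by auto
        qed
        then show ?thesis using congruence_IdI[OF eq] by blast
      next
        case full
        then have "(v, \<zero>\<^bsub>V\<^esub>) \<in> \<eta>" using v by simp
        then have "(?row X \<odot>\<^bsub>V\<^esub> v, \<zero>\<^bsub>V\<^esub>) \<in> \<theta>" if "X \<in> matrices n (carrier R)" for X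
          using that smult_zero[of "?row X"] by (auto simp: \<eta>_def)
        then have "(x, \<zero>\<^bsub>V\<^esub>) \<in> \<theta>" if "x \<in> carrier T" for x using that by (auto simp: T_def C_def)
        then show ?thesis using congruence_fullI[OF eq] by blast
      qed
    qed
    then have rT: "?e r \<odot>\<^bsub>V\<^esub> x = \<zero>\<^bsub>V\<^esub>" if "x \<in> C" for x
      using Js_subset_annihilator r that by (fastforce simp: annihilator_def T_def)
    have "?e r \<odot>\<^bsub>V\<^esub> x = \<zero>\<^bsub>V\<^esub>" if x: "x \<in> carrier V" for x
    proof -
      obtain A where A: "A \<in> matrices n (carrier R)" "x = A \<odot>\<^bsub>V\<^esub> v" using gen x by blast
      have "?e r \<odot>\<^bsub>V\<^esub> x = (?col (?e r) \<otimes>\<^bsub>?M\<^esub> A) \<odot>\<^bsub>V\<^esub> v"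
        using A v rR by (simp add: R.col_part_unit smult_assoc)
      also have "\<dots> = ?e r \<odot>\<^bsub>V\<^esub> (?row A \<odot>\<^bsub>V\<^esub> v)"
        using A v rR by (simp add: R.mult_row_part[symmetric] smult_assoc)
      finally show ?thesis using rT CI[OF A(1)] by simp
    qed
    then show ?thesis using rR by (simp add: annihilator_def)
  qed
qed

theorem Js_matrix_hemiring:
  assumes R: "hemiring R" and n: "n \<ge> 1"
  shows "Js (matrix_hemiring n R) = matrices n (Js R)"
proof (intro equalityI subsetI)
  let ?M = "matrix_hemiring n R"
  interpret R: hemiring R by (rule R)
  {
    fix A assume A: "A \<in> Js ?M"
    then have AM: "A \<in> matrices n (carrier R)" by (simp add: Js_def)
    have "A (i, j) \<in> Js R" if ij: "i < n" "j < n" for i j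
    proof -
      have "A (i, j) \<odot>\<^bsub>M\<^esub> x = \<zero>\<^bsub>M\<^esub>" if M: "simple_semimodule R M" and x: "x \<in> carrier M"
        for M :: "('a, 'a) module" and x
      proof -
        interpret left_semimodule R M using M by (simp add: simple_semimodule_def)
        have "A \<in> annihilator ?M (column_semimodule n M)"
          using Js_subset_annihilator[OF simple_semimodule_column[OF M n]] A by blast
        then have "A \<odot>\<^bsub>column_semimodule n M\<^esub> unit_column M n j x = \<zero>\<^bsub>column_semimodule n M\<^esub>"
          using x by (simp add: annihilator_def)
        then show ?thesis
          using smult_unit_column[OF AM x ij(2) ij(1)] ij by (simp del: column_entry(3))
      qed
      then show ?thesis using matrices_entry[OF AM ij] by (simp add: Js_def annihilator_def)
    qed
    then show "A \<in> matrices n (Js R)" using AM by (auto simp: matrices_def PiE_iff)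
  }
  fix A assume A: "A \<in> matrices n (Js R)"
  then have AM: "A \<in> matrices n (carrier R)" by (auto simp: matrices_def PiE_iff Js_def)
  have "A \<in> annihilator ?M V" if V: "simple_semimodule ?M V" for V :: "(nat \<times> nat \<Rightarrow> 'a, nat \<times> nat \<Rightarrow> 'a) module"
  proof -
    interpret V: left_semimodule ?M V using V by (simp add: simple_semimodule_def)
    note smult = V.smult_assoc[unfolded carrier_matrix_hemiring, symmetric]
      V.smult_closed[unfolded carrier_matrix_hemiring]
      V.smult_distrib_right[unfolded carrier_matrix_hemiring] V.zero_smult
      V.smult_zero[unfolded carrier_matrix_hemiring]
    have ann: "X \<odot>\<^bsub>V\<^esub> x = \<zero>\<^bsub>V\<^esub>" if "X \<in> annihilator ?M V" "x \<in> carrier V" for X x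
      using that by (simp add: annihilator_def)
    have unit: "matrix_unit R n i j r \<in> annihilator ?M V" if r: "r \<in> Js R" and ij: "i < n" "j < n" for i j r
    proof -
      have rR: "r \<in> carrier R" using r by (simp add: Js_def)
      have "matrix_unit R n i j r \<odot>\<^bsub>V\<^esub> x = \<zero>\<^bsub>V\<^esub>" if x: "x \<in> carrier V" for x
      proof (rule simple_semimodule_cancel[OF V])
        fix D assume D: "D \<in> carrier ?M"
        let ?Z = "{D \<in> matrices n (carrier R). D \<odot>\<^bsub>V\<^esub> (matrix_unit R n i j r \<odot>\<^bsub>V\<^esub> x) = \<zero>\<^bsub>V\<^esub>}"
        have "D \<in> ?Z"
        proof (rule R.matrix_mem_submonoid)
          fix k l assume kl: "k < n" "l < n"
          then have d: "D (k, l) \<in> carrier R" using D by (auto intro: matrices_entry)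
          have "matrix_unit R n k l (D (k, l)) \<odot>\<^bsub>V\<^esub> (matrix_unit R n i j r \<odot>\<^bsub>V\<^esub> x) = \<zero>\<^bsub>V\<^esub>"
          proof (cases "l = i")
            case True
            \<comment> \<open>\<open>(d e\<^sub>k\<^sub>i) (r e\<^sub>i\<^sub>j) = (d e\<^sub>k\<^sub>j) (r e\<^sub>j\<^sub>j)\<close> moves \<open>r\<close> to the diagonal.\<close>
            have "matrix_unit R n k j (D (k, l)) \<odot>\<^bsub>V\<^esub> (matrix_unit R n j j r \<odot>\<^bsub>V\<^esub> x) = \<zero>\<^bsub>V\<^esub>"
              using Js_diagonal_unit[OF R V r ij(2)] x d by (simp add: ann smult(5))
            then show ?thesis using True d rR x ij by (simp add: smult(1) R.unit_mult_unit)
          next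
            case False
            then show ?thesis using d rR x kl by (simp add: smult R.unit_mult_unit_zero)
          qed
          then show "matrix_unit R n k l (D (k, l)) \<in> ?Z" using d by simp
        qed (use D x rR in \<open>auto simp: smult(2-4)\<close>)
        then show "D \<odot>\<^bsub>V\<^esub> (matrix_unit R n i j r \<odot>\<^bsub>V\<^esub> x) = D \<odot>\<^bsub>V\<^esub> \<zero>\<^bsub>V\<^esub>"
          using D by (simp add: smult(5))
      qed (use x rR in \<open>auto simp: smult(2)\<close>)
      then show ?thesis using rR by (simp add: annihilator_def)
    qed
    show ?thesis
    proof (rule R.matrix_mem_submonoid[OF AM])
      show "matrix_unit R n i j (A (i, j)) \<in> annihilator ?M V" if "i < n" "j < n" for i j
        using unit that matrices_entry[OF A that] by blast
    qed (auto simp: annihilator_def smult(2-4))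
  qed
  then show "A \<in> Js ?M" using AM by (simp add: Js_def)
qed


section \<open>Formal differences and quasi-regularity\<close>

text \<open>
  The pair \<open>(a, b)\<close> stands for the formal difference \<open>a - b\<close>; swapping its components is the change
  of sign. The ring of differences would identify the balanced pairs with \<open>0\<close> and so
  see equations in \<open>R\<close> only up to cancellation. Semiregularity asks for equations in \<open>R\<close>, so the
  pairs are kept as they are, and "equal to \<open>0\<close>" is replaced by "balanced".
\<close>

definition pair_hemiring :: "('a, 'b) ring_scheme \<Rightarrow> ('a \<times> 'a) ring"
  where "pair_hemiring R =
    \<lparr>carrier = carrier R \<times> carrier R,
     mult = (\<lambda>(a, b) (c, d). (a \<otimes>\<^bsub>R\<^esub> c \<oplus>\<^bsub>R\<^esub> b \<otimes>\<^bsub>R\<^esub> d, a \<otimes>\<^bsub>R\<^esub> d \<oplus>\<^bsub>R\<^esub> b \<otimes>\<^bsub>R\<^esub> c)),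
     one = (\<one>\<^bsub>R\<^esub>, \<zero>\<^bsub>R\<^esub>), zero = (\<zero>\<^bsub>R\<^esub>, \<zero>\<^bsub>R\<^esub>),
     add = (\<lambda>(a, b) (c, d). (a \<oplus>\<^bsub>R\<^esub> c, b \<oplus>\<^bsub>R\<^esub> d))\<rparr>"

definition balanced :: "'a \<times> 'a \<Rightarrow> bool"
  where "balanced p \<longleftrightarrow> fst p = snd p"

text \<open>
  For \<open>p = a - b\<close> this is \<open>p + q + p q = 0\<close>, that is \<open>(1 + p) (1 + q) = 1\<close>.
\<close>

definition quasi_regular :: "('a, 'b) ring_scheme \<Rightarrow> 'a \<times> 'a \<Rightarrow> bool"
  where "quasi_regular R p \<longleftrightarrow> (\<exists>q\<in>carrier (pair_hemiring R).
    balanced (p \<oplus>\<^bsub>pair_hemiring R\<^esub> q \<oplus>\<^bsub>pair_hemiring R\<^esub> p \<otimes>\<^bsub>pair_hemiring R\<^esub> q))"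

lemma pair_in_carrier: "(a, b) \<in> carrier (pair_hemiring R) \<longleftrightarrow> a \<in> carrier R \<and> b \<in> carrier R"
  and pair_carrier: "carrier (pair_hemiring R) = carrier R \<times> carrier R"
  and pair_add: "(a, b) \<oplus>\<^bsub>pair_hemiring R\<^esub> (c, d) = (a \<oplus>\<^bsub>R\<^esub> c, b \<oplus>\<^bsub>R\<^esub> d)"
  and pair_mult: "(a, b) \<otimes>\<^bsub>pair_hemiring R\<^esub> (c, d) =
    (a \<otimes>\<^bsub>R\<^esub> c \<oplus>\<^bsub>R\<^esub> b \<otimes>\<^bsub>R\<^esub> d, a \<otimes>\<^bsub>R\<^esub> d \<oplus>\<^bsub>R\<^esub> b \<otimes>\<^bsub>R\<^esub> c)"
  and pair_zero: "\<zero>\<^bsub>pair_hemiring R\<^esub> = (\<zero>\<^bsub>R\<^esub>, \<zero>\<^bsub>R\<^esub>)"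
  by (simp_all add: pair_hemiring_def)

lemma quasi_regular_pair:
  "quasi_regular R (a, b) \<longleftrightarrow> (\<exists>c\<in>carrier R. \<exists>d\<in>carrier R.
    a \<oplus>\<^bsub>R\<^esub> c \<oplus>\<^bsub>R\<^esub> (a \<otimes>\<^bsub>R\<^esub> c \<oplus>\<^bsub>R\<^esub> b \<otimes>\<^bsub>R\<^esub> d) = b \<oplus>\<^bsub>R\<^esub> d \<oplus>\<^bsub>R\<^esub> (a \<otimes>\<^bsub>R\<^esub> d \<oplus>\<^bsub>R\<^esub> b \<otimes>\<^bsub>R\<^esub> c))"
  by (simp add: quasi_regular_def pair_carrier pair_add pair_mult balanced_def)

context hemiring
begin

lemma hemiring_pair_hemiring: "hemiring (pair_hemiring R)"
proof -
  have "abelian_monoid (pair_hemiring R)"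
    by (rule abelian_monoidI) (auto simp: pair_carrier pair_add pair_zero a_ac)
  then show ?thesis
    by (intro hemiring.intro hemiring_axioms.intro)
      (auto simp: pair_carrier pair_add pair_mult pair_zero distrib_left distrib_right mult_assoc a_ac)
qed

interpretation P: hemiring "pair_hemiring R" by (rule hemiring_pair_hemiring)

lemma swap_closed: "p \<in> carrier (pair_hemiring R) \<Longrightarrow> prod.swap p \<in> carrier (pair_hemiring R)"
  by (auto simp: pair_carrier)

lemma swap_add:
  "prod.swap (p \<oplus>\<^bsub>pair_hemiring R\<^esub> q) = prod.swap p \<oplus>\<^bsub>pair_hemiring R\<^esub> prod.swap q"
  by (cases p; cases q) (simp add: pair_add)

lemma mult_swap:
  "p \<in> carrier (pair_hemiring R) \<Longrightarrow> q \<in> carrier (pair_hemiring R) \<Longrightarrow>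
    p \<otimes>\<^bsub>pair_hemiring R\<^esub> prod.swap q = prod.swap (p \<otimes>\<^bsub>pair_hemiring R\<^esub> q)"
  by (auto simp: pair_carrier pair_mult)

lemma balanced_add:
  "balanced p \<Longrightarrow> balanced q \<Longrightarrow> balanced (p \<oplus>\<^bsub>pair_hemiring R\<^esub> q)"
  by (cases p; cases q) (simp add: balanced_def pair_add)

lemma balanced_swap: "balanced (prod.swap p) \<longleftrightarrow> balanced p"
  by (auto simp: balanced_def)

lemma balanced_add_swap:
  "p \<in> carrier (pair_hemiring R) \<Longrightarrow> balanced (p \<oplus>\<^bsub>pair_hemiring R\<^esub> prod.swap p)"
  by (auto simp: balanced_def pair_carrier pair_add a_ac)

lemma balanced_add_swap_add:
  "p \<in> carrier (pair_hemiring R) \<Longrightarrow> balanced w \<Longrightarrow>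
    balanced (p \<oplus>\<^bsub>pair_hemiring R\<^esub> prod.swap p \<oplus>\<^bsub>pair_hemiring R\<^esub> prod.swap w)"
  by (intro balanced_add balanced_add_swap) (simp_all add: balanced_swap)

lemma quasi_regularI:
  "q \<in> carrier (pair_hemiring R) \<Longrightarrow>
    balanced (p \<oplus>\<^bsub>pair_hemiring R\<^esub> q \<oplus>\<^bsub>pair_hemiring R\<^esub> p \<otimes>\<^bsub>pair_hemiring R\<^esub> q) \<Longrightarrow> quasi_regular R p"
  unfolding quasi_regular_def by blast

lemma balanced_mult:
  assumes "balanced p" "p \<in> carrier (pair_hemiring R)" "q \<in> carrier (pair_hemiring R)"
  shows "balanced (p \<otimes>\<^bsub>pair_hemiring R\<^esub> q)" "balanced (q \<otimes>\<^bsub>pair_hemiring R\<^esub> p)"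
  using assms by (auto simp: balanced_def pair_carrier pair_mult a_ac)

lemmas pair_simps = P.distrib_left P.distrib_right P.mult_assoc P.a_ac mult_swap swap_add swap_closed

text \<open>
  The operation \<open>p \<circ> q = p + q + p q\<close> is associative, so a right quasi-inverse \<open>s\<close> of \<open>p \<circ> q\<close> gives
  the right quasi-inverse \<open>q \<circ> s\<close> of \<open>p\<close>.
\<close>

lemma quasi_regular_circle:
  assumes pq: "p \<in> carrier (pair_hemiring R)" "q \<in> carrier (pair_hemiring R)"
    and qr: "quasi_regular R (p \<oplus>\<^bsub>pair_hemiring R\<^esub> q \<oplus>\<^bsub>pair_hemiring R\<^esub> p \<otimes>\<^bsub>pair_hemiring R\<^esub> q)"
  shows "quasi_regular R p"
proof -
  let ?P = "pair_hemiring R"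
  obtain s where s: "s \<in> carrier ?P"
    "balanced (p \<oplus>\<^bsub>?P\<^esub> q \<oplus>\<^bsub>?P\<^esub> p \<otimes>\<^bsub>?P\<^esub> q \<oplus>\<^bsub>?P\<^esub> s \<oplus>\<^bsub>?P\<^esub> (p \<oplus>\<^bsub>?P\<^esub> q \<oplus>\<^bsub>?P\<^esub> p \<otimes>\<^bsub>?P\<^esub> q) \<otimes>\<^bsub>?P\<^esub> s)"
    using qr by (auto simp: quasi_regular_def)
  let ?t = "q \<oplus>\<^bsub>?P\<^esub> s \<oplus>\<^bsub>?P\<^esub> q \<otimes>\<^bsub>?P\<^esub> s"
  have "p \<oplus>\<^bsub>?P\<^esub> q \<oplus>\<^bsub>?P\<^esub> p \<otimes>\<^bsub>?P\<^esub> q \<oplus>\<^bsub>?P\<^esub> s \<oplus>\<^bsub>?P\<^esub> (p \<oplus>\<^bsub>?P\<^esub> q \<oplus>\<^bsub>?P\<^esub> p \<otimes>\<^bsub>?P\<^esub> q) \<otimes>\<^bsub>?P\<^esub> s =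
    p \<oplus>\<^bsub>?P\<^esub> ?t \<oplus>\<^bsub>?P\<^esub> p \<otimes>\<^bsub>?P\<^esub> ?t"
    using pq s(1) by (simp add: pair_simps)
  then show ?thesis
    using s pq unfolding quasi_regular_def by (intro bexI[of _ ?t]) auto
qed

lemma quasi_regular_add_balanced:
  assumes pz: "p \<in> carrier (pair_hemiring R)" "z \<in> carrier (pair_hemiring R)"
    and qr: "quasi_regular R p" and z: "balanced z"
  shows "quasi_regular R (p \<oplus>\<^bsub>pair_hemiring R\<^esub> z)"
proof -
  let ?P = "pair_hemiring R"
  obtain q where q: "q \<in> carrier ?P" "balanced (p \<oplus>\<^bsub>?P\<^esub> q \<oplus>\<^bsub>?P\<^esub> p \<otimes>\<^bsub>?P\<^esub> q)"
    using qr by (auto simp: quasi_regular_def)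
  have "p \<oplus>\<^bsub>?P\<^esub> z \<oplus>\<^bsub>?P\<^esub> q \<oplus>\<^bsub>?P\<^esub> (p \<oplus>\<^bsub>?P\<^esub> z) \<otimes>\<^bsub>?P\<^esub> q =
    (p \<oplus>\<^bsub>?P\<^esub> q \<oplus>\<^bsub>?P\<^esub> p \<otimes>\<^bsub>?P\<^esub> q) \<oplus>\<^bsub>?P\<^esub> (z \<oplus>\<^bsub>?P\<^esub> z \<otimes>\<^bsub>?P\<^esub> q)"
    using pz q(1) by (simp add: pair_simps)
  moreover have "balanced ((p \<oplus>\<^bsub>?P\<^esub> q \<oplus>\<^bsub>?P\<^esub> p \<otimes>\<^bsub>?P\<^esub> q) \<oplus>\<^bsub>?P\<^esub> (z \<oplus>\<^bsub>?P\<^esub> z \<otimes>\<^bsub>?P\<^esub> q))"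
    by (intro balanced_add[OF q(2)] balanced_add[OF z] balanced_mult(1)[OF z pz(2) q(1)])
  ultimately show ?thesis using q(1) by (intro quasi_regularI[of q]) simp_all
qed

text \<open>This is \<open>p \<circ> (- p) = - p\<^sup>2\<close>.\<close>

lemma quasi_regular_square:
  assumes p: "p \<in> carrier (pair_hemiring R)"
    and qr: "quasi_regular R (prod.swap (p \<otimes>\<^bsub>pair_hemiring R\<^esub> p))"
  shows "quasi_regular R p"
proof -
  let ?P = "pair_hemiring R"
  have "quasi_regular R (prod.swap (p \<otimes>\<^bsub>?P\<^esub> p) \<oplus>\<^bsub>?P\<^esub> (p \<oplus>\<^bsub>?P\<^esub> prod.swap p))"
    using p qr by (intro quasi_regular_add_balanced balanced_add_swap) (auto simp: swap_closed)
  moreover have "prod.swap (p \<otimes>\<^bsub>?P\<^esub> p) \<oplus>\<^bsub>?P\<^esub> (p \<oplus>\<^bsub>?P\<^esub> prod.swap p) =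
    p \<oplus>\<^bsub>?P\<^esub> prod.swap p \<oplus>\<^bsub>?P\<^esub> p \<otimes>\<^bsub>?P\<^esub> prod.swap p"
    using p by (simp add: pair_simps)
  ultimately show ?thesis
    using quasi_regular_circle[OF p, of "prod.swap p"] p by (simp add: swap_closed)
qed

text \<open>If \<open>(1 + a b) (1 + q) = 1\<close>, then \<open>1 - b a - b q a\<close> is a right inverse of \<open>1 + b a\<close>.\<close>

lemma quasi_regular_commute:
  assumes ab: "a \<in> carrier (pair_hemiring R)" "b \<in> carrier (pair_hemiring R)"
    and qr: "quasi_regular R (a \<otimes>\<^bsub>pair_hemiring R\<^esub> b)"
  shows "quasi_regular R (b \<otimes>\<^bsub>pair_hemiring R\<^esub> a)"
proof -
  let ?P = "pair_hemiring R"
  obtain q where q: "q \<in> carrier ?P" "balanced (a \<otimes>\<^bsub>?P\<^esub> b \<oplus>\<^bsub>?P\<^esub> q \<oplus>\<^bsub>?P\<^esub> a \<otimes>\<^bsub>?P\<^esub> b \<otimes>\<^bsub>?P\<^esub> q)"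
    using qr by (auto simp: quasi_regular_def)
  let ?c = "prod.swap (b \<otimes>\<^bsub>?P\<^esub> a \<oplus>\<^bsub>?P\<^esub> b \<otimes>\<^bsub>?P\<^esub> q \<otimes>\<^bsub>?P\<^esub> a)"
  have "b \<otimes>\<^bsub>?P\<^esub> a \<oplus>\<^bsub>?P\<^esub> ?c \<oplus>\<^bsub>?P\<^esub> b \<otimes>\<^bsub>?P\<^esub> a \<otimes>\<^bsub>?P\<^esub> ?c =
    (b \<otimes>\<^bsub>?P\<^esub> a \<oplus>\<^bsub>?P\<^esub> prod.swap (b \<otimes>\<^bsub>?P\<^esub> a)) \<oplus>\<^bsub>?P\<^esub>
    prod.swap (b \<otimes>\<^bsub>?P\<^esub> (a \<otimes>\<^bsub>?P\<^esub> b \<oplus>\<^bsub>?P\<^esub> q \<oplus>\<^bsub>?P\<^esub> a \<otimes>\<^bsub>?P\<^esub> b \<otimes>\<^bsub>?P\<^esub> q) \<otimes>\<^bsub>?P\<^esub> a)"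
    using ab q(1) by (simp add: pair_simps)
  moreover have "balanced ((b \<otimes>\<^bsub>?P\<^esub> a \<oplus>\<^bsub>?P\<^esub> prod.swap (b \<otimes>\<^bsub>?P\<^esub> a)) \<oplus>\<^bsub>?P\<^esub>
    prod.swap (b \<otimes>\<^bsub>?P\<^esub> (a \<otimes>\<^bsub>?P\<^esub> b \<oplus>\<^bsub>?P\<^esub> q \<oplus>\<^bsub>?P\<^esub> a \<otimes>\<^bsub>?P\<^esub> b \<otimes>\<^bsub>?P\<^esub> q) \<otimes>\<^bsub>?P\<^esub> a))"
    using ab q by (intro balanced_add_swap_add balanced_mult(1)[OF balanced_mult(2)]) auto
  ultimately show ?thesis
    using ab q(1) unfolding quasi_regular_def by (intro bexI[of _ ?c]) (auto simp: swap_closed)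
qed

text \<open>If \<open>(1 + p) (1 + q) = 1\<close>, then \<open>- (1 + q) g\<close> solves \<open>g + x + p x = 0\<close>.\<close>

lemma balanced_solution:
  assumes "p \<in> carrier (pair_hemiring R)" "q \<in> carrier (pair_hemiring R)" "g \<in> carrier (pair_hemiring R)"
    and "balanced (p \<oplus>\<^bsub>pair_hemiring R\<^esub> q \<oplus>\<^bsub>pair_hemiring R\<^esub> p \<otimes>\<^bsub>pair_hemiring R\<^esub> q)"
  defines "x \<equiv> prod.swap (g \<oplus>\<^bsub>pair_hemiring R\<^esub> q \<otimes>\<^bsub>pair_hemiring R\<^esub> g)"
  shows "balanced (g \<oplus>\<^bsub>pair_hemiring R\<^esub> x \<oplus>\<^bsub>pair_hemiring R\<^esub> p \<otimes>\<^bsub>pair_hemiring R\<^esub> x)"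
proof -
  let ?P = "pair_hemiring R"
  have "g \<oplus>\<^bsub>?P\<^esub> x \<oplus>\<^bsub>?P\<^esub> p \<otimes>\<^bsub>?P\<^esub> x = (g \<oplus>\<^bsub>?P\<^esub> prod.swap g) \<oplus>\<^bsub>?P\<^esub>
    prod.swap ((p \<oplus>\<^bsub>?P\<^esub> q \<oplus>\<^bsub>?P\<^esub> p \<otimes>\<^bsub>?P\<^esub> q) \<otimes>\<^bsub>?P\<^esub> g)"
    using assms(1-3) by (simp add: x_def pair_simps)
  moreover have "balanced ((g \<oplus>\<^bsub>?P\<^esub> prod.swap g) \<oplus>\<^bsub>?P\<^esub>
    prod.swap ((p \<oplus>\<^bsub>?P\<^esub> q \<oplus>\<^bsub>?P\<^esub> p \<otimes>\<^bsub>?P\<^esub> q) \<otimes>\<^bsub>?P\<^esub> g))"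
    using assms(1-4) by (intro balanced_add_swap_add balanced_mult(1)) auto
  ultimately show ?thesis by simp
qed


section \<open>The Jacobson--Bourne radical\<close>

lemma right_hemiring_idealD:
  assumes "right_hemiring_ideal I R"
  shows "x \<in> I \<Longrightarrow> x \<in> carrier R" "\<zero> \<in> I" "x \<in> I \<Longrightarrow> y \<in> I \<Longrightarrow> x \<oplus> y \<in> I"
    and "x \<in> I \<Longrightarrow> r \<in> carrier R \<Longrightarrow> x \<otimes> r \<in> I"
  using assms by (auto simp: right_hemiring_ideal_def)

lemma right_hemiring_idealI:
  assumes "\<And>x. x \<in> I \<Longrightarrow> x \<in> carrier R" "\<zero> \<in> I" "\<And>x y. x \<in> I \<Longrightarrow> y \<in> I \<Longrightarrow> x \<oplus> y \<in> I"
    and "\<And>x r. x \<in> I \<Longrightarrow> r \<in> carrier R \<Longrightarrow> x \<otimes> r \<in> I"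
  shows "right_hemiring_ideal I R"
  using assms by (auto simp: right_hemiring_ideal_def)

lemma pair_right_ideal:
  assumes I: "right_hemiring_ideal I R" and p: "p \<in> I \<times> I"
  shows "p \<in> carrier (pair_hemiring R)" "prod.swap p \<in> I \<times> I"
    and "q \<in> I \<times> I \<Longrightarrow> p \<oplus>\<^bsub>pair_hemiring R\<^esub> q \<in> I \<times> I"
    and "q \<in> carrier (pair_hemiring R) \<Longrightarrow> p \<otimes>\<^bsub>pair_hemiring R\<^esub> q \<in> I \<times> I"
  using p right_hemiring_idealD[OF I] by (auto simp: pair_carrier pair_add pair_mult)

text \<open>If \<open>p + q + p q = 0\<close>, then \<open>- p - p q\<close> is a quasi-inverse as good as \<open>q\<close>, and it lies in
  every right ideal that contains \<open>p\<close>.\<close>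

lemma right_semiregular_iff:
  assumes I: "right_hemiring_ideal I R"
  shows "right_semiregular R I \<longleftrightarrow> (\<forall>p\<in>I \<times> I. quasi_regular R p)"
proof
  note IR = right_hemiring_idealD(1)[OF I]
  assume sr: "right_semiregular R I"
  have "quasi_regular R (a, b)" if ab: "a \<in> I" "b \<in> I" for a b
  proof -
    obtain c d where cd: "c \<in> I" "d \<in> I"
      "a \<oplus> c \<oplus> a \<otimes> c \<oplus> b \<otimes> d = b \<oplus> d \<oplus> a \<otimes> d \<oplus> b \<otimes> c"
      using sr ab unfolding right_semiregular_def by meson
    then show ?thesis
      using ab IR unfolding quasi_regular_pair by (intro bexI[of _ c] bexI[of _ d]) (auto simp: a_assoc)
  qed
  then show "\<forall>p\<in>I \<times> I. quasi_regular R p" by auto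
next
  let ?P = "pair_hemiring R"
  note IR = right_hemiring_idealD(1)[OF I]
  assume qr: "\<forall>p\<in>I \<times> I. quasi_regular R p"
  show "right_semiregular R I"
    unfolding right_semiregular_def
  proof (intro ballI)
    fix a b assume ab: "a \<in> I" "b \<in> I"
    define p where "p = (a, b)"
    have pI: "p \<in> I \<times> I" using ab by (simp add: p_def)
    note p = pair_right_ideal(1)[OF I pI]
    obtain q where q: "q \<in> carrier ?P" "balanced (p \<oplus>\<^bsub>?P\<^esub> q \<oplus>\<^bsub>?P\<^esub> p \<otimes>\<^bsub>?P\<^esub> q)"
      using qr pI unfolding quasi_regular_def by blast
    obtain c d where cd: "prod.swap (p \<oplus>\<^bsub>?P\<^esub> p \<otimes>\<^bsub>?P\<^esub> q) = (c, d)" by fastforce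
    have cdI: "(c, d) \<in> I \<times> I"
      unfolding cd[symmetric]
      by (intro pair_right_ideal(2,3)[OF I] pair_right_ideal(4)[OF I _ q(1)] pI)
    have "p \<oplus>\<^bsub>?P\<^esub> (c, d) \<oplus>\<^bsub>?P\<^esub> p \<otimes>\<^bsub>?P\<^esub> (c, d) = (p \<oplus>\<^bsub>?P\<^esub> prod.swap p) \<oplus>\<^bsub>?P\<^esub>
      prod.swap (p \<otimes>\<^bsub>?P\<^esub> (p \<oplus>\<^bsub>?P\<^esub> q \<oplus>\<^bsub>?P\<^esub> p \<otimes>\<^bsub>?P\<^esub> q))"
      unfolding cd[symmetric] using p q(1) by (simp add: pair_simps)
    moreover have "balanced ((p \<oplus>\<^bsub>?P\<^esub> prod.swap p) \<oplus>\<^bsub>?P\<^esub>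
      prod.swap (p \<otimes>\<^bsub>?P\<^esub> (p \<oplus>\<^bsub>?P\<^esub> q \<oplus>\<^bsub>?P\<^esub> p \<otimes>\<^bsub>?P\<^esub> q)))"
      using p q by (intro balanced_add_swap_add balanced_mult(2)) auto
    ultimately have "balanced (p \<oplus>\<^bsub>?P\<^esub> (c, d) \<oplus>\<^bsub>?P\<^esub> p \<otimes>\<^bsub>?P\<^esub> (c, d))"
      by (simp only:)
    then have "a \<oplus> c \<oplus> (a \<otimes> c \<oplus> b \<otimes> d) = b \<oplus> d \<oplus> (a \<otimes> d \<oplus> b \<otimes> c)"
      by (simp add: p_def pair_add pair_mult balanced_def)
    then have "a \<oplus> c \<oplus> a \<otimes> c \<oplus> b \<otimes> d = b \<oplus> d \<oplus> a \<otimes> d \<oplus> b \<otimes> c"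
      using cdI ab IR by (simp add: a_assoc)
    then show "\<exists>c\<in>I. \<exists>d\<in>I. a \<oplus> c \<oplus> a \<otimes> c \<oplus> b \<otimes> d = b \<oplus> d \<oplus> a \<otimes> d \<oplus> b \<otimes> c"
      using cdI by blast
  qed
qed

text \<open>
  In the sum \<open>I + K\<close>, let \<open>q\<close> be a quasi-inverse of \<open>a\<close>. Then \<open>(a + b) \<circ> q = b + b q\<close> up to a
  balanced summand, and the right-hand side is a formal difference in \<open>K\<close>.
\<close>

lemma semiregular_ideal_add:
  assumes I: "right_hemiring_ideal I R" "right_semiregular R I"
    and K: "right_hemiring_ideal K R" "right_semiregular R K"
  obtains L where "right_hemiring_ideal L R" "right_semiregular R L" "I \<subseteq> L" "K \<subseteq> L"
proof -
  let ?P = "pair_hemiring R"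
  note ID = right_hemiring_idealD[OF I(1)] and KD = right_hemiring_idealD[OF K(1)]
  define L where "L = {a \<oplus> b |a b. a \<in> I \<and> b \<in> K}"
  have LI: "a \<oplus> b \<in> L" if "a \<in> I" "b \<in> K" for a b using that by (auto simp: L_def)
  have L: "right_hemiring_ideal L R"
  proof (rule right_hemiring_idealI)
    show "x \<in> carrier R" if "x \<in> L" for x using that ID KD by (auto simp: L_def)
    show "\<zero> \<in> L" using LI[OF ID(2) KD(2)] by simp
  next
    fix x y assume "x \<in> L" "y \<in> L"
    then obtain a b c d where *: "x = a \<oplus> b" "y = c \<oplus> d" "a \<in> I" "b \<in> K" "c \<in> I" "d \<in> K"
      by (auto simp: L_def)
    have "x \<oplus> y = (a \<oplus> c) \<oplus> (b \<oplus> d)" using * ID(1) KD(1) by (simp add: a_ac)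
    then show "x \<oplus> y \<in> L" using LI ID(3) KD(3) * by simp
  next
    fix x r assume "x \<in> L" and r: "r \<in> carrier R"
    then obtain a b where *: "x = a \<oplus> b" "a \<in> I" "b \<in> K" by (auto simp: L_def)
    have "x \<otimes> r = a \<otimes> r \<oplus> b \<otimes> r" using * r ID(1) KD(1) by (simp add: distrib_right)
    then show "x \<otimes> r \<in> L" using LI ID(4) KD(4) * r by simp
  qed
  have "quasi_regular R p" if p: "p \<in> L \<times> L" for p
  proof -
    obtain x y where xy: "p = (x, y)" "x \<in> L" "y \<in> L" using p by auto
    obtain a1 b1 a2 b2 where *: "x = a1 \<oplus> b1" "y = a2 \<oplus> b2" "a1 \<in> I" "b1 \<in> K" "a2 \<in> I" "b2 \<in> K"
      using xy by (auto simp: L_def)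
    define a b where "a = (a1, a2)" and "b = (b1, b2)"
    have ab: "a \<in> I \<times> I" "b \<in> K \<times> K" "p = a \<oplus>\<^bsub>?P\<^esub> b" using xy * by (auto simp: a_def b_def pair_add)
    note c = pair_right_ideal(1)[OF I(1) ab(1)] pair_right_ideal(1)[OF K(1) ab(2)]
    obtain q where q: "q \<in> carrier ?P" "balanced (a \<oplus>\<^bsub>?P\<^esub> q \<oplus>\<^bsub>?P\<^esub> a \<otimes>\<^bsub>?P\<^esub> q)"
      using I ab(1) right_semiregular_iff[OF I(1)] unfolding quasi_regular_def by blast
    have "b \<oplus>\<^bsub>?P\<^esub> b \<otimes>\<^bsub>?P\<^esub> q \<in> K \<times> K"
      by (intro pair_right_ideal(3)[OF K(1)] pair_right_ideal(4)[OF K(1) _ q(1)] ab(2))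
    then have "quasi_regular R (b \<oplus>\<^bsub>?P\<^esub> b \<otimes>\<^bsub>?P\<^esub> q)"
      by (rule right_semiregular_iff[OF K(1), THEN iffD1, OF K(2), THEN bspec])
    then have "quasi_regular R ((b \<oplus>\<^bsub>?P\<^esub> b \<otimes>\<^bsub>?P\<^esub> q) \<oplus>\<^bsub>?P\<^esub> (a \<oplus>\<^bsub>?P\<^esub> q \<oplus>\<^bsub>?P\<^esub> a \<otimes>\<^bsub>?P\<^esub> q))"
      using c q by (intro quasi_regular_add_balanced[of "b \<oplus>\<^bsub>?P\<^esub> b \<otimes>\<^bsub>?P\<^esub> q"]) simp_all
    moreover have "(b \<oplus>\<^bsub>?P\<^esub> b \<otimes>\<^bsub>?P\<^esub> q) \<oplus>\<^bsub>?P\<^esub> (a \<oplus>\<^bsub>?P\<^esub> q \<oplus>\<^bsub>?P\<^esub> a \<otimes>\<^bsub>?P\<^esub> q) = p \<oplus>\<^bsub>?P\<^esub> q \<oplus>\<^bsub>?P\<^esub> p \<otimes>\<^bsub>?P\<^esub> q"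
      using c q(1) by (simp add: ab(3) pair_simps)
    ultimately show ?thesis
      using quasi_regular_circle[of p q] c q(1) by (simp add: ab(3))
  qed
  then have "right_semiregular R L" using L by (simp add: right_semiregular_iff)
  moreover have "I \<subseteq> L"
  proof
    fix x assume "x \<in> I"
    then show "x \<in> L" using LI[of x \<zero>] KD(2) ID(1) by simp
  qed
  moreover have "K \<subseteq> L"
  proof
    fix x assume "x \<in> K"
    then show "x \<in> L" using LI[of \<zero> x] ID(2) KD(1) by simp
  qed
  ultimately show ?thesis using that L by blast
qed

lemma jacobson_radical_eq_Union:
  "jacobson_radical R = \<Union> {I. right_hemiring_ideal I R \<and> right_semiregular R I}" (is "_ = ?U")
proof (intro equalityI subsetI)
  fix x assume "x \<in> jacobson_radical R"
  then obtain m :: nat and y where x: "x = (\<Oplus>k\<in>{..<m}. y k)" and y: "\<And>k. k < m \<Longrightarrow> y k \<in> ?U"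
    by (auto simp: jacobson_radical_def ideal_sum_def)
  show "x \<in> ?U"
    unfolding x
  proof (rule finsum_mem_submonoid)
    show "?U \<subseteq> carrier R" using right_hemiring_idealD(1) by blast
    have "right_hemiring_ideal {\<zero>} R" by (rule right_hemiring_idealI) auto
    moreover have "right_semiregular R {\<zero>}" by (simp add: right_semiregular_def)
    ultimately show "\<zero> \<in> ?U" by blast
  next
    fix a b assume "a \<in> ?U" "b \<in> ?U"
    then obtain I K where IK: "right_hemiring_ideal I R" "right_semiregular R I" "a \<in> I"
      "right_hemiring_ideal K R" "right_semiregular R K" "b \<in> K" by blast
    then obtain L where L: "right_hemiring_ideal L R" "right_semiregular R L" "I \<subseteq> L" "K \<subseteq> L"
      using semiregular_ideal_add by metis
    then have "a \<oplus> b \<in> L" using IK right_hemiring_idealD(3)[OF L(1)] by blast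
    then show "a \<oplus> b \<in> ?U" using L by blast
  qed (use y in auto)
next
  fix x assume x: "x \<in> ?U"
  then have "x \<in> carrier R" using right_hemiring_idealD(1) by blast
  then have "x = (\<Oplus>k\<in>{..<(1 :: nat)}. x)" by (simp add: lessThan_Suc)
  moreover have "\<forall>k<(1 :: nat). x \<in> ?U" using x by simp
  ultimately show "x \<in> jacobson_radical R" unfolding jacobson_radical_def ideal_sum_def by blast
qed

lemma semiregular_subset_jacobson_radical:
  "right_hemiring_ideal I R \<Longrightarrow> (\<And>p. p \<in> I \<times> I \<Longrightarrow> quasi_regular R p) \<Longrightarrow> I \<subseteq> jacobson_radical R"
  by (auto simp: jacobson_radical_eq_Union right_semiregular_iff)

lemma jacobson_radical_obtains:
  assumes "x \<in> jacobson_radical R" "y \<in> jacobson_radical R"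
  obtains L where "right_hemiring_ideal L R" "right_semiregular R L" "x \<in> L" "y \<in> L"
    "L \<subseteq> jacobson_radical R"
proof -
  obtain I K where IK: "right_hemiring_ideal I R" "right_semiregular R I" "x \<in> I"
    "right_hemiring_ideal K R" "right_semiregular R K" "y \<in> K"
    using assms by (auto simp: jacobson_radical_eq_Union)
  then obtain L where L: "right_hemiring_ideal L R" "right_semiregular R L" "I \<subseteq> L" "K \<subseteq> L"
    using semiregular_ideal_add by metis
  moreover have "L \<subseteq> jacobson_radical R" using L by (auto simp: jacobson_radical_eq_Union)
  ultimately show ?thesis using that IK by blast
qed

lemma jacobson_radical_quasi_regular:
  assumes "p \<in> jacobson_radical R \<times> jacobson_radical R"
  shows "quasi_regular R p"
proof -
  obtain x y where p: "p = (x, y)" and xy: "x \<in> jacobson_radical R" "y \<in> jacobson_radical R"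
    using assms by auto
  obtain L where "right_hemiring_ideal L R" "right_semiregular R L" "x \<in> L" "y \<in> L"
    using xy by (rule jacobson_radical_obtains)
  then show ?thesis by (simp add: p right_semiregular_iff)
qed

lemma jacobson_radical_right_ideal: "right_hemiring_ideal (jacobson_radical R) R"
proof (rule right_hemiring_idealI)
  show "\<zero> \<in> jacobson_radical R"
    using semiregular_subset_jacobson_radical[of "{\<zero>}"]
      right_hemiring_idealI[of "{\<zero>}"] by (auto simp: quasi_regular_pair)
next
  fix x y assume "x \<in> jacobson_radical R" "y \<in> jacobson_radical R"
  then obtain L where L: "right_hemiring_ideal L R" "x \<in> L" "y \<in> L" "L \<subseteq> jacobson_radical R"
    by (rule jacobson_radical_obtains)
  then show "x \<oplus> y \<in> jacobson_radical R" using right_hemiring_idealD(3)[OF L(1)] by blast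
next
  fix x r assume "x \<in> jacobson_radical R" "r \<in> carrier R"
  then show "x \<otimes> r \<in> jacobson_radical R"
    unfolding jacobson_radical_eq_Union using right_hemiring_idealD(4) by blast
qed (use right_hemiring_idealD(1) in \<open>auto simp: jacobson_radical_eq_Union\<close>)

lemmas jacobson_radicalD = right_hemiring_idealD[OF jacobson_radical_right_ideal]

text \<open>
  \<open>r J\<close> is a right ideal; it is semiregular by \<open>quasi_regular_commute\<close>, because \<open>J r\<close> is contained
  in \<open>J\<close>.
\<close>

lemma jacobson_radical_left:
  assumes x: "x \<in> jacobson_radical R" and r: "r \<in> carrier R"
  shows "r \<otimes> x \<in> jacobson_radical R"
proof -
  let ?J = "jacobson_radical R"
  have "(\<lambda>y. r \<otimes> y) ` ?J \<subseteq> ?J"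
  proof (rule semiregular_subset_jacobson_radical)
    show "right_hemiring_ideal ((\<lambda>y. r \<otimes> y) ` ?J) R"
    proof (rule right_hemiring_idealI)
      show "\<zero> \<in> (\<lambda>y. r \<otimes> y) ` ?J" using jacobson_radicalD(2) mult_zero[OF r] by (metis imageI)
      show "a \<oplus> b \<in> (\<lambda>y. r \<otimes> y) ` ?J" if "a \<in> (\<lambda>y. r \<otimes> y) ` ?J" "b \<in> (\<lambda>y. r \<otimes> y) ` ?J" for a b
        using that jacobson_radicalD r by (auto simp: distrib_left[symmetric])
      show "a \<otimes> s \<in> (\<lambda>y. r \<otimes> y) ` ?J" if "a \<in> (\<lambda>y. r \<otimes> y) ` ?J" "s \<in> carrier R" for a s
        using that jacobson_radicalD r by (auto simp: mult_assoc)
    qed (use jacobson_radicalD r in auto)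
    fix p assume "p \<in> (\<lambda>y. r \<otimes> y) ` ?J \<times> (\<lambda>y. r \<otimes> y) ` ?J"
    then obtain y z where yz: "p = (r \<otimes> y, r \<otimes> z)" "y \<in> ?J" "z \<in> ?J" by auto
    note c = jacobson_radicalD(1)[OF yz(2)] jacobson_radicalD(1)[OF yz(3)]
    have "(y, z) \<otimes>\<^bsub>pair_hemiring R\<^esub> (r, \<zero>) = (y \<otimes> r, z \<otimes> r)" using c r by (simp add: pair_mult)
    moreover have "quasi_regular R (y \<otimes> r, z \<otimes> r)"
      using yz r jacobson_radicalD by (intro jacobson_radical_quasi_regular) auto
    ultimately have "quasi_regular R ((r, \<zero>) \<otimes>\<^bsub>pair_hemiring R\<^esub> (y, z))"
      using c r by (intro quasi_regular_commute[of "(y, z)" "(r, \<zero>)"]) (simp_all add: pair_in_carrier)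
    then show "quasi_regular R p" using c r by (simp add: pair_mult yz(1))
  qed
  then show ?thesis using x by blast
qed

text \<open>
  A formal difference of elements of \<open>T\<close> has its square in \<open>J\<close>, and \<open>quasi_regular_square\<close> applies.
\<close>

lemma square_in_jacobson_radical:
  assumes T: "right_hemiring_ideal T R"
    and sq: "\<And>s t. s \<in> T \<Longrightarrow> t \<in> T \<Longrightarrow> s \<otimes> t \<in> jacobson_radical R"
  shows "T \<subseteq> jacobson_radical R"
proof (rule semiregular_subset_jacobson_radical[OF T])
  fix p assume p: "p \<in> T \<times> T"
  have "prod.swap (p \<otimes>\<^bsub>pair_hemiring R\<^esub> p) \<in> jacobson_radical R \<times> jacobson_radical R"
    using p sq jacobson_radicalD(3) by (auto simp: pair_mult)
  then show "quasi_regular R p"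
    by (rule quasi_regular_square[OF pair_right_ideal(1)[OF T p] jacobson_radical_quasi_regular])
qed

text \<open>
  \<open>J\<close> is semiprime. From an entry \<open>x\<close> of a matrix in a two-sided ideal, multiplication by other matrices
  produces only the elements \<open>r x s\<close> at a chosen place; this lemma recovers \<open>x\<close>. The two
  factors are removed one after the other, each time by \<open>square_in_jacobson_radical\<close>.
\<close>

lemma sandwich_in_jacobson_radical:
  assumes x: "x \<in> carrier R"
    and rxs: "\<And>r s. r \<in> carrier R \<Longrightarrow> s \<in> carrier R \<Longrightarrow> r \<otimes> x \<otimes> s \<in> jacobson_radical R"
  shows "x \<in> jacobson_radical R"
proof -
  define T where "T = {y \<in> carrier R. \<forall>r\<in>carrier R. r \<otimes> y \<in> jacobson_radical R}"
  have "T \<subseteq> jacobson_radical R"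
  proof (rule square_in_jacobson_radical)
    show "right_hemiring_ideal T R"
      by (rule right_hemiring_idealI)
        (use jacobson_radicalD in \<open>auto simp: T_def distrib_left mult_assoc[symmetric]\<close>)
  qed (auto simp: T_def)
  then have xs: "x \<otimes> s \<in> jacobson_radical R" if "s \<in> carrier R" for s
    using that x rxs by (auto simp: T_def mult_assoc)
  define U where "U = {y \<in> carrier R. \<forall>s\<in>carrier R. y \<otimes> s \<in> jacobson_radical R}"
  have "U \<subseteq> jacobson_radical R"
  proof (rule square_in_jacobson_radical)
    show "right_hemiring_ideal U R"
      by (rule right_hemiring_idealI)
        (use jacobson_radicalD in \<open>auto simp: U_def distrib_right mult_assoc\<close>)
  qed (auto simp: U_def)
  then show ?thesis using x xs by (auto simp: U_def)
qed

end

text \<open>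
  On matrices with only row \<open>p\<close>, multiplication from the left by another such matrix \<open>A\<close> is
  multiplication by its entry \<open>A\<^sub>p\<^sub>p\<close>. So a quasi-inverse of \<open>A\<^sub>p\<^sub>p\<close> in \<open>R\<close> yields one of \<open>A\<close>, column by
  column, by \<open>balanced_solution\<close>.
\<close>

lemma row_in_jacobson_radical:
  assumes R: "hemiring R" and p: "p < n"
  shows "{A \<in> matrices n (jacobson_radical R). row_part R n p A = A}
    \<subseteq> jacobson_radical (matrix_hemiring n R)"
proof -
  let ?M = "matrix_hemiring n R" and ?P = "pair_hemiring R"
  interpret R: hemiring R by (rule R)
  interpret M: hemiring ?M by (rule R.hemiring_matrix_hemiring)
  define I where "I = {A \<in> matrices n (jacobson_radical R). row_part R n p A = A}"
  have IM: "A \<in> matrices n (carrier R)" if "A \<in> I" for A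
    using that R.jacobson_radicalD(1) by (auto simp: I_def matrices_def PiE_iff)
  have off_row: "A (i, j) = \<zero>\<^bsub>R\<^esub>" if "A \<in> I" "i < n" "j < n" "i \<noteq> p" for A i j
    using that row_part_entry[of i n j R p A] by (simp add: I_def)
  have I_entry: "A (i, j) \<in> jacobson_radical R" if "A \<in> I" "i < n" "j < n" for A i j
    using that by (auto simp: I_def intro: matrices_entry)
  have II: "A \<in> I" if "A \<in> matrices n (carrier R)" "\<And>i j. i < n \<Longrightarrow> j < n \<Longrightarrow> A (i, j) \<in> jacobson_radical R"
    "\<And>i j. i < n \<Longrightarrow> j < n \<Longrightarrow> i \<noteq> p \<Longrightarrow> A (i, j) = \<zero>\<^bsub>R\<^esub>" for A
  proof -
    have "row_part R n p A = A" using that by (intro R.matrix_eqI[of _ n]) auto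
    then show ?thesis using that by (auto simp: I_def matrices_def PiE_iff)
  qed
  have "I \<subseteq> jacobson_radical ?M"
  proof (rule M.semiregular_subset_jacobson_radical)
    show "right_hemiring_ideal I ?M"
    proof (rule M.right_hemiring_idealI)
      show "A \<in> carrier ?M" if "A \<in> I" for A using IM[OF that] by simp
      show "\<zero>\<^bsub>?M\<^esub> \<in> I" by (rule II) (auto intro: R.jacobson_radicalD(2))
      show "A \<oplus>\<^bsub>?M\<^esub> B \<in> I" if "A \<in> I" "B \<in> I" for A B
        using IM[OF that(1)] IM[OF that(2)] I_entry[OF that(1)] I_entry[OF that(2)]
          off_row[OF that(1)] off_row[OF that(2)] R.jacobson_radicalD(3)
        by (intro II) auto
    next
      fix A B assume A: "A \<in> I" and "B \<in> carrier ?M"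
      then have B: "B \<in> matrices n (carrier R)" by simp
      show "A \<otimes>\<^bsub>?M\<^esub> B \<in> I"
      proof (rule II)
        fix i j assume ij: "i < n" "j < n"
        have "(\<Oplus>\<^bsub>R\<^esub>k\<in>{..<n}. A (i, k) \<otimes>\<^bsub>R\<^esub> B (k, j)) \<in> jacobson_radical R"
          by (rule R.finsum_mem_submonoid)
            (use A ij I_entry matrices_entry[OF B] R.jacobson_radicalD in auto)
        then show "(A \<otimes>\<^bsub>?M\<^esub> B) (i, j) \<in> jacobson_radical R" using ij by (simp add: matrix_mult_entry)
        assume "i \<noteq> p"
        then show "(A \<otimes>\<^bsub>?M\<^esub> B) (i, j) = \<zero>\<^bsub>R\<^esub>"
          using ij off_row[OF A] matrices_entry[OF B]
          by (auto simp: matrix_mult_entry intro!: R.add.finprod_one_eqI)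
      qed (use IM A B in auto)
    qed
  next
    fix a assume "a \<in> I \<times> I"
    then obtain A B where a: "a = (A, B)" and AB: "A \<in> I" "B \<in> I" by auto
    note AM = IM[OF AB(1)] and BM = IM[OF AB(2)]
    define g where "g j = (A (p, j), B (p, j))" for j
    have gP: "g j \<in> carrier ?P" if "j < n" for j
      using that p matrices_entry[OF AM] matrices_entry[OF BM] by (simp add: g_def pair_in_carrier)
    have "g p \<in> jacobson_radical R \<times> jacobson_radical R"
      using AB I_entry p by (simp add: g_def)
    then have "quasi_regular R (g p)" by (rule R.jacobson_radical_quasi_regular)
    then obtain q where q: "q \<in> carrier ?P" "balanced (g p \<oplus>\<^bsub>?P\<^esub> q \<oplus>\<^bsub>?P\<^esub> g p \<otimes>\<^bsub>?P\<^esub> q)"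
      by (auto simp: quasi_regular_def)
    define x where "x j = prod.swap (g j \<oplus>\<^bsub>?P\<^esub> q \<otimes>\<^bsub>?P\<^esub> g j)" for j
    have xP: "x j \<in> carrier ?P" if "j < n" for j
    proof -
      interpret P: hemiring ?P by (rule R.hemiring_pair_hemiring)
      show ?thesis unfolding x_def using gP[OF that] q(1) by (intro R.swap_closed) simp
    qed
    then have x_fst: "fst (x j) \<in> carrier R" and x_snd: "snd (x j) \<in> carrier R" if "j < n" for j
      using that by (auto simp: pair_carrier mem_Times_iff)
    define X where "X = (\<lambda>(i, j)\<in>{..<n} \<times> {..<n}. if i = p then fst (x j) else \<zero>\<^bsub>R\<^esub>)"
    define Y where "Y = (\<lambda>(i, j)\<in>{..<n} \<times> {..<n}. if i = p then snd (x j) else \<zero>\<^bsub>R\<^esub>)"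
    have XY: "X \<in> matrices n (carrier R)" "Y \<in> matrices n (carrier R)"
      unfolding X_def Y_def using x_fst x_snd by (auto intro!: matrices_restrictI)
    have XY_entry: "X (i, j) = (if i = p then fst (x j) else \<zero>\<^bsub>R\<^esub>)"
      "Y (i, j) = (if i = p then snd (x j) else \<zero>\<^bsub>R\<^esub>)" if "i < n" "j < n" for i j
      using that by (simp_all add: X_def Y_def)
    have mult: "(C \<otimes>\<^bsub>?M\<^esub> Z) (i, j) = C (i, p) \<otimes>\<^bsub>R\<^esub> Z (p, j)"
      if "C \<in> matrices n (carrier R)" "Z = X \<or> Z = Y" "i < n" "j < n" for C Z i j
    proof -
      have "Z (k, j) \<in> carrier R" "k \<noteq> p \<Longrightarrow> Z (k, j) = \<zero>\<^bsub>R\<^esub>" if "k < n" for k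
        using that \<open>Z = X \<or> Z = Y\<close> \<open>j < n\<close> x_fst x_snd by (auto simp: XY_entry)
      then show ?thesis
        using that p matrices_entry[OF that(1)]
        by (simp only: matrix_mult_entry) (rule R.finsum_only[where k = p], auto)
    qed
    have "A \<oplus>\<^bsub>?M\<^esub> X \<oplus>\<^bsub>?M\<^esub> (A \<otimes>\<^bsub>?M\<^esub> X \<oplus>\<^bsub>?M\<^esub> B \<otimes>\<^bsub>?M\<^esub> Y) = B \<oplus>\<^bsub>?M\<^esub> Y \<oplus>\<^bsub>?M\<^esub> (A \<otimes>\<^bsub>?M\<^esub> Y \<oplus>\<^bsub>?M\<^esub> B \<otimes>\<^bsub>?M\<^esub> X)"
    proof (rule R.matrix_eqI[of _ n])
      fix i j assume ij: "i < n" "j < n"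
      show "(A \<oplus>\<^bsub>?M\<^esub> X \<oplus>\<^bsub>?M\<^esub> (A \<otimes>\<^bsub>?M\<^esub> X \<oplus>\<^bsub>?M\<^esub> B \<otimes>\<^bsub>?M\<^esub> Y)) (i, j) =
        (B \<oplus>\<^bsub>?M\<^esub> Y \<oplus>\<^bsub>?M\<^esub> (A \<otimes>\<^bsub>?M\<^esub> Y \<oplus>\<^bsub>?M\<^esub> B \<otimes>\<^bsub>?M\<^esub> X)) (i, j)"
      proof (cases "i = p")
        case True
        have "balanced (g j \<oplus>\<^bsub>?P\<^esub> x j \<oplus>\<^bsub>?P\<^esub> g p \<otimes>\<^bsub>?P\<^esub> x j)"
          unfolding x_def by (rule R.balanced_solution[OF gP[OF p] q(1) gP[OF ij(2)] q(2)])
        then show ?thesis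
          using True ij p AM BM
          by (cases "x j") (simp add: mult XY_entry g_def pair_add pair_mult balanced_def)
      next
        case False
        then show ?thesis
          using ij p AM BM AB x_fst x_snd by (simp add: mult XY_entry off_row)
      qed
    qed (use AM BM XY in auto)
    then show "quasi_regular ?M a"
      using XY unfolding a quasi_regular_pair by auto
  qed
  then show ?thesis by (simp add: I_def)
qed

text \<open>
  In one direction, for a matrix \<open>A\<close> in the radical and all \<open>r\<close> and \<open>s\<close>, the single-entry matrix
  \<open>(r e\<^sub>i\<^sub>i) A (s e\<^sub>j\<^sub>i) = (r A\<^sub>i\<^sub>j s) e\<^sub>i\<^sub>i\<close> is in the radical too, and the elements \<open>y\<close> for which \<open>y e\<^sub>i\<^sub>i\<close> is
  in the radical form a semiregular right ideal \<open>I\<close> of \<open>R\<close>.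
\<close>

theorem jacobson_radical_matrix_hemiring:
  assumes R: "hemiring R"
  shows "jacobson_radical (matrix_hemiring n R) = matrices n (jacobson_radical R)"
proof (intro equalityI subsetI)
  let ?M = "matrix_hemiring n R"
  interpret R: hemiring R by (rule R)
  interpret M: hemiring ?M by (rule R.hemiring_matrix_hemiring)
  note MD = M.jacobson_radicalD
  {
    fix A assume A: "A \<in> jacobson_radical ?M"
    then have AM: "A \<in> matrices n (carrier R)" using MD(1) by simp
    have "A (i, j) \<in> jacobson_radical R" if ij: "i < n" "j < n" for i j
    proof (rule R.sandwich_in_jacobson_radical)
      show Aij: "A (i, j) \<in> carrier R" using AM ij by (rule matrices_entry)
      let ?e = "matrix_unit R n i i"
      define I where "I = {y \<in> carrier R. ?e y \<in> jacobson_radical ?M}"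
      have "I \<subseteq> jacobson_radical R"
      proof (rule R.semiregular_subset_jacobson_radical)
        show "right_hemiring_ideal I R"
        proof (rule R.right_hemiring_idealI)
          show "\<zero>\<^bsub>R\<^esub> \<in> I" using MD(2) by (simp add: I_def R.unit_zero)
          show "y \<oplus>\<^bsub>R\<^esub> z \<in> I" if "y \<in> I" "z \<in> I" for y z
            using that MD(3) by (simp add: I_def R.unit_add)
          show "y \<otimes>\<^bsub>R\<^esub> r \<in> I" if "y \<in> I" "r \<in> carrier R" for y r
            using that MD(4)[of "?e y" "?e r"] ij by (simp add: I_def R.unit_mult_unit)
        qed (simp add: I_def)
        fix p assume "p \<in> I \<times> I"
        then obtain y z where p: "p = (y, z)" and yz: "y \<in> carrier R" "z \<in> carrier R"
          "?e y \<in> jacobson_radical ?M" "?e z \<in> jacobson_radical ?M" by (auto simp: I_def)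
        have "quasi_regular ?M (?e y, ?e z)"
          using yz by (intro M.jacobson_radical_quasi_regular) simp
        then obtain C D where CD: "C \<in> matrices n (carrier R)" "D \<in> matrices n (carrier R)"
          and eq: "?e y \<oplus>\<^bsub>?M\<^esub> C \<oplus>\<^bsub>?M\<^esub> (?e y \<otimes>\<^bsub>?M\<^esub> C \<oplus>\<^bsub>?M\<^esub> ?e z \<otimes>\<^bsub>?M\<^esub> D) =
            ?e z \<oplus>\<^bsub>?M\<^esub> D \<oplus>\<^bsub>?M\<^esub> (?e y \<otimes>\<^bsub>?M\<^esub> D \<oplus>\<^bsub>?M\<^esub> ?e z \<otimes>\<^bsub>?M\<^esub> C)"
          by (auto simp: quasi_regular_pair)
        \<comment> \<open>The entry at \<open>(i, i)\<close> of this equation is the one needed in \<open>R\<close>.\<close>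
        have "(?e y \<oplus>\<^bsub>?M\<^esub> C \<oplus>\<^bsub>?M\<^esub> (?e y \<otimes>\<^bsub>?M\<^esub> C \<oplus>\<^bsub>?M\<^esub> ?e z \<otimes>\<^bsub>?M\<^esub> D)) (i, i) =
          (?e z \<oplus>\<^bsub>?M\<^esub> D \<oplus>\<^bsub>?M\<^esub> (?e y \<otimes>\<^bsub>?M\<^esub> D \<oplus>\<^bsub>?M\<^esub> ?e z \<otimes>\<^bsub>?M\<^esub> C)) (i, i)"
          by (simp only: eq)
        then show "quasi_regular R p"
          unfolding p quasi_regular_pair
          using ij yz CD matrices_entry[OF CD(1)] matrices_entry[OF CD(2)]
          by (intro bexI[of _ "C (i, i)"] bexI[of _ "D (i, i)"]) (auto simp: R.unit_mult_matrix_entry)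
      qed
      moreover have "r \<otimes>\<^bsub>R\<^esub> A (i, j) \<otimes>\<^bsub>R\<^esub> s \<in> I" if rs: "r \<in> carrier R" "s \<in> carrier R" for r s
      proof -
        have "?e r \<otimes>\<^bsub>?M\<^esub> A \<otimes>\<^bsub>?M\<^esub> matrix_unit R n j i s \<in> jacobson_radical ?M"
          using A rs by (intro MD(4) M.jacobson_radical_left) simp_all
        moreover have "?e r \<otimes>\<^bsub>?M\<^esub> A \<otimes>\<^bsub>?M\<^esub> matrix_unit R n j i s = ?e (r \<otimes>\<^bsub>R\<^esub> A (i, j) \<otimes>\<^bsub>R\<^esub> s)"
          using AM ij rs Aij
          by (intro R.matrix_eqI[of _ n]) (auto simp: R.unit_mult_matrix_entry R.matrix_mult_unit_entry)
        ultimately show ?thesis using rs Aij by (simp add: I_def)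
      qed
      ultimately show "r \<otimes>\<^bsub>R\<^esub> A (i, j) \<otimes>\<^bsub>R\<^esub> s \<in> jacobson_radical R"
        if "r \<in> carrier R" "s \<in> carrier R" for r s using that by blast
    qed
    then show "A \<in> matrices n (jacobson_radical R)" using AM by (auto simp: matrices_def PiE_iff)
  }
  fix A assume A: "A \<in> matrices n (jacobson_radical R)"
  then have AM: "A \<in> matrices n (carrier R)"
    using R.jacobson_radicalD(1) by (auto simp: matrices_def PiE_iff)
  show "A \<in> jacobson_radical ?M"
  proof (rule R.matrix_mem_submonoid[OF AM])
    show "jacobson_radical ?M \<subseteq> matrices n (carrier R)" using MD(1) by auto
    fix p q assume pq: "p < n" "q < n"
    have r: "A (p, q) \<in> jacobson_radical R" using A pq by (rule matrices_entry)
    have "matrix_unit R n p q (A (p, q)) \<in> matrices n (jacobson_radical R)"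
      unfolding matrix_unit_def using r R.jacobson_radicalD(2) by (auto intro!: matrices_restrictI)
    then show "matrix_unit R n p q (A (p, q)) \<in> jacobson_radical ?M"
      using row_in_jacobson_radical[OF R pq(1)] R.row_part_unit R.jacobson_radicalD(1)[OF r] by blast
  qed (use MD in auto)
qed

section \<open>The three radicals\<close>

theorem corollary5p11:
  fixes R :: "('a, 'b) ring_scheme" and n :: nat
  assumes "hemiring R" and "n \<ge> 1"
  shows "brown_mccoy_radical (matrix_hemiring n R) = matrices n (brown_mccoy_radical R) \<and>
         Js (matrix_hemiring n R) = matrices n (Js R) \<and>
         jacobson_radical (matrix_hemiring n R) = matrices n (jacobson_radical R)"
  using brown_mccoy_radical_matrix_hemiring[OF assms] Js_matrix_hemiring[OF assms]
    jacobson_radical_matrix_hemiring[OF assms(1)] by blast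

end
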